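(* Let $P=\langle x_1,\ldots ,x_n\mid r_1,\ldots ,r_m\rangle$ be a finite presentation where each $r_i$ contains all the generators. If $P$ is DR in all directions, then any proper subset $S$ of $\{x_1,\ldots ,x_n\}$ generates a free subgroup of $G(P)$ with basis $S$.
   Context: For a presentation $P=\langle x_1,\ldots ,x_n\mid r_1,\ldots ,r_m\rangle$, $K(P)$ is the 2-complex with one vertex, one oriented edge for each generator, and one 2-cell for each relator, attached along the relator word; $G(P)=\pi_1(K(P))$ is the group presented by $P$. A map between 2-complexes is combinatorial if it maps open cells homeomorphically to open cells. A spherical diagram over $K(P)$ is a combinatorial map $f\colon C\to K(P)$ where $C$ is a 2-sphere with a cell structure. The label of a cell $c$ of $C$ is $f(c)$; an edge is thus labeled by a generator. A folding edge of $C$ is an edge $e$ such that the two 2-cells of $C$ that contain $e$ in their boundary map to the same 2-cell of $K(P)$ with opposite orientations by folding over $e$ (the two cells are mirror images of each other across $e$: in both, $e$ corresponds to the same letter position of the relator). $P$ is DR in all directions if, for each $i=1,\ldots ,n$, every spherical diagram $f\colon C\to K(P)$ that contains an edge labeled $x_i$ also contains a folding edge with label $x_i$. *)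

theory Defs
  imports "HOL-Algebra.Generated_Groups" "HOL-Combinatorics.Orbits"
begin

section \<open>Free groups and presentations\<close>

text \<open>The letter \<open>(x, True)\<close> stands for \<open>x\<close> and \<open>(x, False)\<close> for its formal inverse.\<close>

type_synonym 'a letter = "'a \<times> bool"
type_synonym 'a word = "'a letter list"

definition inv_letter :: "'a letter \<Rightarrow> 'a letter" where
  "inv_letter a = (fst a, \<not> snd a)"

fun reduced :: "'a word \<Rightarrow> bool" where
  "reduced (a # b # w) \<longleftrightarrow> b \<noteq> inv_letter a \<and> reduced (b # w)"
| "reduced _ \<longleftrightarrow> True"

fun cons_red :: "'a letter \<Rightarrow> 'a word \<Rightarrow> 'a word" where
  "cons_red a [] = [a]"
| "cons_red a (b # w) = (if b = inv_letter a then w else a # b # w)"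

definition reduce :: "'a word \<Rightarrow> 'a word" where
  "reduce w = foldr cons_red w []"

text \<open>For reduced \<open>v\<close>, the product below is the reduced form of the concatenation \<open>u @ v\<close>.\<close>

definition free_group :: "'a set \<Rightarrow> 'a word monoid" where
  "free_group X =
     \<lparr>carrier = {w. set w \<subseteq> X \<times> UNIV \<and> reduced w},
      monoid.mult = (\<lambda>u v. foldr cons_red u v), one = []\<rparr>"

definition normal_closure :: "('g, 'm) monoid_scheme \<Rightarrow> 'g set \<Rightarrow> 'g set" where
  "normal_closure G A =
     generate G {g \<otimes>\<^bsub>G\<^esub> a \<otimes>\<^bsub>G\<^esub> inv\<^bsub>G\<^esub> g | g a. g \<in> carrier G \<and> a \<in> A}"

text \<open>Relators form a list, and may be arbitrary words: equal relators at different list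
  positions give different 2-cells of \<open>K(P)\<close>, and relators need not be (cyclically) reduced.\<close>

record 'a presentation =
  gens :: "'a set"
  rels :: "'a word list"

definition finite_presentation :: "'a presentation \<Rightarrow> bool" where
  "finite_presentation P \<longleftrightarrow> finite (gens P) \<and> (\<forall>r \<in> set (rels P). set r \<subseteq> gens P \<times> UNIV)"

definition presented_group :: "'a presentation \<Rightarrow> 'a word set monoid" where
  "presented_group P =
     free_group (gens P) Mod normal_closure (free_group (gens P)) (reduce ` set (rels P))"

definition gen_class :: "'a presentation \<Rightarrow> 'a \<Rightarrow> 'a word set" where
  "gen_class P x =
     normal_closure (free_group (gens P)) (reduce ` set (rels P)) #>\<^bsub>free_group (gens P)\<^esub> [(x, True)]"

definition word_eval :: "('g, 'm) monoid_scheme \<Rightarrow> ('a \<Rightarrow> 'g) \<Rightarrow> 'a word \<Rightarrow> 'g" where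
  "word_eval G \<phi> w =
     foldr (\<lambda>a g. (if snd a then \<phi> (fst a) else inv\<^bsub>G\<^esub> \<phi> (fst a)) \<otimes>\<^bsub>G\<^esub> g) w \<one>\<^bsub>G\<^esub>"

text \<open>The subgroup of \<open>G\<close> generated by the family \<open>\<phi> x\<close>, \<open>x \<in> S\<close>, is free with that family as
  basis (in particular, \<open>\<phi>\<close> is injective on \<open>S\<close>).\<close>

definition freely_generates :: "('g, 'm) monoid_scheme \<Rightarrow> ('a \<Rightarrow> 'g) \<Rightarrow> 'a set \<Rightarrow> bool" where
  "freely_generates G \<phi> S \<longleftrightarrow>
     word_eval G \<phi> \<in> iso (free_group S) (G\<lparr>carrier := generate G (\<phi> ` S)\<rparr>)"


section \<open>Cell structures on the 2-sphere\<close>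

text \<open>
  A cell structure, with at least one edge, on an oriented closed surface is encoded by its finite
  set of darts (oriented edges), the fixed-point-free involution \<open>opp\<close> reversing a dart, and the
  permutation \<open>nxt\<close> sending a dart to its successor on the boundary of the 2-cell to its left.
  The 1-cells are the pairs \<open>{d, opp d}\<close>, the 2-cells are the orbits of \<open>nxt\<close>, and the 0-cells are
  the orbits of \<open>nxt \<circ> opp\<close>, which permutes the darts with a given origin cyclically.
  The surface is a 2-sphere iff it is connected and has Euler characteristic 2. Loops, multiple
  edges, vertices of degree one and 2-cells meeting an edge from both sides are all allowed.
  As there are only finitely many darts, taking them in \<open>nat\<close> is no restriction.
  The only cell structure on the sphere left out is the one with no edges, which is irrelevant for
  diagrams required to contain an edge with a given label.
\<close>

record cell_structure =
  darts :: "nat set"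
  opp :: "nat \<Rightarrow> nat"
  nxt :: "nat \<Rightarrow> nat"

definition cells0 :: "cell_structure \<Rightarrow> nat set set" where
  "cells0 C = orbit (nxt C \<circ> opp C) ` darts C"

definition cells1 :: "cell_structure \<Rightarrow> nat set set" where
  "cells1 C = (\<lambda>d. {d, opp C d}) ` darts C"

definition cells2 :: "cell_structure \<Rightarrow> nat set set" where
  "cells2 C = orbit (nxt C) ` darts C"

definition closed_surface :: "cell_structure \<Rightarrow> bool" where
  "closed_surface C \<longleftrightarrow>
     finite (darts C) \<and> opp C permutes darts C \<and> nxt C permutes darts C \<and>
     (\<forall>d \<in> darts C. opp C d \<noteq> d \<and> opp C (opp C d) = d)"

definition connected_surface :: "cell_structure \<Rightarrow> bool" where
  "connected_surface C \<longleftrightarrow>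
     (\<forall>d \<in> darts C. \<forall>d' \<in> darts C.
        (d, d') \<in> {(a, b). a \<in> darts C \<and> (b = opp C a \<or> b = nxt C a)}\<^sup>*)"

definition euler_char :: "cell_structure \<Rightarrow> int" where
  "euler_char C = int (card (cells0 C)) - int (card (cells1 C)) + int (card (cells2 C))"

definition sphere_structure :: "cell_structure \<Rightarrow> bool" where
  "sphere_structure C \<longleftrightarrow> closed_surface C \<and> connected_surface C \<and> euler_char C = 2"


section \<open>Spherical diagrams over \<open>K(P)\<close>\<close>

text \<open>
  The oriented edges of \<open>K(P)\<close> are the letters over the generators. A side \<open>(j, p, \<epsilon>)\<close> is the
  \<open>p\<close>-th boundary edge of the 2-cell attached along the \<open>j\<close>-th relator, where the boundary is
  traversed in the direction of the relator if \<open>\<epsilon>\<close> and backwards otherwise.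
\<close>

type_synonym side = "nat \<times> nat \<times> bool"

definition sides :: "'a presentation \<Rightarrow> side set" where
  "sides P = {(j, p, e). j < length (rels P) \<and> p < length (rels P ! j)}"

fun side_letter :: "'a presentation \<Rightarrow> side \<Rightarrow> 'a letter" where
  "side_letter P (j, p, e) = (if e then rels P ! j ! p else inv_letter (rels P ! j ! p))"

fun side_next :: "'a presentation \<Rightarrow> side \<Rightarrow> side" where
  "side_next P (j, p, e) =
     (let l = length (rels P ! j) in (j, (if e then p + 1 else p + l - 1) mod l, e))"

text \<open>
  A combinatorial map \<open>f: C \<rightarrow> K(P)\<close> is given by the side of a 2-cell of \<open>K(P)\<close> to which a dart,
  seen as a side of the 2-cell on its left, is mapped. The dart itself then goes to the oriented
  edge \<open>side_letter P (f d)\<close>, and the two sides of an edge have to agree on this. Injectivity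
  on each \<open>nxt\<close>-orbit says that open 2-cells are mapped homeomorphically, not as branched covers.
\<close>

definition combinatorial_map :: "'a presentation \<Rightarrow> cell_structure \<Rightarrow> (nat \<Rightarrow> side) \<Rightarrow> bool" where
  "combinatorial_map P C f \<longleftrightarrow>
     (\<forall>d \<in> darts C.
        f d \<in> sides P \<and>
        f (nxt C d) = side_next P (f d) \<and>
        side_letter P (f (opp C d)) = inv_letter (side_letter P (f d))) \<and>
     (\<forall>c \<in> cells2 C. inj_on f c)"

definition spherical_diagram :: "'a presentation \<Rightarrow> cell_structure \<Rightarrow> (nat \<Rightarrow> side) \<Rightarrow> bool" where
  "spherical_diagram P C f \<longleftrightarrow> sphere_structure C \<and> combinatorial_map P C f"

definition edge_label :: "'a presentation \<Rightarrow> (nat \<Rightarrow> side) \<Rightarrow> nat \<Rightarrow> 'a" where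
  "edge_label P f d = fst (side_letter P (f d))"

text \<open>The 2-cells on the two sides of the edge \<open>{d, opp d}\<close> map to the same 2-cell of \<open>K(P)\<close>, with
  opposite orientations, and the edge is at the same position of the relator in both.\<close>

definition folding_edge :: "cell_structure \<Rightarrow> (nat \<Rightarrow> side) \<Rightarrow> nat \<Rightarrow> bool" where
  "folding_edge C f d \<longleftrightarrow> (\<exists>j p e. f d = (j, p, e) \<and> f (opp C d) = (j, p, \<not> e))"

definition DR_in_all_directions :: "'a presentation \<Rightarrow> bool" where
  "DR_in_all_directions P \<longleftrightarrow>
     (\<forall>x \<in> gens P. \<forall>C f. spherical_diagram P C f \<longrightarrow>
        (\<exists>d \<in> darts C. edge_label P f d = x) \<longrightarrow>
        (\<exists>d \<in> darts C. edge_label P f d = x \<and> folding_edge C f d))"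

end

theory Submission
  imports Defs
begin

text \<open>
  Let \<open>w\<close> be a reduced word over \<open>S\<close> that is trivial in \<open>G(P)\<close>. It is a product of conjugates of
  relators, so it is the boundary word of a planar (van Kampen) diagram over \<open>K(P)\<close>
  (\<open>bounds_normal_closure\<close>). Choose such a diagram with the fewest edges, and fix a generator \<open>x\<close>
  outside \<open>S\<close>. Gluing the diagram to its mirror image along the boundary yields spherical diagrams. If
  the diagram has a 2-cell, then it has an edge labelled \<open>x\<close>, as all relators contain \<open>x\<close>; so the double
  has a folding edge labelled \<open>x\<close>. No edge of the boundary is labelled \<open>x\<close>, so that the folding edge lies
  in the interior of one of the two copies. Removing the two mirror-image 2-cells at this edge and
  sewing up the hole gives a diagram for \<open>w\<close> with fewer edges (\<open>fold_reduces\<close>), a contradiction.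
  Hence there are no 2-cells (\<open>minimal_diagram_no_inner\<close>), the diagram is a tree, and a closed path
  around a tree with at least one edge backtracks (\<open>one_face_diagram_not_reduced\<close>). So \<open>w\<close> is empty.

  The topology of surfaces enters through two permutations of the darts, whose cycles are the faces
  and the edges. Joining or cutting faces, and gluing edges, is multiplication of one of the permutations
  with a transposition. This changes the number of cycles by one (\<open>eqv_transposition\<close>), so its effect on
  \<open>defect\<close>, which is twice the number of components minus the Euler characteristic, can be read
  off (\<open>defect_transposition\<close>). The defect is never negative (\<open>defect_nonneg\<close>), and a pair of
  permutations is called planar if it vanishes. All constructions preserve planarity. Diagrams may be
  disconnected and boundaries need not be simple closed curves: when sewing up a boundary pinches
  off a sphere, the defect being additive and nonnegative guarantees that all pieces are still planar.
\<close>

section \<open>Counting equivalence classes\<close>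

definition eqv :: "('a \<times> 'a) set \<Rightarrow> ('a \<times> 'a) set" where
  "eqv R = (R \<union> R\<inverse>)\<^sup>*"

text \<open>
  Orbits of a permutation, components of a surface, and the effect of gluing on both are all
  counted with this one function, applied to the graphs of the permutations involved.
\<close>

definition nclasses :: "'a set \<Rightarrow> ('a \<times> 'a) set \<Rightarrow> nat" where
  "nclasses D R = card ((\<lambda>x. eqv R `` {x}) ` D)"

lemma eqv_refl [simp]: "(x, x) \<in> eqv R"
  by (simp add: eqv_def)

lemma eqv_sym: "(x, y) \<in> eqv R \<Longrightarrow> (y, x) \<in> eqv R"
proof -
  have "sym (R \<union> R\<inverse>)" by (auto simp: sym_def)
  then show "(x, y) \<in> eqv R \<Longrightarrow> (y, x) \<in> eqv R"
    unfolding eqv_def using sym_rtrancl by (metis symD)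
qed

lemma eqv_trans: "(x, y) \<in> eqv R \<Longrightarrow> (y, z) \<in> eqv R \<Longrightarrow> (x, z) \<in> eqv R"
  by (simp add: eqv_def)

lemma eqv_base: "(x, y) \<in> R \<Longrightarrow> (x, y) \<in> eqv R"
  by (auto simp: eqv_def)

lemma eqv_least:
  assumes "R \<subseteq> E" and "\<And>x. (x, x) \<in> E" and "\<And>x y. (x, y) \<in> E \<Longrightarrow> (y, x) \<in> E"
    and "\<And>x y z. (x, y) \<in> E \<Longrightarrow> (y, z) \<in> E \<Longrightarrow> (x, z) \<in> E"
  shows "eqv R \<subseteq> E"
proof
  fix p assume "p \<in> eqv R"
  then obtain x y where "p = (x, y)" "(x, y) \<in> (R \<union> R\<inverse>)\<^sup>*" by (cases p) (auto simp: eqv_def)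
  moreover from this(2) have "(x, y) \<in> E"
    by induction (use assms in blast)+
  ultimately show "p \<in> E" by simp
qed

lemma eqv_subset: "R \<subseteq> eqv R' \<Longrightarrow> eqv R \<subseteq> eqv R'"
  by (rule eqv_least) (auto intro: eqv_sym eqv_trans)

lemma eqv_mono: "R \<subseteq> R' \<Longrightarrow> eqv R \<subseteq> eqv R'"
  by (rule eqv_subset) (auto intro: eqv_base)

lemma eqv_class_eq: "eqv R `` {x} = eqv R `` {y} \<longleftrightarrow> (x, y) \<in> eqv R"
  by (auto intro: eqv_sym eqv_trans)

text \<open>
  The usual way to show that two points are inequivalent: exhibit a set that separates them.
\<close>

lemma eqv_in_closed:
  assumes "(x, y) \<in> eqv R" "x \<in> K" "\<And>u v. (u, v) \<in> R \<Longrightarrow> u \<in> K \<longleftrightarrow> v \<in> K"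
  shows "y \<in> K"
proof -
  have "eqv R \<subseteq> {(u, v). u \<in> K \<longleftrightarrow> v \<in> K}"
    by (rule eqv_least) (use assms(3) in auto)
  with assms show ?thesis by auto
qed

lemma eqv_insert:
  "eqv (insert (a, b) R) = eqv R \<union>
     {(x, y). ((x, a) \<in> eqv R \<or> (x, b) \<in> eqv R) \<and> ((y, a) \<in> eqv R \<or> (y, b) \<in> eqv R)}"
  (is "_ = ?E")
proof
  show "eqv (insert (a, b) R) \<subseteq> ?E"
  proof (rule eqv_least)
    show "insert (a, b) R \<subseteq> ?E" by (auto intro: eqv_base)
    show "(x, x) \<in> ?E" for x by simp
    show "(y, x) \<in> ?E" if "(x, y) \<in> ?E" for x y using that eqv_sym by fast
    show "(x, z) \<in> ?E" if "(x, y) \<in> ?E" "(y, z) \<in> ?E" for x y z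
      using that by (auto dest: eqv_sym intro: eqv_trans)
  qed
  have m: "eqv R \<subseteq> eqv (insert (a, b) R)" by (rule eqv_mono) auto
  have ab: "(a, b) \<in> eqv (insert (a, b) R)" by (rule eqv_base) auto
  have to_a: "(x, a) \<in> eqv (insert (a, b) R)" if "(x, a) \<in> eqv R \<or> (x, b) \<in> eqv R" for x
    using that m ab by (meson eqv_sym eqv_trans subsetD)
  show "?E \<subseteq> eqv (insert (a, b) R)"
  proof (rule subsetI)
    fix p assume p: "p \<in> ?E"
    obtain x y where xy: "p = (x, y)" by (cases p)
    show "p \<in> eqv (insert (a, b) R)"
    proof (cases "p \<in> eqv R")
      case True
      with m show ?thesis by blast
    next
      case False
      with p xy have "(x, a) \<in> eqv (insert (a, b) R)" "(y, a) \<in> eqv (insert (a, b) R)"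
        by (auto intro: to_a)
      then show ?thesis unfolding xy by (blast intro: eqv_sym eqv_trans)
    qed
  qed
qed

lemma nclasses_cong: "eqv R = eqv R' \<Longrightarrow> nclasses D R = nclasses D R'"
  by (simp add: nclasses_def)

text \<open>
  Only the classes of \<open>a\<close> and \<open>b\<close> change: they become one class, unless they already coincide.
\<close>

lemma nclasses_insert:
  assumes "finite D" "a \<in> D" "b \<in> D"
  shows "nclasses D R = nclasses D (insert (a, b) R) + (if (a, b) \<in> eqv R then 0 else 1)"
proof (cases "(a, b) \<in> eqv R")
  case True
  then have "eqv (insert (a, b) R) = eqv R"
  proof (intro equalityI)
    show "eqv (insert (a, b) R) \<subseteq> eqv R"
      by (rule eqv_subset) (use True in \<open>auto intro: eqv_base\<close>)
    show "eqv R \<subseteq> eqv (insert (a, b) R)"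
      by (rule eqv_mono) auto
  qed
  with True show ?thesis by (simp add: nclasses_def)
next
  case False
  let ?c = "\<lambda>x. eqv R `` {x}"
  let ?J = "?c a \<union> ?c b"
  let ?C = "?c ` D"
  have new: "eqv (insert (a, b) R) `` {x} = (if x \<in> ?J then ?J else ?c x)" for x
  proof (intro Set.set_eqI)
    fix y
    have "y \<in> eqv (insert (a, b) R) `` {x} \<longleftrightarrow> (x, y) \<in> eqv R \<or> x \<in> ?J \<and> y \<in> ?J"
      unfolding eqv_insert using eqv_sym[of _ _ R] by auto
    moreover have "y \<in> ?J" if "(x, y) \<in> eqv R" "x \<in> ?J"
      using that eqv_trans[of _ x R y] by auto
    ultimately show "y \<in> eqv (insert (a, b) R) `` {x} \<longleftrightarrow> y \<in> (if x \<in> ?J then ?J else ?c x)"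
      by auto
  qed
  have "(\<lambda>x. eqv (insert (a, b) R) `` {x}) ` D = insert ?J (?C - {?c a, ?c b})"
  proof (intro equalityI subsetI)
    fix X assume "X \<in> (\<lambda>x. eqv (insert (a, b) R) `` {x}) ` D"
    then obtain x where x: "x \<in> D" "X = (if x \<in> ?J then ?J else ?c x)" using new by auto
    show "X \<in> insert ?J (?C - {?c a, ?c b})"
    proof (cases "x \<in> ?J")
      case False
      then have "?c x \<noteq> ?c a" "?c x \<noteq> ?c b" by (auto simp: eqv_class_eq intro: eqv_sym)
      with x False show ?thesis by simp
    qed (use x in simp)
  next
    fix X assume X: "X \<in> insert ?J (?C - {?c a, ?c b})"
    show "X \<in> (\<lambda>x. eqv (insert (a, b) R) `` {x}) ` D"
    proof (cases "X = ?J")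
      case True
      then have "X = eqv (insert (a, b) R) `` {a}" using new by auto
      with assms show ?thesis by blast
    next
      case False
      with X obtain x where x: "x \<in> D" "X = ?c x" "?c x \<noteq> ?c a" "?c x \<noteq> ?c b" by auto
      then have "x \<notin> ?J" unfolding eqv_class_eq by (auto intro: eqv_sym)
      with x new show ?thesis by auto
    qed
  qed
  moreover have "?J \<notin> ?C - {?c a, ?c b}"
  proof
    assume "?J \<in> ?C - {?c a, ?c b}"
    then obtain x where x: "?J = ?c x" "?c x \<noteq> ?c a" by blast
    have "a \<in> ?J" by simp
    then have "a \<in> ?c x" using x(1) by simp
    with x(2) show False unfolding eqv_class_eq by simp
  qed
  moreover have "card (?C - {?c a, ?c b}) = card ?C - 2"
  proof -
    have "?c a \<noteq> ?c b" using False eqv_class_eq by metis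
    then show ?thesis using assms by (subst card_Diff_subset) auto
  qed
  moreover have "card ?C \<ge> 2"
  proof -
    have "card {?c a, ?c b} = 2" using False by (simp add: eqv_class_eq)
    moreover have "card {?c a, ?c b} \<le> card ?C" using assms by (intro card_mono) auto
    ultimately show ?thesis by simp
  qed
  ultimately show ?thesis using False assms by (simp add: nclasses_def)
qed

lemma nclasses_disjoint_union:
  assumes "finite D" "finite D'" "D \<inter> D' = {}" "R \<subseteq> D \<times> D" "R' \<subseteq> D' \<times> D'"
  shows "nclasses (D \<union> D') (R \<union> R') = nclasses D R + nclasses D' R'"
proof -
  have half: "eqv (R \<union> R') `` {x} = eqv R `` {x} \<and> eqv (R \<union> R') `` {x} \<subseteq> D"
    if "x \<in> D" "D \<inter> D' = {}" "R \<subseteq> D \<times> D" "R' \<subseteq> D' \<times> D'" for x and D D' :: "'a set" and R R'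
  proof -
    let ?E = "{(u, v). (u \<in> D \<longleftrightarrow> v \<in> D) \<and> (u \<in> D \<longrightarrow> (u, v) \<in> eqv R)}"
    have "eqv (R \<union> R') \<subseteq> ?E"
    proof (rule eqv_least)
      show "R \<union> R' \<subseteq> ?E"
        using that(2-4) by (auto intro: eqv_base)
      show "(u, u) \<in> ?E" for u
        by simp
      show "(v, u) \<in> ?E" if "(u, v) \<in> ?E" for u v
        using that eqv_sym[of u v R] by simp
      show "(u, w) \<in> ?E" if "(u, v) \<in> ?E" "(v, w) \<in> ?E" for u v w
        using that eqv_trans[of u v R w] by simp
    qed
    moreover have "eqv R \<subseteq> eqv (R \<union> R')" by (rule eqv_mono) auto
    ultimately show ?thesis using that(1) by blast
  qed
  have h1: "eqv (R \<union> R') `` {x} = eqv R `` {x}" if "x \<in> D" for x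
    using half[OF that assms(3-5)] by simp
  then have 1: "(\<lambda>x. eqv (R \<union> R') `` {x}) ` D = (\<lambda>x. eqv R `` {x}) ` D"
    by (intro image_cong refl) (simp add: h1)
  have h2: "eqv (R \<union> R') `` {x} = eqv R' `` {x} \<and> eqv (R \<union> R') `` {x} \<subseteq> D'" if "x \<in> D'" for x
  proof -
    have e: "R \<union> R' = R' \<union> R" by (rule Un_commute)
    show ?thesis unfolding e by (rule half[OF that, of D]) (use assms in auto)
  qed
  then have 2: "(\<lambda>x. eqv (R \<union> R') `` {x}) ` D' = (\<lambda>x. eqv R' `` {x}) ` D'"
    by (intro image_cong refl) simp
  have "eqv R `` {x} \<noteq> eqv R' `` {y}" if "x \<in> D" "y \<in> D'" for x y
  proof
    assume e: "eqv R `` {x} = eqv R' `` {y}"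
    have "x \<in> eqv R `` {x}" by simp
    then have "x \<in> eqv (R \<union> R') `` {y}" using e h2[OF that(2)] by simp
    then have "x \<in> D'" using h2[OF that(2)] by blast
    with that assms show False by auto
  qed
  then have "(\<lambda>x. eqv R `` {x}) ` D \<inter> (\<lambda>x. eqv R' `` {x}) ` D' = {}"
    by auto
  then show ?thesis
    unfolding nclasses_def image_Un 1 2 by (intro card_Un_disjoint) (use assms in auto)
qed

lemma nclasses_inj_image:
  assumes "inj h"
  shows "nclasses (h ` D) (map_prod h h ` R) = nclasses D R"
proof -
  let ?R = "map_prod h h ` R"
  have 1: "(h x, h y) \<in> eqv ?R" if "(x, y) \<in> eqv R" for x y
  proof -
    have "eqv R \<subseteq> {(x, y). (h x, h y) \<in> eqv ?R}"
      by (rule eqv_least) (auto intro: eqv_sym eqv_trans eqv_base)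
    with that show ?thesis by auto
  qed
  have 2: "z \<in> h ` (eqv R `` {x})" if "(h x, z) \<in> eqv ?R" for x z
  proof -
    have "eqv ?R \<subseteq> {(u, v). u = v \<or> (\<exists>x y. u = h x \<and> v = h y \<and> (x, y) \<in> eqv R)}"
    proof (rule eqv_least)
      fix x y z
      assume a: "(x, y) \<in> {(u, v). u = v \<or> (\<exists>x y. u = h x \<and> v = h y \<and> (x, y) \<in> eqv R)}"
        "(y, z) \<in> {(u, v). u = v \<or> (\<exists>x y. u = h x \<and> v = h y \<and> (x, y) \<in> eqv R)}"
      then show "(x, z) \<in> {(u, v). u = v \<or> (\<exists>x y. u = h x \<and> v = h y \<and> (x, y) \<in> eqv R)}"
        using injD[OF assms] eqv_trans[of _ _ R] by clarsimp metis
    qed (auto intro: eqv_sym eqv_base)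
    with that have "h x = z \<or> (\<exists>x' y. h x = h x' \<and> z = h y \<and> (x', y) \<in> eqv R)" by blast
    then show ?thesis using injD[OF assms] by auto
  qed
  have "eqv ?R `` {h x} = h ` (eqv R `` {x})" for x
    using 1 2 by auto
  then have "(\<lambda>x. eqv ?R `` {x}) ` h ` D = image h ` (\<lambda>x. eqv R `` {x}) ` D"
    by (simp add: image_image)
  moreover have "inj_on (image h) A" for A
    using assms by (simp add: inj_on_def inj_image_eq_iff)
  ultimately show ?thesis by (simp add: nclasses_def card_image)
qed

lemma eqv_converse: "eqv (R\<inverse>) = eqv R"
  by (simp add: eqv_def Un_commute)

section \<open>Cycles of permutations and transpositions\<close>

definition perm_graph :: "'a set \<Rightarrow> ('a \<Rightarrow> 'a) \<Rightarrow> ('a \<times> 'a) set" where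
  "perm_graph D \<pi> = {(x, \<pi> x) | x. x \<in> D}"

lemma orbit_sub_eqv:
  assumes "\<pi> permutes D" "x \<in> D"
  shows "orbit \<pi> x \<subseteq> eqv (perm_graph D \<pi>) `` {x}"
proof
  fix y assume "y \<in> orbit \<pi> x"
  then have "y \<in> D \<and> (x, y) \<in> eqv (perm_graph D \<pi>)"
  proof induction
    case base
    then show ?case using assms by (auto simp: perm_graph_def permutes_in_image intro: eqv_base)
  next
    case (step y)
    then have "(y, \<pi> y) \<in> eqv (perm_graph D \<pi>)" by (auto simp: perm_graph_def intro: eqv_base)
    with step assms show ?case by (auto simp: permutes_in_image intro: eqv_trans)
  qed
  then show "y \<in> eqv (perm_graph D \<pi>) `` {x}" by simp
qed

lemma self_in_orbit:
  assumes "finite D" "\<pi> permutes D"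
  shows "x \<in> orbit \<pi> x"
  using assms permutation_permutes permutation_self_in_orbit by fast

lemma eqv_perm_graph_iff_orbit:
  assumes "finite D" "\<pi> permutes D" "x \<in> D"
  shows "(x, y) \<in> eqv (perm_graph D \<pi>) \<longleftrightarrow> y \<in> orbit \<pi> x"
proof
  show "y \<in> orbit \<pi> x \<Longrightarrow> (x, y) \<in> eqv (perm_graph D \<pi>)"
    using orbit_sub_eqv[OF assms(2,3)] by auto
  have "eqv (perm_graph D \<pi>) \<subseteq> {(x, y). y \<in> orbit \<pi> x}"
  proof (rule eqv_least)
    show "perm_graph D \<pi> \<subseteq> {(x, y). y \<in> orbit \<pi> x}" by (auto simp: perm_graph_def intro: orbit.base)
    show "(x, x) \<in> {(x, y). y \<in> orbit \<pi> x}" for x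
      using self_in_orbit[OF assms(1,2)] by simp
    then show "(y, x) \<in> {(x, y). y \<in> orbit \<pi> x}" if "(x, y) \<in> {(x, y). y \<in> orbit \<pi> x}" for x y
      using that orbit_swap[of x \<pi> y] by auto
    show "(x, z) \<in> {(x, y). y \<in> orbit \<pi> x}"
      if "(x, y) \<in> {(x, y). y \<in> orbit \<pi> x}" "(y, z) \<in> {(x, y). y \<in> orbit \<pi> x}" for x y z
      using that orbit_trans[of z \<pi> y x] by auto
  qed
  then show "(x, y) \<in> eqv (perm_graph D \<pi>) \<Longrightarrow> y \<in> orbit \<pi> x" by auto
qed

lemma nclasses_perm_graph:
  assumes "finite D" "\<pi> permutes D"
  shows "nclasses D (perm_graph D \<pi>) = card (orbit \<pi> ` D)"
proof -
  have "(\<lambda>x. eqv (perm_graph D \<pi>) `` {x}) ` D = orbit \<pi> ` D"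
    by (intro image_cong refl) (use eqv_perm_graph_iff_orbit[OF assms] in blast)
  then show ?thesis by (simp add: nclasses_def)
qed

text \<open>
  A cycle \<open>(a \<dots> b \<dots>)\<close> is cut in two. Under the new permutation \<open>b\<close> goes to the old
  successor of \<open>a\<close> and then runs along the old cycle, back to \<open>b\<close>, without meeting \<open>a\<close>.
\<close>

lemma orbit_transposition_split:
  assumes "a \<noteq> b" "b \<in> orbit \<pi> a"
  shows "a \<notin> orbit (\<pi> \<circ> Transposition.transpose a b) b"
proof -
  \<comment> \<open>The arc from the successor of \<open>a\<close> to \<open>b\<close> is the set \<open>B\<close> below.\<close>
  define k where "k = (LEAST n. 0 < n \<and> (\<pi> ^^ n) a = b)"
  have ex: "\<exists>n. 0 < n \<and> (\<pi> ^^ n) a = b" using assms(2) by (auto simp: orbit_altdef)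
  have k: "0 < k" "(\<pi> ^^ k) a = b" using LeastI_ex[OF ex] by (auto simp: k_def)
  have least: "(\<pi> ^^ n) a \<noteq> b" if "0 < n" "n < k" for n
    using not_less_Least[of n "\<lambda>n. 0 < n \<and> (\<pi> ^^ n) a = b"] that by (auto simp: k_def)
  have no_a: "(\<pi> ^^ i) a \<noteq> a" if "0 < i" "i \<le> k" for i
  proof
    assume i: "(\<pi> ^^ i) a = a"
    with that k assms have "i < k" by (cases "i = k") auto
    then have "(\<pi> ^^ (k - i)) a = b"
      using k i funpow_add[of "k - i" i \<pi>] by auto
    with least[of "k - i"] that \<open>i < k\<close> show False by auto
  qed
  define B where "B = {(\<pi> ^^ i) a | i. 0 < i \<and> i \<le> k}"
  have B: "(\<pi> \<circ> Transposition.transpose a b) y \<in> B" if "y \<in> B" for y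
  proof -
    from that obtain i where i: "y = (\<pi> ^^ i) a" "0 < i" "i \<le> k" by (auto simp: B_def)
    show ?thesis
    proof (cases "i = k")
      case True
      then have "y = b" using i k by simp
      then have "(\<pi> \<circ> Transposition.transpose a b) y = (\<pi> ^^ 1) a" by simp
      then show ?thesis unfolding B_def using k by fastforce
    next
      case False
      then have "(\<pi> \<circ> Transposition.transpose a b) y = (\<pi> ^^ Suc i) a"
        using i least[of i] no_a[of i] by simp
      then show ?thesis unfolding B_def using i False by fastforce
    qed
  qed
  have "b \<in> B" unfolding B_def using k by auto
  have "y \<in> B" if "y \<in> orbit (\<pi> \<circ> Transposition.transpose a b) b" for y
    using that(1)
  proof (induction rule: orbit.induct)
    case base
    show ?case by (rule B) (rule \<open>b \<in> B\<close>)
  next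
    case (step y)
    show ?case by (rule B) (rule step.IH)
  qed
  moreover have "a \<notin> B"
  proof
    assume "a \<in> B"
    then obtain i where "a = (\<pi> ^^ i) a" "0 < i" "i \<le> k" unfolding B_def by blast
    then show False using no_a[of i] by simp
  qed
  ultimately show ?thesis by blast
qed

text \<open>
  The new permutation sends \<open>a\<close> into the old cycle of \<open>b\<close>, which it then follows up to \<open>b\<close>.
\<close>

lemma orbit_transposition_merge:
  assumes "b \<in> orbit \<pi> b" "a \<notin> orbit \<pi> b"
  shows "b \<in> orbit (\<pi> \<circ> Transposition.transpose a b) a"
proof -
  define n where "n = (LEAST n. 0 < n \<and> (\<pi> ^^ n) b = b)"
  have ex: "\<exists>n. 0 < n \<and> (\<pi> ^^ n) b = b" using assms(1) by (auto simp: orbit_altdef)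
  have n: "0 < n" "(\<pi> ^^ n) b = b" using LeastI_ex[OF ex] by (auto simp: n_def)
  have least: "(\<pi> ^^ i) b \<noteq> b" if "0 < i" "i < n" for i
    using not_less_Least[of i "\<lambda>n. 0 < n \<and> (\<pi> ^^ n) b = b"] that by (auto simp: n_def)
  have "(\<pi> ^^ Suc i) b \<in> orbit (\<pi> \<circ> Transposition.transpose a b) a" if "Suc i \<le> n" for i
    using that
  proof (induction i)
    case 0
    then show ?case
      using orbit.base[of "\<pi> \<circ> Transposition.transpose a b" a] unfolding comp_apply by simp
  next
    case (Suc i)
    have "(\<pi> ^^ Suc i) b \<in> orbit \<pi> b" unfolding orbit_altdef by blast
    then have "(\<pi> ^^ Suc i) b \<noteq> a" using assms(2) by metis
    moreover have "(\<pi> ^^ Suc i) b \<noteq> b" using least[of "Suc i"] Suc by simp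
    ultimately have "(\<pi> ^^ Suc (Suc i)) b = (\<pi> \<circ> Transposition.transpose a b) ((\<pi> ^^ Suc i) b)"
      by simp
    then show ?case using Suc orbit.step by (metis Suc_leD)
  qed
  from this[of "n - 1"] n show ?thesis by simp
qed

lemma permutes_comp_transpose:
  assumes "\<pi> permutes D" "a \<in> D" "b \<in> D"
  shows "\<pi> \<circ> Transposition.transpose a b permutes D"
  using assms by (intro permutes_compose permutes_swap_id)

text \<open>
  The two lemmas above in one: multiplication with a transposition either cuts a cycle or joins
  two, so the number of cycles changes by exactly one. Every change of a defect below is computed
  from this.
\<close>

lemma eqv_transposition:
  assumes "finite D" "\<pi> permutes D" "a \<in> D" "b \<in> D" "a \<noteq> b"
  shows "(a, b) \<in> eqv (perm_graph D (\<pi> \<circ> Transposition.transpose a b)) \<longleftrightarrow> (a, b) \<notin> eqv (perm_graph D \<pi>)"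
proof -
  let ?\<pi> = "\<pi> \<circ> Transposition.transpose a b"
  have p: "?\<pi> permutes D" by (rule permutes_comp_transpose[OF assms(2-4)])
  note eqs = eqv_perm_graph_iff_orbit[OF assms(1) p] eqv_perm_graph_iff_orbit[OF assms(1,2)]
  show ?thesis
  proof (cases "b \<in> orbit \<pi> a")
    case True
    then have "a \<notin> orbit ?\<pi> b" by (rule orbit_transposition_split[OF assms(5)])
    then have "b \<notin> orbit ?\<pi> a" using orbit_swap[OF self_in_orbit[OF assms(1) p]] by blast
    then show ?thesis using True eqs assms by blast
  next
    case False
    then have "a \<notin> orbit \<pi> b" using orbit_swap[OF self_in_orbit[OF assms(1,2)]] by blast
    then have "b \<in> orbit ?\<pi> a"
      by (rule orbit_transposition_merge[OF self_in_orbit[OF assms(1,2)]])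
    then show ?thesis using False eqs assms by blast
  qed
qed

text \<open>
  With \<open>a\<close> and \<open>b\<close> identified, the transposition is invisible. Comparing both sides with
  \<open>nclasses_insert\<close> relates the numbers of classes before and after the multiplication.
\<close>

lemma eqv_insert_transposition:
  assumes "a \<in> D" "b \<in> D"
  shows "eqv (insert (a, b) (perm_graph D (\<pi> \<circ> Transposition.transpose a b) \<union> R)) = eqv (insert (a, b) (perm_graph D \<pi> \<union> R))"
proof -
  have half: "eqv (insert (a, b) (perm_graph D (\<rho> \<circ> Transposition.transpose a b) \<union> R)) \<subseteq> eqv (insert (a, b) (perm_graph D \<rho> \<union> R))"
    for \<rho>
  proof (rule eqv_subset, rule subsetI)
    fix p assume p: "p \<in> insert (a, b) (perm_graph D (\<rho> \<circ> Transposition.transpose a b) \<union> R)"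
    let ?E = "eqv (insert (a, b) (perm_graph D \<rho> \<union> R))"
    have ab: "(a, b) \<in> ?E" by (rule eqv_base) auto
    have g: "(x, \<rho> x) \<in> ?E" if "x \<in> D" for x
      by (rule eqv_base) (use that in \<open>auto simp: perm_graph_def\<close>)
    have "(x, \<rho> (Transposition.transpose a b x)) \<in> ?E" if "x \<in> D" for x
      using g ab assms that eqv_trans eqv_sym
      by (metis transpose_apply_first transpose_apply_other transpose_apply_second)
    moreover have "p \<in> ?E" if "p \<in> insert (a, b) R"
      using that eqv_base[of "fst p" "snd p" "insert (a, b) (perm_graph D \<rho> \<union> R)"] by auto
    ultimately show "p \<in> ?E" using p by (auto simp: perm_graph_def)
  qed
  from half[of \<pi>] half[of "\<pi> \<circ> Transposition.transpose a b"] show ?thesis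
    by (simp add: comp_assoc)
qed

lemma nclasses_transposition:
  assumes "finite D" "\<pi> permutes D" "a \<in> D" "b \<in> D" "a \<noteq> b"
  shows "int (nclasses D (perm_graph D (\<pi> \<circ> Transposition.transpose a b))) =
    int (nclasses D (perm_graph D \<pi>)) + (if (a, b) \<in> eqv (perm_graph D \<pi>) then 1 else -1)"
  using nclasses_insert[OF assms(1,3,4), of "perm_graph D \<pi>"]
    nclasses_insert[OF assms(1,3,4), of "perm_graph D (\<pi> \<circ> Transposition.transpose a b)"]
    nclasses_cong[OF eqv_insert_transposition[OF assms(3,4), of \<pi> "{}"], of D]
    eqv_transposition[OF assms] by (simp split: if_splits)

lemma nclasses_transposition_union:
  assumes "finite D" "a \<in> D" "b \<in> D"
  shows "int (nclasses D (perm_graph D (\<pi> \<circ> Transposition.transpose a b) \<union> R)) 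
       + (if (a, b) \<in> eqv (perm_graph D \<pi> \<union> R) then 0 else 1) =
    int (nclasses D (perm_graph D \<pi> \<union> R)) 
      + (if (a, b) \<in> eqv (perm_graph D (\<pi> \<circ> Transposition.transpose a b) \<union> R) then 0 else 1)"
  using nclasses_insert[OF assms, of "perm_graph D \<pi> \<union> R"]
    nclasses_insert[OF assms, of "perm_graph D (\<pi> \<circ> Transposition.transpose a b) \<union> R"]
    nclasses_cong[OF eqv_insert_transposition[OF assms(2,3), of \<pi> R], of D] by (simp split: if_splits)

section \<open>Planar pairs of permutations\<close>

lemma perm_graph_Un: "perm_graph (D \<union> D') \<pi> = perm_graph D \<pi> \<union> perm_graph D' \<pi>"
  by (auto simp: perm_graph_def)

lemma perm_graph_cong: "(\<And>x. x \<in> D \<Longrightarrow> \<pi> x = \<pi>' x) \<Longrightarrow> perm_graph D \<pi> = perm_graph D \<pi>'"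
  by (auto simp: perm_graph_def)

lemma perm_graph_subset: "\<pi> ` D \<subseteq> D \<Longrightarrow> perm_graph D \<pi> \<subseteq> D \<times> D"
  by (auto simp: perm_graph_def)

lemma eqv_perm_graph_step: "x \<in> D \<Longrightarrow> (x, \<pi> x) \<in> eqv (perm_graph D \<pi>)"
  by (rule eqv_base) (auto simp: perm_graph_def)

lemma perm_graph_id: "eqv (perm_graph D id \<union> R) = eqv R"
proof (intro equalityI eqv_subset)
  show "perm_graph D id \<union> R \<subseteq> eqv R" by (auto simp: perm_graph_def intro: eqv_base)
  show "R \<subseteq> eqv (perm_graph D id \<union> R)" by (auto intro: eqv_base)
qed

text \<open>
  Let \<open>\<pi>\<close> be the permutation of the darts whose cycles are the faces and \<open>\<rho>\<close> the one whose cycles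
  are the edges; then the cycles of \<open>\<pi> \<circ> \<rho>\<close> are the vertices. As \<open>card D\<close> is twice the number of
  edges if \<open>\<rho>\<close> is a fixed-point-free involution, the defect is twice the number of components
  minus the Euler characteristic, that is, twice the total genus. Arbitrary permutations are allowed
  because gluing one edge to another passes through a \<open>\<rho>\<close> that is not an involution.
\<close>

definition defect :: "'a set \<Rightarrow> ('a \<Rightarrow> 'a) \<Rightarrow> ('a \<Rightarrow> 'a) \<Rightarrow> int" where
  "defect D \<pi> \<rho> = 2 * int (nclasses D (perm_graph D \<pi> \<union> perm_graph D \<rho>)) - int (nclasses D (perm_graph D \<pi>))
     - int (nclasses D (perm_graph D \<rho>)) - int (nclasses D (perm_graph D (\<pi> \<circ> \<rho>))) + int (card D)"

text \<open>
  The two products are conjugate by \<open>\<rho>\<close>.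
\<close>

lemma nclasses_comp_commute:
  assumes "\<pi> permutes D" "\<rho> permutes D"
  shows "nclasses D (perm_graph D (\<rho> \<circ> \<pi>)) = nclasses D (perm_graph D (\<pi> \<circ> \<rho>))"
proof -
  have D: "\<rho> ` D = D" using assms(2) by (rule permutes_image)
  have "perm_graph (\<rho> ` D) (\<rho> \<circ> \<pi>) = map_prod \<rho> \<rho> ` perm_graph D (\<pi> \<circ> \<rho>)"
    by (force simp: perm_graph_def)
  then show ?thesis
    using nclasses_inj_image[OF permutes_inj[OF assms(2)], of D "perm_graph D (\<pi> \<circ> \<rho>)"] D by simp
qed

lemma defect_commute:
  assumes "\<pi> permutes D" "\<rho> permutes D"
  shows "defect D \<rho> \<pi> = defect D \<pi> \<rho>"
  using nclasses_comp_commute[OF assms] by (simp add: defect_def Un_commute)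

lemma eqv_comp_subset:
  assumes "\<pi> permutes D" "\<rho> permutes D"
  shows "eqv (perm_graph D (\<pi> \<circ> \<rho>)) \<subseteq> eqv (perm_graph D \<pi> \<union> perm_graph D \<rho>)"
proof (rule eqv_subset, rule subsetI)
  fix p assume "p \<in> perm_graph D (\<pi> \<circ> \<rho>)"
  then obtain x where x: "p = (x, \<pi> (\<rho> x))" "x \<in> D" by (auto simp: perm_graph_def)
  have "(x, \<rho> x) \<in> eqv (perm_graph D \<pi> \<union> perm_graph D \<rho>)" by (rule eqv_base) (use x in \<open>auto simp: perm_graph_def\<close>)
  moreover have "(\<rho> x, \<pi> (\<rho> x)) \<in> eqv (perm_graph D \<pi> \<union> perm_graph D \<rho>)"
    by (rule eqv_base) (use x assms in \<open>auto simp: perm_graph_def permutes_in_image\<close>)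
  ultimately show "p \<in> eqv (perm_graph D \<pi> \<union> perm_graph D \<rho>)" unfolding x by (rule eqv_trans)
qed

text \<open>
  Multiplying \<open>\<rho>\<close> with \<open>(a b)\<close> changes the number of edge cycles and of vertex cycles by one each.
  If both grow, the number of components grows by at most one; if one grows and the other
  drops, then \<open>a\<close> and \<open>b\<close> are connected before and after, and no component is created or lost; if
  both drop, the defect grows unless two components are joined.
\<close>

lemma defect_transposition:
  assumes "finite D" "\<pi> permutes D" "\<rho> permutes D" "a \<in> D" "b \<in> D" "a \<noteq> b"
  shows defect_transposition_le:
      "(a, b) \<in> eqv (perm_graph D \<rho>) \<or> (a, b) \<in> eqv (perm_graph D (\<pi> \<circ> \<rho>)) \<or> (a, b) \<notin> eqv (perm_graph D \<pi> \<union> perm_graph D \<rho>) \<Longrightarrow>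
       defect D \<pi> (\<rho> \<circ> Transposition.transpose a b) \<le> defect D \<pi> \<rho>" (is "?P \<Longrightarrow> ?Q")
    and defect_transposition_ge:
      "(a, b) \<notin> eqv (perm_graph D \<rho>) \<Longrightarrow>
       defect D \<pi> \<rho> \<le> defect D \<pi> (\<rho> \<circ> Transposition.transpose a b)" (is "?R \<Longrightarrow> ?S")
proof -
  let ?\<rho> = "\<rho> \<circ> Transposition.transpose a b"
  have p: "?\<rho> permutes D" by (rule permutes_comp_transpose[OF assms(3-5)])
  have q: "\<pi> \<circ> \<rho> permutes D" by (rule permutes_compose[OF assms(3,2)])
  \<comment> \<open>\<open>A\<close>, \<open>B\<close>, \<open>C\<close>: are \<open>a\<close> and \<open>b\<close> on the same edge, vertex, component; \<open>C'\<close>: same component afterwards.\<close>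
  define A B C C' where "A \<longleftrightarrow> (a, b) \<in> eqv (perm_graph D \<rho>)" and "B \<longleftrightarrow> (a, b) \<in> eqv (perm_graph D (\<pi> \<circ> \<rho>))"
    and "C \<longleftrightarrow> (a, b) \<in> eqv (perm_graph D \<rho> \<union> perm_graph D \<pi>)" and "C' \<longleftrightarrow> (a, b) \<in> eqv (perm_graph D ?\<rho> \<union> perm_graph D \<pi>)"
  note defs = this
  have A: "int (nclasses D (perm_graph D ?\<rho>)) = int (nclasses D (perm_graph D \<rho>)) + (if A then 1 else -1)"
    unfolding defs by (rule nclasses_transposition[OF assms(1,3-6)])
  have B: "int (nclasses D (perm_graph D (\<pi> \<circ> ?\<rho>))) = int (nclasses D (perm_graph D (\<pi> \<circ> \<rho>))) + (if B then 1 else -1)"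
    using nclasses_transposition[OF assms(1) q assms(4-6)] unfolding defs by (simp add: comp_assoc)
  have C: "int (nclasses D (perm_graph D ?\<rho> \<union> perm_graph D \<pi>)) + (if C then 0 else 1) =
      int (nclasses D (perm_graph D \<rho> \<union> perm_graph D \<pi>)) + (if C' then 0 else 1)"
    unfolding defs by (rule nclasses_transposition_union[OF assms(1,4,5)])
  have AC: "A \<Longrightarrow> C" unfolding defs using eqv_mono[of "perm_graph D \<rho>" "perm_graph D \<rho> \<union> perm_graph D \<pi>"] by blast
  have BC: "B \<Longrightarrow> C" unfolding defs using eqv_comp_subset[OF assms(2,3)] by (auto simp: Un_commute)
  have AC': "\<not> A \<Longrightarrow> C'"
    unfolding defs using eqv_mono[of "perm_graph D ?\<rho>" "perm_graph D ?\<rho> \<union> perm_graph D \<pi>"] eqv_transposition[OF assms(1,3-6)]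
    by blast
  have BC': "\<not> B \<Longrightarrow> C'"
    using eqv_comp_subset[OF assms(2) p] eqv_transposition[OF assms(1) q assms(4-6)]
    unfolding defs comp_assoc by (auto simp: Un_commute)
  have "?P \<longleftrightarrow> A \<or> B \<or> \<not> C" unfolding defs by (simp add: Un_commute)
  then show "?P \<Longrightarrow> ?Q"
    using A B C AC BC AC' BC' unfolding defect_def Un_commute[of "perm_graph D \<pi>"]
    by (auto split: if_splits)
  show "?R \<Longrightarrow> ?S"
    unfolding A_def[symmetric]
    using A B C AC BC AC' BC' unfolding defect_def Un_commute[of "perm_graph D \<pi>"]
    by (auto split: if_splits)
qed

lemma nclasses_id: "nclasses D (perm_graph D id) = card D"
proof -
  have "eqv (perm_graph D id \<union> {}) = Id" unfolding perm_graph_id by (simp add: eqv_def)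
  then show ?thesis by (simp add: nclasses_def card_image)
qed

lemma defect_id: "defect D \<pi> id = 0"
  using nclasses_cong[OF perm_graph_id, of D D "perm_graph D \<pi>"] nclasses_id[of D]
  by (simp add: defect_def Un_commute)

text \<open>
  The genus is not negative. By cutting fixed points off the cycles of \<open>\<rho>\<close> one reaches the identity,
  where the defect vanishes. Read backwards, every step joins two cycles of \<open>\<rho>\<close>, and such a step
  does not lower the defect. This inequality replaces all appeals to the Jordan curve theorem.
\<close>

lemma defect_nonneg:
  assumes "finite D" "\<pi> permutes D" "\<rho> permutes D"
  shows "0 \<le> defect D \<pi> \<rho>"
  using assms(3)
proof (induction "card {x \<in> D. \<rho> x \<noteq> x}" arbitrary: \<rho> rule: less_induct)
  case less
  show ?case
  proof (cases "\<rho> = id")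
    case True
    then show ?thesis by (simp add: defect_id)
  next
    case False
    then obtain a where "\<rho> a \<noteq> a" by (auto simp: fun_eq_iff)
    define b where "b = \<rho> a"
    have a: "a \<in> D" "b \<in> D" "a \<noteq> b"
      using \<open>\<rho> a \<noteq> a\<close> less.prems by (auto simp: b_def permutes_in_image dest: permutes_not_in)
    have b: "\<rho> b \<noteq> b" using a less.prems by (metis b_def permutes_inj injD)
    \<comment> \<open>\<open>\<rho>'\<close> fixes \<open>b\<close>, which \<open>\<rho>\<close> does not, and moves nothing that \<open>\<rho>\<close> fixes.\<close>
    define \<rho>' where "\<rho>' = \<rho> \<circ> Transposition.transpose a b"
    have p: "\<rho>' permutes D" unfolding \<rho>'_def by (rule permutes_comp_transpose[OF less.prems a(1,2)])
    have "\<rho>' x \<noteq> x \<Longrightarrow> x \<noteq> b \<and> \<rho> x \<noteq> x" for x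
      using \<open>\<rho> a \<noteq> a\<close> b by (cases "x = a \<or> x = b") (auto simp: \<rho>'_def b_def[symmetric])
    then have "{x \<in> D. \<rho>' x \<noteq> x} \<subset> {x \<in> D. \<rho> x \<noteq> x}" using a b by auto
    then have "card {x \<in> D. \<rho>' x \<noteq> x} < card {x \<in> D. \<rho> x \<noteq> x}"
      by (intro psubset_card_mono) (use assms(1) in auto)
    then have "0 \<le> defect D \<pi> \<rho>'" using p by (rule less.hyps)
    moreover have "(a, b) \<notin> eqv (perm_graph D \<rho>')"
      unfolding \<rho>'_def using eqv_transposition[OF assms(1) less.prems a] eqv_perm_graph_step[OF a(1), of \<rho>]
      by (simp add: b_def)
    then have "defect D \<pi> \<rho>' \<le> defect D \<pi> (\<rho>' \<circ> Transposition.transpose a b)"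
      by (rule defect_transposition_ge[OF assms(1,2) p a])
    moreover have "\<rho>' \<circ> Transposition.transpose a b = \<rho>" by (simp add: \<rho>'_def comp_assoc)
    ultimately show ?thesis by simp
  qed
qed

text \<open>
  Not necessarily connected: the defect is additive over components and never negative, so it
  vanishes exactly if every component is a sphere.
\<close>

definition planar :: "'a set \<Rightarrow> ('a \<Rightarrow> 'a) \<Rightarrow> ('a \<Rightarrow> 'a) \<Rightarrow> bool" where
  "planar D \<pi> \<rho> \<longleftrightarrow> finite D \<and> \<pi> permutes D \<and> \<rho> permutes D \<and> defect D \<pi> \<rho> = 0"

lemma planarD:
  assumes "planar D \<pi> \<rho>"
  shows "finite D" "\<pi> permutes D" "\<rho> permutes D" "defect D \<pi> \<rho> = 0"
  using assms by (auto simp: planar_def)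

lemma planar_commute: "planar D \<pi> \<rho> \<Longrightarrow> planar D \<rho> \<pi>"
  by (simp add: planar_def defect_commute)

lemma planar_id: "finite D \<Longrightarrow> \<pi> permutes D \<Longrightarrow> planar D \<pi> id"
  by (simp add: planar_def permutes_id defect_id)

text \<open>
  Since the defect cannot become negative, it suffices that it does not grow. The hypothesis
  excludes the one bad case, in which two edges and two vertices of one component are joined.
\<close>

lemma planar_transposition_edge:
  assumes "planar D \<pi> \<rho>" "a \<in> D" "b \<in> D"
    and "(a, b) \<in> eqv (perm_graph D \<rho>) \<or> (a, b) \<in> eqv (perm_graph D (\<pi> \<circ> \<rho>)) \<or> (a, b) \<notin> eqv (perm_graph D \<pi> \<union> perm_graph D \<rho>)"
  shows "planar D \<pi> (\<rho> \<circ> Transposition.transpose a b)"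
proof (cases "a = b")
  case False
  note p = planarD[OF assms(1)]
  have q: "\<rho> \<circ> Transposition.transpose a b permutes D"
    by (rule permutes_comp_transpose[OF p(3) assms(2,3)])
  show ?thesis
    using defect_transposition_le[OF p(1-3) assms(2,3) False assms(4)] defect_nonneg[OF p(1,2) q] p q
    by (simp add: planar_def)
qed (use assms in simp)

text \<open>
  The roles of faces and edges are interchangeable, the vertices being then the cycles of \<open>\<rho> \<circ> \<pi>\<close>.
\<close>

lemma planar_transposition_face:
  assumes "planar D \<pi> \<rho>" "a \<in> D" "b \<in> D"
    and "(a, b) \<in> eqv (perm_graph D \<pi>) \<or> (a, b) \<in> eqv (perm_graph D (\<rho> \<circ> \<pi>)) \<or> (a, b) \<notin> eqv (perm_graph D \<pi> \<union> perm_graph D \<rho>)"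
  shows "planar D (\<pi> \<circ> Transposition.transpose a b) \<rho>"
  by (rule planar_commute, rule planar_transposition_edge)
    (use assms planar_commute in \<open>auto simp: Un_commute\<close>)

lemma defect_Un:
  assumes "finite D" "finite D'" "D \<inter> D' = {}"
    and "\<pi> ` D \<subseteq> D" "\<rho> ` D \<subseteq> D" "\<pi> ` D' \<subseteq> D'" "\<rho> ` D' \<subseteq> D'"
  shows "defect (D \<union> D') \<pi> \<rho> = defect D \<pi> \<rho> + defect D' \<pi> \<rho>"
proof -
  have sub: "(\<pi> \<circ> \<rho>) ` D \<subseteq> D" "(\<pi> \<circ> \<rho>) ` D' \<subseteq> D'" using assms(4-7) by (auto simp: image_subset_iff)
  have g: "nclasses (D \<union> D') (perm_graph (D \<union> D') f) = nclasses D (perm_graph D f) + nclasses D' (perm_graph D' f)"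
    if "f ` D \<subseteq> D" "f ` D' \<subseteq> D'" for f
    unfolding perm_graph_Un by (rule nclasses_disjoint_union[OF assms(1-3)]) (use perm_graph_subset[OF that(1)] perm_graph_subset[OF that(2)] in auto)
  have "nclasses (D \<union> D') ((perm_graph D \<pi> \<union> perm_graph D \<rho>) \<union> (perm_graph D' \<pi> \<union> perm_graph D' \<rho>)) =
      nclasses D (perm_graph D \<pi> \<union> perm_graph D \<rho>) + nclasses D' (perm_graph D' \<pi> \<union> perm_graph D' \<rho>)"
    by (rule nclasses_disjoint_union[OF assms(1-3)])
      (use perm_graph_subset[OF assms(4)] perm_graph_subset[OF assms(5)] perm_graph_subset[OF assms(6)] perm_graph_subset[OF assms(7)] in auto)
  moreover have "(perm_graph D \<pi> \<union> perm_graph D \<rho>) \<union> (perm_graph D' \<pi> \<union> perm_graph D' \<rho>) = perm_graph (D \<union> D') \<pi> \<union> perm_graph (D \<union> D') \<rho>"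
    by (auto simp: perm_graph_Un)
  ultimately show ?thesis
    using g[OF assms(4,6)] g[OF assms(5,7)] g[OF sub] assms(1-3)
    by (simp add: defect_def card_Un_disjoint)
qed

lemma defect_cong:
  assumes "\<And>x. x \<in> D \<Longrightarrow> \<pi> x = \<pi>' x" "\<And>x. x \<in> D \<Longrightarrow> \<rho> x = \<rho>' x" "\<rho> ` D \<subseteq> D"
  shows "defect D \<pi> \<rho> = defect D \<pi>' \<rho>'"
proof -
  have "perm_graph D \<pi> = perm_graph D \<pi>'" "perm_graph D \<rho> = perm_graph D \<rho>'" by (intro perm_graph_cong; simp add: assms)+
  moreover have "perm_graph D (\<pi> \<circ> \<rho>) = perm_graph D (\<pi>' \<circ> \<rho>')"
    by (intro perm_graph_cong) (use assms in \<open>auto simp: image_subset_iff\<close>)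
  ultimately show ?thesis by (simp add: defect_def)
qed

lemma perm_restrict_permutes:
  assumes "finite K" "inj \<pi>" "\<pi> ` K \<subseteq> K"
  shows "perm_restrict \<pi> K permutes K"
proof -
  have "\<pi> ` K = K" by (rule endo_inj_surj[OF assms(1,3) inj_on_subset[OF assms(2)]]) simp
  then have "bij_betw \<pi> K K" using inj_on_subset[OF assms(2)] by (simp add: bij_betw_def)
  then have "bij_betw (perm_restrict \<pi> K) K K"
    using bij_betw_cong[of K "perm_restrict \<pi> K" \<pi> K] by (simp add: perm_restrict_simps)
  then show ?thesis by (rule bij_imp_permutes) (simp add: perm_restrict_simps)
qed

text \<open>
  The defects of \<open>K\<close> and of the complement add up to zero and neither is negative.
\<close>

lemma planar_restrict:
  assumes "planar D \<pi> \<rho>" "K \<subseteq> D" "\<pi> ` K \<subseteq> K" "\<rho> ` K \<subseteq> K"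
  shows "planar K (perm_restrict \<pi> K) (perm_restrict \<rho> K)"
proof -
  note p = planarD[OF assms(1)]
  have fin: "finite K" "finite (D - K)" using p(1) assms(2) finite_subset by auto
  have co: "f ` (D - K) \<subseteq> D - K" if f: "f permutes D" "f ` K \<subseteq> K" for f
  proof -
    have "f ` K = K"
      by (rule endo_inj_surj[OF fin(1) f(2) inj_on_subset[OF permutes_inj[OF f(1)]]]) simp
    moreover have "f ` (D - K) = f ` D - f ` K" by (rule image_set_diff[OF permutes_inj[OF f(1)]])
    ultimately show ?thesis using permutes_image[OF f(1)] by simp
  qed
  have pr: "perm_restrict f X permutes X" if "f permutes D" "f ` X \<subseteq> X" "finite X" for f X
    by (rule perm_restrict_permutes) (use that permutes_inj in auto)
  have d: "defect X \<pi> \<rho> = defect X (perm_restrict \<pi> X) (perm_restrict \<rho> X)" if "\<rho> ` X \<subseteq> X" for X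
    by (rule defect_cong) (use that in \<open>auto simp: perm_restrict_simps\<close>)
  have nn: "0 \<le> defect X \<pi> \<rho>" if "finite X" "\<pi> ` X \<subseteq> X" "\<rho> ` X \<subseteq> X" for X
    unfolding d[OF that(3)] by (rule defect_nonneg) (use that pr p in auto)
  have "defect (K \<union> (D - K)) \<pi> \<rho> = defect K \<pi> \<rho> + defect (D - K) \<pi> \<rho>"
    by (rule defect_Un) (use fin assms co p in auto)
  moreover have "K \<union> (D - K) = D" using assms(2) by auto
  ultimately have "defect K \<pi> \<rho> = 0"
    using p(4) nn[OF fin(1) assms(3,4)] nn[OF fin(2) co[OF p(2) assms(3)] co[OF p(3) assms(4)]] by simp
  then show ?thesis
    unfolding planar_def d[OF assms(4), symmetric] using fin(1) pr[OF p(2) assms(3)] pr[OF p(3) assms(4)] by simp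
qed

lemma override_permutes:
  assumes "\<pi> permutes D" "\<pi>' permutes D'" "D \<inter> D' = {}"
  shows "override_on \<pi>' \<pi> D permutes D \<union> D'"
proof -
  have "override_on \<pi>' \<pi> D = \<pi>' \<circ> \<pi>"
  proof
    fix x
    have "x \<in> D \<Longrightarrow> \<pi> x \<in> D" using assms(1) by (simp add: permutes_in_image)
    then have "x \<in> D \<Longrightarrow> \<pi> x \<notin> D'" using assms(3) by auto
    then show "override_on \<pi>' \<pi> D x = (\<pi>' \<circ> \<pi>) x"
      using assms permutes_not_in[of \<pi>' D' "\<pi> x"] permutes_not_in[of \<pi> D x]
      by (auto simp: override_on_def)
  qed
  then show ?thesis using assms(1,2) by (auto intro: permutes_compose permutes_subset)
qed

lemma planar_union:
  assumes "planar D \<pi> \<rho>" "planar D' \<pi>' \<rho>'" "D \<inter> D' = {}"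
  shows "planar (D \<union> D') (override_on \<pi>' \<pi> D) (override_on \<rho>' \<rho> D)"
proof -
  note p = planarD[OF assms(1)] and p' = planarD[OF assms(2)]
  let ?p = "override_on \<pi>' \<pi> D" and ?r = "override_on \<rho>' \<rho> D"
  have im: "f ` X \<subseteq> X" if "f permutes X" for f and X :: "'a set" using permutes_image[OF that] by simp
  have d1: "defect D \<pi> \<rho> = defect D ?p ?r" by (rule defect_cong) (use im p in auto)
  have d2: "defect D' \<pi>' \<rho>' = defect D' ?p ?r"
    by (rule defect_cong) (use im p' assms(3) in \<open>auto simp: override_on_def\<close>)
  have "override_on f' f D ` D \<subseteq> D \<and> override_on f' f D ` D' \<subseteq> D'"
    if "f permutes D" "f' permutes D'" for f f'
    using im[OF that(1)] im[OF that(2)] assms(3) by (force simp: override_on_def)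
  then have "defect (D \<union> D') ?p ?r = defect D ?p ?r + defect D' ?p ?r"
    by (intro defect_Un) (use p p' assms(3) in auto)
  then show ?thesis
    using d1 d2 p p' override_permutes[OF p(2) p'(2) assms(3)] override_permutes[OF p(3) p'(3) assms(3)]
    by (simp add: planar_def)
qed

lemma planar_relabel:
  assumes "planar D \<pi> \<rho>" "h \<circ> h = id"
  shows "planar (h ` D) (h \<circ> \<pi> \<circ> h) (h \<circ> \<rho> \<circ> h)"
proof -
  note p = planarD[OF assms(1)]
  have hh: "h (h x) = x" for x using assms(2) by (simp add: fun_eq_iff)
  have h: "inj h" by (rule inj_on_inverseI[of _ h]) (rule hh)
  have g: "perm_graph (h ` D) (h \<circ> f \<circ> h) = map_prod h h ` perm_graph D f" for f
    by (force simp: perm_graph_def hh)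
  have pe: "h \<circ> f \<circ> h permutes h ` D" if f: "f permutes D" for f
  proof (rule bij_imp_permutes)
    show "bij_betw (h \<circ> f \<circ> h) (h ` D) (h ` D)"
    proof (intro bij_betw_trans)
      show "bij_betw h (h ` D) D" by (rule bij_betw_byWitness[where f' = h]) (auto simp: hh)
      show "bij_betw f D D" using f by (rule permutes_imp_bij)
      show "bij_betw h D (h ` D)" by (rule bij_betw_byWitness[where f' = h]) (auto simp: hh)
    qed
    fix x assume "x \<notin> h ` D"
    then have "h x \<notin> D" using hh[of x] by force
    then show "(h \<circ> f \<circ> h) x = x" using permutes_not_in[OF f] hh by simp
  qed
  have "(h \<circ> \<pi> \<circ> h) \<circ> (h \<circ> \<rho> \<circ> h) = h \<circ> (\<pi> \<circ> \<rho>) \<circ> h" by (auto simp: hh)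
  then have "defect (h ` D) (h \<circ> \<pi> \<circ> h) (h \<circ> \<rho> \<circ> h) = defect D \<pi> \<rho>"
    unfolding defect_def by (simp only: g image_Un[symmetric] nclasses_inj_image[OF h])
      (simp add: card_image inj_on_subset[OF h])
  then show ?thesis using p pe by (simp add: planar_def)
qed

text \<open>
  The prefix \<open>inv\<close> denotes inverses in groups here.
\<close>

abbreviation inv_perm :: "('a \<Rightarrow> 'a) \<Rightarrow> 'a \<Rightarrow> 'a" where
  "inv_perm \<equiv> inv_into UNIV"

lemma perm_graph_inv: "\<pi> permutes D \<Longrightarrow> perm_graph D (inv_perm \<pi>) = (perm_graph D \<pi>)\<inverse>"
  by (auto simp: perm_graph_def permutes_in_image permutes_inv permutes_inverses)

text \<open>
  The converse relation has the same classes, and \<open>\<pi>\<inverse> \<circ> \<rho> = (\<rho> \<circ> \<pi>)\<inverse>\<close> has as many cycles as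
  \<open>\<pi> \<circ> \<rho>\<close>.
\<close>

lemma planar_mirror:
  assumes "planar D \<pi> \<rho>" "\<rho> \<circ> \<rho> = id"
  shows "planar D (inv_perm \<pi>) \<rho>"
proof -
  note p = planarD[OF assms(1)]
  have "inv_perm \<rho> = \<rho>" using assms(2) by (rule inv_unique_comp[OF _ assms(2)])
  then have i: "inv_perm \<pi> \<circ> \<rho> = inv_perm (\<rho> \<circ> \<pi>)"
    using permutes_inv_o p by (simp add: o_inv_distrib permutes_bij)
  have u: "eqv (perm_graph D (inv_perm \<pi>) \<union> perm_graph D \<rho>) = eqv (perm_graph D \<pi> \<union> perm_graph D \<rho>)"
    unfolding perm_graph_inv[OF p(2)]
    by (intro equalityI eqv_subset) (auto intro: eqv_base eqv_sym)
  have e: "nclasses D (perm_graph D (inv_perm f)) = nclasses D (perm_graph D f)" if "f permutes D" for f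
    using eqv_converse[of "perm_graph D f"] by (simp add: perm_graph_inv[OF that] nclasses_def)
  have "\<rho> \<circ> \<pi> permutes D" using p by (intro permutes_compose)
  then have "defect D (inv_perm \<pi>) \<rho> = defect D \<pi> \<rho>"
    unfolding defect_def i
    using e[OF p(2)] e[of "\<rho> \<circ> \<pi>"] nclasses_comp_commute[OF p(2,3)] nclasses_cong[OF u, of D] by simp
  then show ?thesis using p permutes_inv by (auto simp: planar_def)
qed

section \<open>Diagrams with free faces\<close>

text \<open>
  Shifting by one says that \<open>\<pi>\<close> sends every entry to the cyclically next one, so \<open>L\<close> lists one
  cycle of \<open>\<pi>\<close> from a chosen starting point. The empty list is admitted: it is the boundary of a
  diagram with empty boundary word.
\<close>

definition face :: "('d \<Rightarrow> 'd) \<Rightarrow> 'd list \<Rightarrow> bool" where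
  "face \<pi> L \<longleftrightarrow> distinct L \<and> map \<pi> L = rotate1 L"

lemma face_Nil [simp]: "face \<pi> []"
  by (simp add: face_def)

lemma face_rotate: "face \<pi> (A @ B) \<Longrightarrow> face \<pi> (B @ A)"
proof -
  have "B @ A = rotate (length A) (A @ B)" by (simp add: rotate_append)
  then show "face \<pi> (A @ B) \<Longrightarrow> face \<pi> (B @ A)"
    by (metis face_def distinct_rotate rotate_map rotate1_rotate_swap)
qed

lemma face_snoc: "face \<pi> (A @ [a]) \<longleftrightarrow>
    distinct (A @ [a]) \<and> map \<pi> A = tl (A @ [a]) \<and> \<pi> a = hd (A @ [a])"
  by (auto simp: face_def rotate1_hd_tl)

lemma face_image: "face \<pi> L \<Longrightarrow> \<pi> ` set L = set L"
  unfolding face_def by (metis set_map set_rotate1)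

lemma face_cong: "(\<And>x. x \<in> set L \<Longrightarrow> \<pi> x = \<pi>' x) \<Longrightarrow> face \<pi> L \<longleftrightarrow> face \<pi>' L"
  unfolding face_def by (metis map_cong)

text \<open>
  The transposition exchanges the successors of the last entries, which are the two first entries.
\<close>

lemma face_join:
  assumes "face \<pi> A" "face \<pi> B" "A \<noteq> []" "B \<noteq> []" "set A \<inter> set B = {}"
  shows "face (\<pi> \<circ> Transposition.transpose (last A) (last B)) (A @ B)"
proof -
  obtain A' a where A: "A = A' @ [a]" using assms(3) by (cases A rule: rev_cases) auto
  obtain B' b where B: "B = B' @ [b]" using assms(4) by (cases B rule: rev_cases) auto
  let ?\<pi> = "\<pi> \<circ> Transposition.transpose a b"
  have d: "a \<notin> set A'" "b \<notin> set A'" "a \<notin> set B'" "b \<notin> set B'" "a \<noteq> b"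
    using assms(1,2,5) by (auto simp: A B face_def)
  have "map ?\<pi> A' = map \<pi> A'" "map ?\<pi> B' = map \<pi> B'"
    using d by (auto simp: transpose_def)
  then have "map ?\<pi> A' = tl A" "map ?\<pi> B' = tl B"
    using assms(1,2) unfolding A B face_snoc by auto
  moreover have "?\<pi> a = hd B" "?\<pi> b = hd A"
    using assms(1,2) unfolding A B face_snoc by auto
  ultimately have "map ?\<pi> (A' @ a # B') = tl (A @ B)" "?\<pi> b = hd (A @ B)"
    using assms(3,4) by simp_all
  then show ?thesis
    using assms(1,2,5) face_snoc[of ?\<pi> "A' @ a # B'" b] by (auto simp: A B face_def)
qed

lemma face_split:
  assumes "face \<pi> (A @ B)" "A \<noteq> []" "B \<noteq> []"
  shows "face (\<pi> \<circ> Transposition.transpose (last A) (last B)) A"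
    and "face (\<pi> \<circ> Transposition.transpose (last A) (last B)) B"
proof -
  obtain A' a where A: "A = A' @ [a]" using assms(2) by (cases A rule: rev_cases) auto
  obtain B' b where B: "B = B' @ [b]" using assms(3) by (cases B rule: rev_cases) auto
  let ?\<pi> = "\<pi> \<circ> Transposition.transpose a b"
  have dis: "distinct (A @ B)" using assms(1) by (simp add: face_def)
  then have d: "a \<notin> set A'" "b \<notin> set A'" "a \<notin> set B'" "b \<notin> set B'" "a \<noteq> b"
    by (auto simp: A B)
  have m: "map \<pi> (A' @ a # B') = tl (A @ B)" "\<pi> b = hd (A @ B)"
    using assms(1) face_snoc[of \<pi> "A' @ a # B'" b] by (auto simp: A B)
  moreover have "tl (A @ B) = tl A @ hd B # tl B" using assms(2,3) by simp
  ultimately have "map \<pi> A' @ \<pi> a # map \<pi> B' = tl A @ hd B # tl B" by simp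
  moreover have "length (tl A) = length A'" by (simp add: A)
  ultimately have e: "map \<pi> A' = tl A" "\<pi> a = hd B" "map \<pi> B' = tl B"
    by (auto simp: append_eq_append_conv)
  have hb: "\<pi> b = hd A" using m(2) assms(2) by simp
  have "map ?\<pi> A' = map \<pi> A'" "map ?\<pi> B' = map \<pi> B'"
    using d by (auto simp: transpose_def)
  then show "face (\<pi> \<circ> Transposition.transpose (last A) (last B)) A"
    "face (\<pi> \<circ> Transposition.transpose (last A) (last B)) B"
    using e hb dis face_snoc[of ?\<pi> A' a] face_snoc[of ?\<pi> B' b] by (auto simp: A B)
qed

lemma face_inv:
  assumes "face \<pi> L" "inj \<pi>"
  shows "face (inv_perm \<pi>) (rev L)"
proof (cases L)
  case (Cons x xs)
  have "map (inv_perm \<pi>) (map \<pi> L) = L"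
    using assms(2) by (simp add: map_idI)
  moreover have "map \<pi> L = xs @ [x]" using assms(1) Cons by (simp add: face_def)
  ultimately have "map (inv_perm \<pi>) (xs @ [x]) = x # xs" using Cons by (simp only:)
  then have "rev (map (inv_perm \<pi>) (xs @ [x])) = rev (x # xs)" by (rule arg_cong)
  then have "map (inv_perm \<pi>) (x # rev xs) = rev xs @ [x]" by (simp add: rev_map)
  then have "rotate1 (map (inv_perm \<pi>) (x # rev xs)) = rotate1 (rev xs @ [x])" by (rule arg_cong)
  then have "map (inv_perm \<pi>) (rev xs @ [x]) = rotate1 (rev xs @ [x])" by simp
  then show ?thesis using assms(1) Cons by (simp add: face_def)
qed simp

lemma face_eqv:
  assumes "face \<pi> L" "set L \<subseteq> D" "x \<in> set L" "y \<in> set L"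
  shows "(x, y) \<in> eqv (perm_graph D \<pi>)"
proof -
  have n: "(L ! 0, L ! i) \<in> eqv (perm_graph D \<pi>)" if "i < length L" for i
    using that
  proof (induction i)
    case (Suc i)
    have "\<pi> (L ! i) = rotate1 L ! i" using assms(1) Suc.prems by (metis Suc_lessD face_def nth_map)
    then have "\<pi> (L ! i) = L ! Suc i" using Suc.prems by (simp add: nth_rotate1)
    moreover have "(L ! i, \<pi> (L ! i)) \<in> eqv (perm_graph D \<pi>)"
      by (rule eqv_perm_graph_step) (use assms(2) Suc.prems in auto)
    ultimately show ?case using Suc eqv_trans[of "L ! 0" "L ! i"] by simp
  qed simp
  obtain i j where "i < length L" "x = L ! i" "j < length L" "y = L ! j"
    using assms(3,4) by (metis in_set_conv_nth)
  then show ?thesis using n eqv_sym eqv_trans by metis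
qed

lemma inv_letter_simps [simp]:
  "inv_letter (inv_letter a) = a" "fst (inv_letter a) = fst a" "inv_letter a \<noteq> a"
  by (auto simp: inv_letter_def prod_eq_iff)

definition winv :: "'a word \<Rightarrow> 'a word" where
  "winv w = rev (map inv_letter w)"

lemma winv_simps [simp]: "winv [] = []" "winv (u @ v) = winv v @ winv u"
  "winv (a # w) = winv w @ [inv_letter a]" "winv (winv w) = w"
  by (simp_all add: winv_def rev_map[symmetric] comp_def)

record 'a diag = cell_structure +
  side :: "nat \<Rightarrow> side"
  label :: "nat \<Rightarrow> 'a letter"

text \<open>
  \<open>F\<close> consists of the darts of the free faces, those that are not 2-cells over \<open>K(P)\<close>: the outer face
  of a diagram, and 2-cells that have been removed but whose boundary is still to be sewn up. A free
  dart has a label but its \<open>side\<close> is meaningless. All other faces map to 2-cells of \<open>K(P)\<close>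
  as in a spherical diagram. With \<open>F = {}\<close>, every component is a spherical diagram.
\<close>

definition diagram :: "'a presentation \<Rightarrow> 'a diag \<Rightarrow> nat set \<Rightarrow> bool" where
  "diagram P M F \<longleftrightarrow>
     planar (darts M) (nxt M) (opp M) \<and>
     (\<forall>d \<in> darts M. opp M d \<noteq> d \<and> opp M (opp M d) = d \<and> label M (opp M d) = inv_letter (label M d)) \<and>
     F \<subseteq> darts M \<and> nxt M ` F \<subseteq> F \<and>
     (\<forall>d \<in> darts M - F. side M d \<in> sides P \<and> side M (nxt M d) = side_next P (side M d) \<and>
        label M d = side_letter P (side M d) \<and> inj_on (side M) (orbit (nxt M) d))"

lemma diagramD:
  assumes "diagram P M F"
  shows "planar (darts M) (nxt M) (opp M)" "finite (darts M)" "nxt M permutes darts M"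
    "opp M permutes darts M" "F \<subseteq> darts M" "nxt M ` F \<subseteq> F" "finite F"
    "\<And>d. d \<in> darts M \<Longrightarrow> opp M d \<noteq> d" "\<And>d. d \<in> darts M \<Longrightarrow> opp M (opp M d) = d"
    "\<And>d. d \<in> darts M \<Longrightarrow> label M (opp M d) = inv_letter (label M d)"
    "\<And>d. d \<in> darts M \<Longrightarrow> opp M d \<in> darts M" "\<And>d. d \<in> darts M \<Longrightarrow> nxt M d \<in> darts M"
proof -
  show p: "planar (darts M) (nxt M) (opp M)" and F: "F \<subseteq> darts M" "nxt M ` F \<subseteq> F"
    using assms by (auto simp: diagram_def)
  note q = planarD[OF p]
  show "finite (darts M)" "nxt M permutes darts M" "opp M permutes darts M" "finite F"
    using q F finite_subset by auto
  show "\<And>d. d \<in> darts M \<Longrightarrow> opp M d \<in> darts M" "\<And>d. d \<in> darts M \<Longrightarrow> nxt M d \<in> darts M"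
    using q by (simp_all add: permutes_in_image)
qed (use assms in \<open>auto simp: diagram_def\<close>)

lemma diagram_inner:
  assumes "diagram P M F" "d \<in> darts M" "d \<notin> F"
  shows "side M d \<in> sides P" "side M (nxt M d) = side_next P (side M d)"
    "label M d = side_letter P (side M d)" "inj_on (side M) (orbit (nxt M) d)"
  using assms by (auto simp: diagram_def)

lemma permutes_closed_iff:
  assumes "\<pi> permutes D" "finite F" "\<pi> ` F \<subseteq> F"
  shows "\<pi> d \<in> F \<longleftrightarrow> d \<in> F"
proof -
  have "\<pi> ` F = F"
    by (rule endo_inj_surj[OF assms(2,3) inj_on_subset[OF permutes_inj[OF assms(1)]]]) simp
  then show ?thesis using inj_image_mem_iff[OF permutes_inj[OF assms(1)], of d F] by simp
qed

lemma diagram_nxt_free_iff: "diagram P M F \<Longrightarrow> nxt M d \<in> F \<longleftrightarrow> d \<in> F"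
  by (rule permutes_closed_iff) (fact diagramD)+

lemma diagram_change_nxt:
  assumes "diagram P M F" "planar (darts M) \<pi> (opp M)" "\<And>d. d \<in> darts M - F \<Longrightarrow> \<pi> d = nxt M d"
    and "\<pi> ` F \<subseteq> F"
  shows "diagram P (M\<lparr>nxt := \<pi>\<rparr>) F"
proof -
  have "orbit \<pi> d = orbit (nxt M) d" if "d \<in> darts M - F" for d
    by (rule orbit_cong0[OF that, symmetric])
      (use assms(3) diagramD(12)[OF assms(1)] diagram_nxt_free_iff[OF assms(1)] in auto)
  then show ?thesis using assms unfolding diagram_def by simp
qed

lemma diagram_free_more:
  assumes "diagram P M F" "X \<subseteq> darts M" "nxt M ` X \<subseteq> X"
  shows "diagram P M (F \<union> X)"
  using assms unfolding diagram_def by auto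

lemma transposition_closed:
  assumes "\<pi> ` F \<subseteq> F" "a \<in> F" "b \<in> F"
  shows "(\<pi> \<circ> Transposition.transpose a b) ` F \<subseteq> F"
  using assms by (auto simp: transpose_def image_subset_iff)

text \<open>
  Two free faces may be joined either at a common vertex, which is what the first alternative says
  about the starting points of the two faces, or if they lie on different components.
\<close>

lemma diagram_join_faces:
  assumes M: "diagram P M F" and faces: "face (nxt M) A" "face (nxt M) B" "A \<noteq> []" "B \<noteq> []"
    and sub: "set A \<subseteq> F" "set B \<subseteq> F" "set A \<inter> set B = {}"
    and ok: "(last A, last B) \<in> eqv (perm_graph (darts M) (opp M \<circ> nxt M)) \<or>
      (last A, last B) \<notin> eqv (perm_graph (darts M) (nxt M) \<union> perm_graph (darts M) (opp M))"
  defines "\<pi> \<equiv> nxt M \<circ> Transposition.transpose (last A) (last B)"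
  shows "diagram P (M\<lparr>nxt := \<pi>\<rparr>) F" "face \<pi> (A @ B)"
proof -
  have l: "last A \<in> F" "last B \<in> F" using faces sub by auto
  note D = diagramD[OF M]
  have "planar (darts M) \<pi> (opp M)"
    unfolding \<pi>_def by (rule planar_transposition_face) (use D(1,5) l ok in auto)
  then show "diagram P (M\<lparr>nxt := \<pi>\<rparr>) F"
    by (rule diagram_change_nxt[OF M])
      (use l transposition_closed[OF D(6) l] in \<open>auto simp: \<pi>_def transpose_def\<close>)
  show "face \<pi> (A @ B)" unfolding \<pi>_def by (rule face_join) (use faces sub in auto)
qed

text \<open>
  Cutting a free face into two never harms planarity, whether it joins two vertices or pinches
  the surface at a single vertex.
\<close>

lemma diagram_split_face:
  assumes M: "diagram P M F" and f: "face (nxt M) (A @ B)" "A \<noteq> []" "B \<noteq> []"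
    and sub: "set (A @ B) \<subseteq> F"
  defines "\<pi> \<equiv> nxt M \<circ> Transposition.transpose (last A) (last B)"
  shows "diagram P (M\<lparr>nxt := \<pi>\<rparr>) F" "face \<pi> A" "face \<pi> B"
proof -
  have l: "last A \<in> F" "last B \<in> F" using f sub by auto
  note D = diagramD[OF M]
  have "(last A, last B) \<in> eqv (perm_graph (darts M) (nxt M))"
    by (rule face_eqv[OF f(1)]) (use f sub D(5) in auto)
  then have "planar (darts M) \<pi> (opp M)"
    unfolding \<pi>_def by (intro planar_transposition_face) (use D(1,5) l in auto)
  then show "diagram P (M\<lparr>nxt := \<pi>\<rparr>) F"
    by (rule diagram_change_nxt[OF M])
      (use l transposition_closed[OF D(6) l] in \<open>auto simp: \<pi>_def transpose_def\<close>)
  show "face \<pi> A" "face \<pi> B" unfolding \<pi>_def by (rule face_split[OF f])+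
qed

text \<open>
  A 2-gon with sides \<open>p\<close>, \<open>q\<close> is collapsed: the two edges across \<open>p\<close> and \<open>q\<close> become one edge, and
  \<open>p\<close>, \<open>q\<close> are left paired with each other as a separate component. Of the two transpositions, the first
  joins the edges \<open>{p, \<rho> p}\<close>, \<open>{q, \<rho> q}\<close> into a 4-cycle at a vertex that they share and the second cuts
  the 4-cycle the other way.
\<close>

lemma rewire_digon:
  assumes pl: "planar D \<pi> \<rho>" and invol: "\<forall>d \<in> D. \<rho> d \<noteq> d \<and> \<rho> (\<rho> d) = d"
    and pq: "p \<in> D" "q \<in> D" "p \<noteq> q" "\<pi> p = q" "\<pi> q = p" and ne: "\<rho> p \<noteq> q"
  defines "\<rho>' \<equiv> \<rho> \<circ> Transposition.transpose (\<rho> p) q \<circ> Transposition.transpose (\<rho> q) p"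
  shows "planar D \<pi> \<rho>'" "\<rho>' p = q" "\<rho>' q = p" "\<rho>' (\<rho> p) = \<rho> q" "\<rho>' (\<rho> q) = \<rho> p"
    and "\<And>d. d \<notin> {p, q, \<rho> p, \<rho> q} \<Longrightarrow> \<rho>' d = \<rho> d"
proof -
  note p = planarD[OF pl]
  have inv: "\<And>d. d \<in> D \<Longrightarrow> \<rho> d \<noteq> d" "\<And>d. d \<in> D \<Longrightarrow> \<rho> (\<rho> d) = d" using invol by auto
  have inj: "\<rho> x = \<rho> y \<longleftrightarrow> x = y" for x y using permutes_inj[OF p(3)] by (auto dest: injD)
  have D: "\<rho> p \<in> D" "\<rho> q \<in> D" using p(3) pq by (simp_all add: permutes_in_image)
  have ne': "\<rho> q \<noteq> p" using ne inv(2)[OF pq(2)] by metis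
  note dist = ne ne' inv(1)[OF pq(1)] inv(1)[OF pq(2)] pq(3) inj[of p q]
  let ?\<rho>1 = "\<rho> \<circ> Transposition.transpose (\<rho> p) q"
  have "(\<rho> p, (\<pi> \<circ> \<rho>) (\<rho> p)) \<in> eqv (perm_graph D (\<pi> \<circ> \<rho>))" by (rule eqv_perm_graph_step[OF D(1)])
  then have "planar D \<pi> ?\<rho>1"
    by (intro planar_transposition_edge[OF pl D(1) pq(2)]) (simp add: inv(2) pq)
  moreover have "?\<rho>1 (\<rho> q) = q" using dist inv(2)[OF pq(2)] by (simp add: transpose_def)
  then have "(\<rho> q, p) \<in> eqv (perm_graph D (\<pi> \<circ> ?\<rho>1))"
    using eqv_perm_graph_step[OF D(2), of "\<pi> \<circ> ?\<rho>1"] pq(5) by (simp del: comp_assoc)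
  ultimately show "planar D \<pi> \<rho>'"
    unfolding \<rho>'_def by (intro planar_transposition_edge[OF _ D(2) pq(1)]) auto
  show "\<rho>' p = q" "\<rho>' q = p" "\<rho>' (\<rho> p) = \<rho> q" "\<rho>' (\<rho> q) = \<rho> p"
    "\<And>d. d \<notin> {p, q, \<rho> p, \<rho> q} \<Longrightarrow> \<rho>' d = \<rho> d"
    using dist inv(2)[OF pq(1)] inv(2)[OF pq(2)] by (auto simp: \<rho>'_def transpose_def)
qed

section \<open>Cancelling inverse edges of a free face\<close>

lemma face_pair: "face \<pi> [p, q] \<longleftrightarrow> p \<noteq> q \<and> \<pi> p = q \<and> \<pi> q = p"
  by (auto simp: face_def)

lemma isolate_pair:
  assumes M: "diagram P M F" and f: "face (nxt M) (A @ [p, q])" and sub: "set (A @ [p, q]) \<subseteq> F"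
  obtains \<pi> where "diagram P (M\<lparr>nxt := \<pi>\<rparr>) F" "face \<pi> A" "face \<pi> [p, q]"
    "\<And>d. d \<notin> set (A @ [p, q]) \<Longrightarrow> \<pi> d = nxt M d"
proof (cases "A = []")
  case True
  show ?thesis by (rule that[of "nxt M"]) (use M f True in simp_all)
next
  case False
  note s = diagram_split_face[OF M f False _ sub, simplified]
  show ?thesis
    by (rule that[OF s]) (use False in \<open>auto simp: transpose_def\<close>)
qed

lemma rewire_pair:
  assumes M: "diagram P M F" and f: "face (nxt M) [p, q]" and sub: "p \<in> F" "q \<in> F"
    and lab: "label M q = inv_letter (label M p)"
  obtains \<rho> where "planar (darts M) (nxt M) \<rho>" "\<rho> p = q" "\<rho> q = p"
    "\<And>d. d \<in> darts M - {p, q} \<Longrightarrow> \<rho> d \<in> darts M - {p, q} \<and> \<rho> d \<noteq> d \<and> \<rho> (\<rho> d) = d \<and>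
       label M (\<rho> d) = inv_letter (label M d) \<and> (\<rho> d = opp M d \<or> fst (label M d) = fst (label M p))"
proof -
  note D = diagramD[OF M]
  have pq: "p \<noteq> q" "nxt M p = q" "nxt M q = p" "p \<in> darts M" "q \<in> darts M"
    using f sub D(5) by (auto simp: face_pair)
  have inj: "opp M x = opp M y \<longleftrightarrow> x = y" for x y
    using permutes_inj[OF D(4)] by (auto dest: injD)
  show ?thesis
  proof (cases "opp M p = q")
    case True
    then have q: "opp M q = p" using D(9) pq by metis
    show ?thesis
    proof (rule that[of "opp M"])
      fix d assume d: "d \<in> darts M - {p, q}"
      have "opp M d \<noteq> p" "opp M d \<noteq> q" using d True q inj by (metis Diff_iff insertI1 insertI2)+
      then show "opp M d \<in> darts M - {p, q} \<and> opp M d \<noteq> d \<and> opp M (opp M d) = d \<and>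
       label M (opp M d) = inv_letter (label M d) \<and> (opp M d = opp M d \<or> fst (label M d) = fst (label M p))"
        using d D(8-11) by auto
    qed (use D True q in auto)
  next
    case False
    then have ne': "opp M q \<noteq> p" using D(9) pq by metis
    define \<rho> where "\<rho> = opp M \<circ> Transposition.transpose (opp M p) q \<circ> Transposition.transpose (opp M q) p"
    have "\<forall>d \<in> darts M. opp M d \<noteq> d \<and> opp M (opp M d) = d" using D(8,9) by simp
    note r = rewire_digon[OF D(1) this pq(4,5,1,2,3) False, folded \<rho>_def]
    show ?thesis
    proof (rule that[OF r(1-3)])
      fix d assume d: "d \<in> darts M - {p, q}"
      consider "d = opp M p" | "d = opp M q" | "d \<notin> {p, q, opp M p, opp M q}" using d by auto
      then show "\<rho> d \<in> darts M - {p, q} \<and> \<rho> d \<noteq> d \<and> \<rho> (\<rho> d) = d \<and>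
       label M (\<rho> d) = inv_letter (label M d) \<and> (\<rho> d = opp M d \<or> fst (label M d) = fst (label M p))"
      proof cases
        case 1
        then show ?thesis using r D(8)[OF pq(5)] D(10)[OF pq(4)] D(10)[OF pq(5)] D(11)[OF pq(5)] inj[of p q] pq(1) ne' lab
          by auto
      next
        case 2
        then show ?thesis using r D(8)[OF pq(4)] D(10)[OF pq(4)] D(10)[OF pq(5)] D(11)[OF pq(4)] inj[of p q] pq(1) False lab
          by auto
      next
        case 3
        have o: "opp M d \<notin> {p, q, opp M p, opp M q}"
          using 3 inj D(9) pq(4,5) d by (metis DiffD1 insertCI insertE singletonD)
        show ?thesis
          using r(6)[OF 3] r(6)[OF o] o d D(8-11)[of d] by auto
      qed
    qed
  qed
qed

text \<open>
  The pair is split off as a free 2-gon, the 2-gon is collapsed, and its two darts are discarded with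
  the component that they form. If both darts lie on the same edge, a spike disappears; if their
  other end points coincide, the surface may fall apart, into planar pieces.
\<close>

lemma cancel_last_pair:
  assumes M: "diagram P M (set (A @ [p, q]) \<union> X)" and f: "face (nxt M) (A @ [p, q])"
    and dis: "set (A @ [p, q]) \<inter> X = {}" and lab: "label M q = inv_letter (label M p)"
  obtains N where "diagram P N (set A \<union> X)" "face (nxt N) A" "darts N = darts M - {p, q}"
    "side N = side M" "label N = label M" "\<And>d. d \<in> darts M - set (A @ [p, q]) \<Longrightarrow> nxt N d = nxt M d"
    "\<And>d. d \<in> darts N \<Longrightarrow> opp N d = opp M d \<or> fst (label M d) = fst (label M p)"
proof -
  let ?L = "set (A @ [p, q])" and ?F = "set (A @ [p, q]) \<union> X" and ?K = "darts M - {p, q}"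
  note D = diagramD[OF M]
  have L_closed: "nxt M d \<in> ?L \<longleftrightarrow> d \<in> ?L" for d
    by (rule permutes_closed_iff[OF D(3)]) (use face_image[OF f] in auto)
  obtain \<pi> where N1: "diagram P (M\<lparr>nxt := \<pi>\<rparr>) ?F" and fA: "face \<pi> A" and fpq: "face \<pi> [p, q]"
    and \<pi>: "\<And>d. d \<notin> ?L \<Longrightarrow> \<pi> d = nxt M d"
    using isolate_pair[OF M f Un_upper1] by metis
  obtain \<rho> where pl: "planar (darts M) \<pi> \<rho>" and \<rho>pq: "\<rho> p = q" "\<rho> q = p" and
    \<rho>: "\<And>d. d \<in> ?K \<Longrightarrow> \<rho> d \<in> ?K \<and> \<rho> d \<noteq> d \<and> \<rho> (\<rho> d) = d \<and>
       label M (\<rho> d) = inv_letter (label M d) \<and> (\<rho> d = opp M d \<or> fst (label M d) = fst (label M p))"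
    by (rule rewire_pair[OF N1, of p q]) (use fpq lab in auto)
  note D1 = diagramD[OF N1, simplified]
  have K_closed: "\<pi> d \<in> {p, q} \<longleftrightarrow> d \<in> {p, q}" for d
    by (rule permutes_closed_iff[OF D1(3)]) (use fpq in \<open>auto simp: face_pair\<close>)
  have \<pi>K: "\<pi> ` ?K \<subseteq> ?K" using K_closed D1(12) by blast
  have \<rho>K: "\<rho> ` ?K \<subseteq> ?K" using \<rho> by blast
  define N where "N = M\<lparr>darts := ?K, opp := perm_restrict \<rho> ?K, nxt := perm_restrict \<pi> ?K\<rparr>"
  have N_simps: "darts N = ?K" "side N = side M" "label N = label M"
    "\<And>d. d \<in> ?K \<Longrightarrow> opp N d = \<rho> d" "\<And>d. d \<in> ?K \<Longrightarrow> nxt N d = \<pi> d"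
    by (simp_all add: N_def perm_restrict_simps)
  have distL: "p \<notin> set A" "q \<notin> set A" using f by (auto simp: face_def)
  have F_sub: "set A \<union> X \<subseteq> ?K" using distL dis D(5) by auto
  have nA: "nxt N d = \<pi> d" if "d \<in> set A \<union> X" for d using N_simps(5) F_sub that by blast
  have orb: "orbit (nxt N) d = orbit (nxt M) d" if "d \<in> darts M - ?F" for d
    by (rule orbit_cong0[OF that, symmetric])
      (use \<pi> D(12) diagram_nxt_free_iff[OF M] in \<open>auto simp: N_simps\<close>)
  have dN: "diagram P N (set A \<union> X)"
    unfolding diagram_def
  proof (intro conjI ballI)
    show "planar (darts N) (nxt N) (opp N)"
      using planar_restrict[OF pl Diff_subset \<pi>K \<rho>K] by (simp add: N_def)
    show "set A \<union> X \<subseteq> darts N" using F_sub by (simp add: N_simps)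
    have "\<pi> ` X \<subseteq> X" 
    proof
      fix y assume "y \<in> \<pi> ` X"
      then obtain x where x: "x \<in> X" "y = \<pi> x" by auto
      then have "x \<notin> ?L" "x \<in> ?F" using dis by auto
      then have "y = nxt M x" "nxt M x \<in> ?F" "nxt M x \<notin> ?L"
        using \<pi> x diagram_nxt_free_iff[OF M] L_closed by blast+
      then show "y \<in> X" by blast
    qed
    then show "nxt N ` (set A \<union> X) \<subseteq> set A \<union> X"
      using face_image[OF fA] nA by (auto simp: image_subset_iff)
    fix d assume "d \<in> darts N"
    then have d: "d \<in> ?K" by (simp add: N_simps)
    show "opp N d \<noteq> d" "opp N (opp N d) = d" "label N (opp N d) = inv_letter (label N d)"
      using \<rho>[OF d] d by (simp_all add: N_simps)
  next
    fix d assume "d \<in> darts N - (set A \<union> X)"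
    then have d: "d \<in> ?K" "d \<in> darts M" "d \<notin> ?F" by (auto simp: N_simps)
    note i = diagram_inner[OF M d(2,3)]
    show "side N d \<in> sides P" "label N d = side_letter P (side N d)"
      "inj_on (side N) (orbit (nxt N) d)"
      using i orb[of d] d by (simp_all add: N_simps)
    show "side N (nxt N d) = side_next P (side N d)"
      using i(2) d \<pi>[of d] by (simp add: N_simps)
  qed
  show ?thesis
  proof (rule that[OF dN])
    show "face (nxt N) A" using fA face_cong[of A "nxt N" \<pi>] nA by simp
    show "nxt N d = nxt M d" if "d \<in> darts M - set (A @ [p, q])" for d
      using that \<pi>[of d] N_simps(5)[of d] by simp
    show "opp N d = opp M d \<or> fst (label M d) = fst (label M p)" if "d \<in> darts N" for d
      using that \<rho>[of d] N_simps(4)[of d] by (simp add: N_simps(1))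
  qed (simp_all add: N_simps)
qed

lemma cancel_pair:
  assumes M: "diagram P M (set (A @ [p, q] @ B) \<union> X)" and f: "face (nxt M) (A @ [p, q] @ B)"
    and dis: "set (A @ [p, q] @ B) \<inter> X = {}" and lab: "label M q = inv_letter (label M p)"
  obtains N where "diagram P N (set (A @ B) \<union> X)" "face (nxt N) (A @ B)" "darts N = darts M - {p, q}"
    "side N = side M" "label N = label M" "\<And>d. d \<in> darts M - set (A @ [p, q] @ B) \<Longrightarrow> nxt N d = nxt M d"
    "\<And>d. d \<in> darts N \<Longrightarrow> opp N d = opp M d \<or> fst (label M d) = fst (label M p)"
proof -
  have s: "set ((B @ A) @ [p, q]) = set (A @ [p, q] @ B)" "set (B @ A) = set (A @ B)" by auto
  have "face (nxt M) ((B @ A) @ [p, q])" using face_rotate[of "nxt M" "A @ [p, q]" B] f by simp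
  then obtain N where N: "diagram P N (set (B @ A) \<union> X)" "face (nxt N) (B @ A)" "darts N = darts M - {p, q}"
    "side N = side M" "label N = label M"
    "\<And>d. d \<in> darts M - set ((B @ A) @ [p, q]) \<Longrightarrow> nxt N d = nxt M d"
    "\<And>d. d \<in> darts N \<Longrightarrow> opp N d = opp M d \<or> fst (label M d) = fst (label M p)"
    using cancel_last_pair[OF M[folded s(1)] _ dis[folded s(1)] lab] by metis
  show ?thesis
    by (rule that[OF N(1)[unfolded s] face_rotate[OF N(2)] N(3-5) N(6)[unfolded s] N(7)])
qed

text \<open>
  A free face whose boundary word has the form \<open>r r\<inverse>\<close> is sewn up from the middle of the word outwards.
  The map \<open>nxt\<close> is unaffected elsewhere, and \<open>opp\<close> changes only at edges whose label occurs
  in \<open>r\<close>, which is what later keeps edges with another label in place.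
\<close>

lemma cancel_face:
  assumes "diagram P M (set L \<union> X)" "face (nxt M) L" "set L \<inter> X = {}" "map (label M) L = r @ winv r"
  obtains N where "diagram P N X" "darts N = darts M - set L" "side N = side M" "label N = label M"
    "\<And>d. d \<in> darts N \<Longrightarrow> nxt N d = nxt M d"
    "\<And>d. d \<in> darts N \<Longrightarrow> opp N d = opp M d \<or> fst (label M d) \<in> fst ` set r"
  using assms
proof (induction r arbitrary: M L thesis rule: rev_induct)
  case Nil
  show ?case by (rule Nil(1)[of M]) (use Nil(2-) in simp_all)
next
  case (snoc a r)
  from snoc.prems(5) have "map (label M) L = r @ [a, inv_letter a] @ winv r" by simp
  then obtain A L1 where 1: "L = A @ L1" "map (label M) A = r" "map (label M) L1 = [a, inv_letter a] @ winv r"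
    by (auto simp: map_eq_append_conv)
  then obtain p L2 where 2: "L1 = p # L2" "label M p = a" "map (label M) L2 = [inv_letter a] @ winv r"
    by auto
  then obtain q B where 3: "L2 = q # B" "label M q = inv_letter a" "map (label M) B = winv r"
    by auto
  have L: "L = A @ [p, q] @ B" using 1 2 3 by simp
  obtain N where N: "diagram P N (set (A @ B) \<union> X)" "face (nxt N) (A @ B)" "darts N = darts M - {p, q}"
    "side N = side M" "label N = label M" "\<And>d. d \<in> darts M - set L \<Longrightarrow> nxt N d = nxt M d"
    "\<And>d. d \<in> darts N \<Longrightarrow> opp N d = opp M d \<or> fst (label M d) = fst (label M p)"
    using cancel_pair[OF snoc.prems(2-4)[unfolded L]] 2(2) 3(2) L by metis
  have "set (A @ B) \<inter> X = {}" "map (label N) (A @ B) = r @ winv r"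
    using snoc.prems(4) L 1 3 N(5) by auto
  then obtain N' where N': "diagram P N' X" "darts N' = darts N - set (A @ B)" "side N' = side N" "label N' = label N"
    "\<And>d. d \<in> darts N' \<Longrightarrow> nxt N' d = nxt N d"
    "\<And>d. d \<in> darts N' \<Longrightarrow> opp N' d = opp N d \<or> fst (label N d) \<in> fst ` set r"
    using snoc.IH[OF _ N(1,2)] by metis
  have dd: "darts N' = darts M - set L" using N'(2) N(3) L by auto
  show ?case
  proof (rule snoc.prems(1)[OF N'(1) dd])
    fix d assume d: "d \<in> darts N'"
    then show "nxt N' d = nxt M d" using N'(5) N(6) dd by simp
    have "d \<in> darts N" using d N'(2) by simp
    then show "opp N' d = opp M d \<or> fst (label M d) \<in> fst ` set (r @ [a])"
      using N'(6)[OF d] N(7)[of d] N(5) 2(2) by auto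
  qed (use N' N in simp_all)
qed

section \<open>Union, relabelling and reflection\<close>

definition union_diag :: "'a diag \<Rightarrow> 'a diag \<Rightarrow> 'a diag" where
  "union_diag M N = \<lparr>darts = darts M \<union> darts N, opp = override_on (opp N) (opp M) (darts M),
     nxt = override_on (nxt N) (nxt M) (darts M), side = override_on (side N) (side M) (darts M),
     label = override_on (label N) (label M) (darts M)\<rparr>"

lemma union_diag_simps:
  "darts (union_diag M N) = darts M \<union> darts N"
  "d \<in> darts M \<Longrightarrow> opp (union_diag M N) d = opp M d"
  "d \<in> darts M \<Longrightarrow> nxt (union_diag M N) d = nxt M d"
  "d \<in> darts M \<Longrightarrow> side (union_diag M N) d = side M d"
  "d \<in> darts M \<Longrightarrow> label (union_diag M N) d = label M d"
  "d \<notin> darts M \<Longrightarrow> opp (union_diag M N) d = opp N d"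
  "d \<notin> darts M \<Longrightarrow> nxt (union_diag M N) d = nxt N d"
  "d \<notin> darts M \<Longrightarrow> side (union_diag M N) d = side N d"
  "d \<notin> darts M \<Longrightarrow> label (union_diag M N) d = label N d"
  by (simp_all add: union_diag_def)

lemma diagram_union:
  assumes M: "diagram P M F" and N: "diagram P N F'" and dis: "darts M \<inter> darts N = {}"
  shows "diagram P (union_diag M N) (F \<union> F')"
proof -
  note D = diagramD[OF M] and D' = diagramD[OF N]
  let ?U = "union_diag M N"
  note U = union_diag_simps[where M = M and N = N]
  have c: "x \<in> darts N \<Longrightarrow> x \<notin> darts M" for x using dis by auto
  have o1: "orbit (nxt ?U) d = orbit (nxt M) d" if "d \<in> darts M" for d
    by (rule orbit_cong0[OF that]) (use U D(12) in auto)
  have o2: "orbit (nxt ?U) d = orbit (nxt N) d" if "d \<in> darts N" for d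
    by (rule orbit_cong0[OF that]) (use U D'(12) c in auto)
  have orbM: "orbit (nxt M) d \<subseteq> darts M" if "d \<in> darts M" for d
    using permutes_orbit_subset[OF D(3) that] .
  have orbN: "orbit (nxt N) d \<subseteq> darts N" if "d \<in> darts N" for d
    using permutes_orbit_subset[OF D'(3) that] .
  show ?thesis
    unfolding diagram_def
  proof (intro conjI ballI)
    show "planar (darts ?U) (nxt ?U) (opp ?U)"
      using planar_union[OF D(1) D'(1) dis] by (simp add: union_diag_def)
    show "F \<union> F' \<subseteq> darts ?U" using D(5) D'(5) U by auto
    show "nxt ?U ` (F \<union> F') \<subseteq> F \<union> F'"
    proof
      fix y assume "y \<in> nxt ?U ` (F \<union> F')"
      then obtain x where x: "x \<in> F \<union> F'" "y = nxt ?U x" by blast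
      show "y \<in> F \<union> F'"
      proof (cases "x \<in> F")
        case True
        then have "y = nxt M x" using x(2) U(3) D(5) by blast
        with True D(6) show ?thesis by blast
      next
        case False
        then have "x \<in> F'" using x(1) by simp
        moreover from this have "y = nxt N x" using x(2) U(7) c D'(5) by blast
        ultimately show ?thesis using D'(6) by blast
      qed
    qed
    fix d assume d: "d \<in> darts ?U"
    show "opp ?U d \<noteq> d" "opp ?U (opp ?U d) = d" "label ?U (opp ?U d) = inv_letter (label ?U d)"
      using d D(8-11)[of d] D'(8-11)[of d] U c by auto
  next
    fix d assume d: "d \<in> darts ?U - (F \<union> F')"
    show "side ?U d \<in> sides P" "side ?U (nxt ?U d) = side_next P (side ?U d)"
      "label ?U d = side_letter P (side ?U d)" 
      using d diagram_inner[OF M, of d] diagram_inner[OF N, of d] U D(12)[of d] D'(12)[of d] c by auto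
    show "inj_on (side ?U) (orbit (nxt ?U) d)"
    proof (cases "d \<in> darts M")
      case True
      then have "inj_on (side M) (orbit (nxt M) d)" using diagram_inner[OF M, of d] d by auto
      then show ?thesis unfolding o1[OF True]
        by (rule inj_on_cong[THEN iffD1, rotated]) (use orbM[OF True] U in auto)
    next
      case False
      then have dN: "d \<in> darts N" using d U by auto
      then have "inj_on (side N) (orbit (nxt N) d)" using diagram_inner[OF N, of d] d by auto
      then show ?thesis unfolding o2[OF dN]
        by (rule inj_on_cong[THEN iffD1, rotated]) (use orbN[OF dN] U c in auto)
    qed
  qed
qed

definition relabel_diag :: "(nat \<Rightarrow> nat) \<Rightarrow> 'a diag \<Rightarrow> 'a diag" where
  "relabel_diag h M = \<lparr>darts = h ` darts M, opp = h \<circ> opp M \<circ> h, nxt = h \<circ> nxt M \<circ> h,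
     side = side M \<circ> h, label = label M \<circ> h\<rparr>"

lemma diagram_relabel:
  assumes M: "diagram P M F" and h: "h \<circ> h = id"
  shows "diagram P (relabel_diag h M) (h ` F)"
proof -
  have hh: "h (h x) = x" for x using h by (simp add: fun_eq_iff)
  note D = diagramD[OF M]
  have orb: "orbit (h \<circ> nxt M \<circ> h) (h d) = h ` orbit (nxt M) d" for d
  proof -
    define g where "g = h \<circ> nxt M \<circ> h"
    have g: "g (h x) = h (nxt M x)" for x by (simp add: g_def hh)
    have "y \<in> h ` orbit (nxt M) d" if "y \<in> orbit g (h d)" for y
      using that by induction (auto simp: g intro: orbit.intros)
    moreover have "h y \<in> orbit g (h d)" if "y \<in> orbit (nxt M) d" for y
      using that by induction (auto simp flip: g intro: orbit.intros)
    ultimately show ?thesis unfolding g_def by blast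
  qed
  show ?thesis
    unfolding diagram_def
  proof (intro conjI ballI)
    show "planar (darts (relabel_diag h M)) (nxt (relabel_diag h M)) (opp (relabel_diag h M))"
      using planar_relabel[OF D(1) h] by (simp add: relabel_diag_def)
    show "h ` F \<subseteq> darts (relabel_diag h M)" using D(5) by (auto simp: relabel_diag_def)
    show "nxt (relabel_diag h M) ` h ` F \<subseteq> h ` F" using D(6) by (auto simp: relabel_diag_def hh)
    fix d assume "d \<in> darts (relabel_diag h M)"
    then obtain x where "d = h x" "x \<in> darts M" by (auto simp: relabel_diag_def)
    then show "opp (relabel_diag h M) d \<noteq> d" "opp (relabel_diag h M) (opp (relabel_diag h M) d) = d"
      "label (relabel_diag h M) (opp (relabel_diag h M) d) = inv_letter (label (relabel_diag h M) d)"
      using D(8-10)[of x] hh by (auto simp: relabel_diag_def) (metis hh)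
  next
    fix d assume "d \<in> darts (relabel_diag h M) - h ` F"
    then obtain x where x: "d = h x" "x \<in> darts M" "x \<notin> F" by (auto simp: relabel_diag_def)
    note i = diagram_inner[OF M x(2,3)]
    show "side (relabel_diag h M) d \<in> sides P"
      "side (relabel_diag h M) (nxt (relabel_diag h M) d) = side_next P (side (relabel_diag h M) d)"
      "label (relabel_diag h M) d = side_letter P (side (relabel_diag h M) d)"
      using i x by (simp_all add: relabel_diag_def hh)
    have "inj_on (side M \<circ> h) (h ` orbit (nxt M) d')" if "inj_on (side M) (orbit (nxt M) d')" for d'
      using that by (auto simp: inj_on_def hh)
    then show "inj_on (side (relabel_diag h M)) (orbit (nxt (relabel_diag h M)) d)"
      using i(4) x(1) orb by (simp add: relabel_diag_def)
  qed
qed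

lemma face_relabel:
  assumes "h \<circ> h = id" "face \<pi> L"
  shows "face (h \<circ> \<pi> \<circ> h) (map h L)"
proof -
  have hh: "h (h x) = x" for x using assms(1) by (simp add: fun_eq_iff)
  have "inj h" by (rule inj_on_inverseI[of _ h]) (rule hh)
  then have dist: "distinct (map h L)" using assms(2) by (auto simp: face_def distinct_map intro: inj_on_subset)
  have "map (h \<circ> \<pi> \<circ> h) (map h L) = map h (map \<pi> L)" by (simp add: hh)
  also have "map h (map \<pi> L) = rotate1 (map h L)"
    using assms(2) by (simp only: face_def rotate1_map)
  finally show ?thesis using dist by (simp only: face_def)
qed

text \<open>
  Exchange an initial segment of the natural numbers that contains both sets with the next segment
  of the same length. An involution is chosen so that conjugation needs no inverse.
\<close>

lemma exists_disjoint_relabelling: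
  fixes A B :: "nat set"
  assumes "finite A" "finite B"
  obtains h where "h \<circ> h = id" "A \<inter> h ` B = {}"
proof -
  obtain n where n: "\<And>x. x \<in> A \<union> B \<Longrightarrow> x < n"
    using finite_nat_set_iff_bounded[of "A \<union> B"] assms by auto
  define h where "h x = (if x < n then x + n else if x < 2 * n then x - n else x)" for x
  have "h \<circ> h = id" by (rule ext) (auto simp: h_def)
  moreover have "A \<inter> h ` B = {}" using n by (force simp: h_def)
  ultimately show ?thesis by (rule that)
qed

text \<open>
  The same edge of the same 2-cell of \<open>K(P)\<close>, seen when the boundary is traversed in the other
  direction.
\<close>

fun flip_side :: "side \<Rightarrow> side" where
  "flip_side (j, p, e) = (j, p, \<not> e)"

lemma flip_side_simps [simp]:
  "flip_side (flip_side s) = s"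
  "flip_side s \<in> sides P \<longleftrightarrow> s \<in> sides P"
  "side_letter P (flip_side s) = inv_letter (side_letter P s)"
  by (cases s; auto simp: sides_def)+

lemma side_next_flip:
  assumes "s \<in> sides P"
  shows "side_next P (flip_side (side_next P s)) = flip_side s"
proof -
  obtain j p e where s: "s = (j, p, e)" by (cases s)
  define l where "l = length (rels P ! j)"
  have p: "p < l" using assms s by (simp add: sides_def l_def)
  have "((p + 1) mod l + l - 1) mod l = p"
  proof (cases "p + 1 = l")
    case False
    then have "p + 1 < l" using p by simp
    then show ?thesis using p by simp
  qed (use p in auto)
  moreover have "((p + l - 1) mod l + 1) mod l = p"
  proof -
    have "((p + l - 1) mod l + 1) mod l = (p + l - 1 + 1) mod l" by (rule mod_add_left_eq)
    then show ?thesis using p by simp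
  qed
  ultimately show ?thesis by (simp add: s Let_def l_def[symmetric])
qed

lemma side_next_in_sides: "s \<in> sides P \<Longrightarrow> side_next P s \<in> sides P"
  by (cases s) (auto simp: sides_def Let_def intro!: mod_less_divisor)

text \<open>
  The boundary of every face is traversed backwards. A dart keeps its position on its face, so it
  now carries the inverse letter.
\<close>

definition mirror_diag :: "'a diag \<Rightarrow> 'a diag" where
  "mirror_diag M = \<lparr>darts = darts M, opp = opp M, nxt = inv_perm (nxt M),
     side = flip_side \<circ> side M, label = inv_letter \<circ> label M\<rparr>"

lemma diagram_mirror:
  assumes M: "diagram P M F"
  shows "diagram P (mirror_diag M) F"
proof -
  note D = diagramD[OF M]
  have oo: "opp M \<circ> opp M = id"
  proof
    fix d show "(opp M \<circ> opp M) d = id d"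
      using D(9)[of d] permutes_not_in[OF D(4), of d] by (cases "d \<in> darts M") auto
  qed
  have n: "nxt M (inv_perm (nxt M) d) = d" for d using permutes_inverses(1)[OF D(3)] .
  have inF: "inv_perm (nxt M) d \<in> F \<longleftrightarrow> d \<in> F" for d
    using diagram_nxt_free_iff[OF M, of "inv_perm (nxt M) d"] n by simp
  have inD: "inv_perm (nxt M) d \<in> darts M \<longleftrightarrow> d \<in> darts M" for d
    using permutes_in_image[OF D(3), of "inv_perm (nxt M) d"] n by simp
  have "permutation (nxt M)" using D(2,3) permutation_permutes by blast
  note orb = orbit_inv_eq[OF this]
  show ?thesis
    unfolding diagram_def
  proof (intro conjI ballI)
    show "planar (darts (mirror_diag M)) (nxt (mirror_diag M)) (opp (mirror_diag M))"
      using planar_mirror[OF D(1) oo] by (simp add: mirror_diag_def)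
    show "F \<subseteq> darts (mirror_diag M)" using D(5) by (simp add: mirror_diag_def)
    show "nxt (mirror_diag M) ` F \<subseteq> F" using inF by (auto simp: mirror_diag_def)
    fix d assume "d \<in> darts (mirror_diag M)"
    then show "opp (mirror_diag M) d \<noteq> d" "opp (mirror_diag M) (opp (mirror_diag M) d) = d"
      "label (mirror_diag M) (opp (mirror_diag M) d) = inv_letter (label (mirror_diag M) d)"
      using D(8-10)[of d] by (simp_all add: mirror_diag_def)
  next
    fix d assume "d \<in> darts (mirror_diag M) - F"
    then have d: "d \<in> darts M" "d \<notin> F" by (simp_all add: mirror_diag_def)
    note i = diagram_inner[OF M d]
    have d': "inv_perm (nxt M) d \<in> darts M" "inv_perm (nxt M) d \<notin> F" using d inD inF by simp_all
    note i' = diagram_inner[OF M d']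
    show "side (mirror_diag M) d \<in> sides P" "label (mirror_diag M) d = side_letter P (side (mirror_diag M) d)"
      using i by (simp_all add: mirror_diag_def)
    show "side (mirror_diag M) (nxt (mirror_diag M) d) = side_next P (side (mirror_diag M) d)"
      using side_next_flip[OF i'(1)] i'(2) n by (simp add: mirror_diag_def)
    have "inj_on flip_side A" for A by (rule inj_on_inverseI[of _ flip_side]) simp
    then show "inj_on (side (mirror_diag M)) (orbit (nxt (mirror_diag M)) d)"
      using i(4) orb by (simp add: mirror_diag_def comp_inj_on)
  qed
qed

text \<open>
  A free face whose boundary word is a relator can be filled in with the corresponding 2-cell.
\<close>

lemma diagram_close_face:
  assumes M: "diagram P M (set B \<union> X)" and f: "face (nxt M) B" and dis: "set B \<inter> X = {}"
    and j: "j < length (rels P)" and lab: "map (label M) B = rels P ! j"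
  obtains s where "diagram P (M\<lparr>side := s\<rparr>) X"
proof -
  note D = diagramD[OF M]
  have dB: "distinct B" using f by (simp add: face_def)
  have len: "length (rels P ! j) = length B" using lab by (metis length_map)
  define idx where "idx = the_inv_into {..<length B} ((!) B)"
  have idx: "idx (B ! i) = i" if "i < length B" for i
    unfolding idx_def using that inj_on_nth[OF dB, of "{..<length B}"] by (intro the_inv_into_f_f) auto
  define s where "s d = (if d \<in> set B then (j, idx d, True) else side M d)" for d
  have Bc: "nxt M d \<in> set B \<longleftrightarrow> d \<in> set B" for d
    by (rule permutes_closed_iff[OF D(3)]) (use face_image[OF f] in auto)
  have "diagram P (M\<lparr>side := s\<rparr>) X"
    unfolding diagram_def
  proof (intro conjI ballI)
    show "X \<subseteq> darts (M\<lparr>side := s\<rparr>)" using D(5) by simp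
    show "nxt (M\<lparr>side := s\<rparr>) ` X \<subseteq> X"
      using D(6) Bc dis by auto
    fix d assume d: "d \<in> darts (M\<lparr>side := s\<rparr>) - X"
    have "s d \<in> sides P \<and> s (nxt M d) = side_next P (s d) \<and>
        label M d = side_letter P (s d) \<and> inj_on s (orbit (nxt M) d)"
    proof (cases "d \<in> set B")
      case True
      then obtain i where i: "i < length B" "d = B ! i" by (metis in_set_conv_nth)
      have "map (nxt M) B ! i = rotate1 B ! i" using f by (simp add: face_def)
      then have nd: "nxt M d = B ! (Suc i mod length B)" using i by (simp add: nth_rotate1)
      have "Suc i mod length B < length B" using i(1) by (intro mod_less_divisor) auto
      then have "s (nxt M d) = side_next P (s d)"
        using i idx nd by (simp add: s_def len Let_def)
      moreover have "s d \<in> sides P" using i idx j len by (simp add: s_def sides_def)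
      moreover have "label M d = side_letter P (s d)"
        using i idx by (simp add: s_def lab[symmetric])
      moreover have "inj_on s (orbit (nxt M) d)"
      proof (rule inj_on_subset)
        show "inj_on s (set B)"
        proof (rule inj_onI)
          fix x y assume "x \<in> set B" "y \<in> set B" "s x = s y"
          then show "x = y" using idx by (auto simp: s_def in_set_conv_nth)
        qed
        show "orbit (nxt M) d \<subseteq> set B"
        proof
          fix y assume "y \<in> orbit (nxt M) d"
          then show "y \<in> set B" by induction (use True Bc in auto)
        qed
      qed
      ultimately show ?thesis by blast
    next
      case False
      then have d': "d \<in> darts M" "d \<notin> set B \<union> X" using d by auto
      note i = diagram_inner[OF M d']
      have "y \<notin> set B" if "y \<in> orbit (nxt M) d" for y
        using that by induction (use False Bc in auto)
      then have "inj_on s (orbit (nxt M) d) \<longleftrightarrow> inj_on (side M) (orbit (nxt M) d)"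
        by (intro inj_on_cong) (simp add: s_def)
      then show ?thesis using i False Bc by (simp add: s_def)
    qed
    then show "side (M\<lparr>side := s\<rparr>) d \<in> sides P"
      "side (M\<lparr>side := s\<rparr>) (nxt (M\<lparr>side := s\<rparr>) d) = side_next P (side (M\<lparr>side := s\<rparr>) d)"
      "label (M\<lparr>side := s\<rparr>) d = side_letter P (side (M\<lparr>side := s\<rparr>) d)"
      "inj_on (side (M\<lparr>side := s\<rparr>)) (orbit (nxt (M\<lparr>side := s\<rparr>)) d)"
      by simp_all
  qed (use D in simp_all)
  then show ?thesis by (rule that)
qed

text \<open>
  The diagrams are wedged together at a boundary vertex, so that the two outer faces become one.
\<close>

lemma diagram_disjoint_union_join:
  assumes M: "diagram P M (set A)" "face (nxt M) A" "A \<noteq> []"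
    and N: "diagram P N (set B)" "face (nxt N) B" "B \<noteq> []"
    and dis: "darts M \<inter> darts N = {}"
  obtains \<pi> where "diagram P ((union_diag M N)\<lparr>nxt := \<pi>\<rparr>) (set (A @ B))" "face \<pi> (A @ B)"
    "\<And>d. d \<notin> set (A @ B) \<Longrightarrow> \<pi> d = nxt (union_diag M N) d"
proof -
  let ?U = "union_diag M N"
  note U = union_diag_simps[where M = M and N = N]
  note D = diagramD[OF M(1)] and D' = diagramD[OF N(1)]
  have sub: "set A \<subseteq> darts M" "set B \<subseteq> darts N" "set A \<inter> set B = {}" using D(5) D'(5) dis by auto
  have B_out: "d \<notin> darts M" if "d \<in> darts N" for d using that dis by auto
  have dU: "diagram P ?U (set A \<union> set B)" by (rule diagram_union[OF M(1) N(1) dis])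
  have fA: "face (nxt ?U) A" using M(2) face_cong[of A "nxt ?U" "nxt M"] sub U(3) by auto
  have fB: "face (nxt ?U) B" using N(2) face_cong[of B "nxt ?U" "nxt N"] sub(2) B_out U(7) by blast
  have l: "last A \<in> darts M" "last B \<in> darts N" using sub M(3) N(3) by auto
  have ne: "(last A, last B) \<notin> eqv (perm_graph (darts ?U) (nxt ?U) \<union> perm_graph (darts ?U) (opp ?U))"
  proof
    assume "(last A, last B) \<in> eqv (perm_graph (darts ?U) (nxt ?U) \<union> perm_graph (darts ?U) (opp ?U))"
    then have "last B \<in> darts M"
    proof (rule eqv_in_closed[OF _ l(1)])
      fix u v assume "(u, v) \<in> perm_graph (darts ?U) (nxt ?U) \<union> perm_graph (darts ?U) (opp ?U)"
      then have uv: "u \<in> darts M \<union> darts N" "v = nxt ?U u \<or> v = opp ?U u"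
        by (auto simp: perm_graph_def U(1))
      show "u \<in> darts M \<longleftrightarrow> v \<in> darts M"
      proof (cases "u \<in> darts M")
        case True
        then show ?thesis using uv(2) U(2,3)[OF True] D(11,12)[OF True] by auto
      next
        case False
        then have "v \<in> darts N" using uv U(6,7)[OF False] D'(11,12)[of u] by auto
        then show ?thesis using False B_out by blast
      qed
    qed
    then show False using l(2) B_out by blast
  qed
  note j = diagram_join_faces[OF dU fA fB M(3) N(3) Un_upper1 Un_upper2 sub(3) disjI2[OF ne]]
  show ?thesis
  proof (rule that)
    show "diagram P (?U\<lparr>nxt := nxt ?U \<circ> Transposition.transpose (last A) (last B)\<rparr>) (set (A @ B))"
      using j(1) by simp
    show "face (nxt ?U \<circ> Transposition.transpose (last A) (last B)) (A @ B)" by (rule j(2))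
    fix d assume "d \<notin> set (A @ B)"
    then show "(nxt ?U \<circ> Transposition.transpose (last A) (last B)) d = nxt ?U d"
      using M(3) N(3) by (auto simp: transpose_def)
  qed
qed

section \<open>Boundary words of planar diagrams\<close>

text \<open>
  The outer face is traversed with the surface on its right, and the diagram may be disconnected. Both
  are harmless: the class of these words is closed under formal inversion, and components without
  boundary do not affect the boundary word.
\<close>

definition bounds :: "'a presentation \<Rightarrow> 'a word \<Rightarrow> bool" where
  "bounds P w \<longleftrightarrow> (\<exists>M L. diagram P M (set L) \<and> face (nxt M) L \<and> map (label M) L = w)"

lemma bounds_Nil: "bounds P []"
  unfolding bounds_def
proof (intro exI conjI)
  let ?M = "\<lparr>darts = {}, opp = id, nxt = id, side = undefined, label = undefined\<rparr> :: 'a diag"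
  show "diagram P ?M (set [])" by (simp add: diagram_def planar_id permutes_id)
qed simp_all

text \<open>
  The sphere with a single edge and two vertices, built from two isolated darts by joining first
  their edges and then their faces.
\<close>

lemma planar_edge:
  assumes "p \<noteq> q"
  shows "planar {p, q} (Transposition.transpose p q) (Transposition.transpose p q)"
proof -
  let ?D = "{p, q}" and ?t = "Transposition.transpose p q"
  have "planar ?D id id" by (rule planar_id) (simp_all add: permutes_id)
  moreover have "eqv (perm_graph ?D id \<union> perm_graph ?D id) = Id"
    using perm_graph_id[of ?D "perm_graph ?D id"] perm_graph_id[of ?D "{}"] by (simp add: eqv_def)
  ultimately have "planar ?D id (id \<circ> ?t)"
    using assms by (intro planar_transposition_edge) auto
  then have "planar ?D (id \<circ> ?t) ?t"
    using eqv_perm_graph_step[of p ?D ?t] by (intro planar_transposition_face) auto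
  then show ?thesis by simp
qed

lemma bounds_edge: "bounds P [a, inv_letter a]"
  unfolding bounds_def
proof (intro exI conjI)
  let ?t = "Transposition.transpose (0::nat) 1"
  let ?M = "\<lparr>darts = {0, 1}, opp = ?t, nxt = ?t, side = undefined,
    label = \<lambda>d. if d = 0 then a else inv_letter a\<rparr> :: 'a diag"
  show "diagram P ?M (set [0, 1])"
    using planar_edge[of "0::nat" 1] by (auto simp: diagram_def)
  show "face (nxt ?M) [0, 1]" by (simp add: face_pair)
qed simp

lemma bounds_rotate: "bounds P (u @ v) \<Longrightarrow> bounds P (v @ u)"
proof -
  assume "bounds P (u @ v)"
  then obtain M L where M: "diagram P M (set L)" "face (nxt M) L" "map (label M) L = u @ v"
    by (auto simp: bounds_def)
  then obtain A B where L: "L = A @ B" "map (label M) A = u" "map (label M) B = v"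
    by (auto simp: map_eq_append_conv)
  have "set (B @ A) = set L" using L by auto
  then have "diagram P M (set (B @ A)) \<and> face (nxt M) (B @ A) \<and> map (label M) (B @ A) = v @ u"
    using M face_rotate L by simp
  then show ?thesis unfolding bounds_def by blast
qed

lemma bounds_cancel:
  assumes "bounds P (u @ [a, inv_letter a] @ v)"
  shows "bounds P (u @ v)"
proof -
  obtain M L where M: "diagram P M (set L)" "face (nxt M) L" "map (label M) L = u @ [a, inv_letter a] @ v"
    using assms by (auto simp: bounds_def)
  then obtain A L1 where 1: "L = A @ L1" "map (label M) A = u" "map (label M) L1 = [a, inv_letter a] @ v"
    by (auto simp: map_eq_append_conv)
  then obtain p L2 where 2: "L1 = p # L2" "label M p = a" "map (label M) L2 = [inv_letter a] @ v"
    by auto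
  then obtain q B where 3: "L2 = q # B" "label M q = inv_letter a" "map (label M) B = v"
    by auto
  have L: "L = A @ [p, q] @ B" using 1 2 3 by simp
  obtain N where "diagram P N (set (A @ B) \<union> {})" "face (nxt N) (A @ B)" "label N = label M"
    by (rule cancel_pair[of P M A p q B "{}"]) (use M L 2 3 in auto)
  then have "diagram P N (set (A @ B)) \<and> face (nxt N) (A @ B) \<and> map (label N) (A @ B) = u @ v"
    using 1 3 by simp
  then show ?thesis unfolding bounds_def by blast
qed

lemma bounds_disjoint:
  assumes "bounds P w" "finite X"
  obtains M L where "diagram P M (set L)" "face (nxt M) L" "map (label M) L = w" "X \<inter> darts M = {}"
proof -
  obtain M L where M: "diagram P M (set L)" "face (nxt M) L" "map (label M) L = w"
    using assms(1) by (auto simp: bounds_def)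
  obtain h where h: "h \<circ> h = id" "X \<inter> h ` darts M = {}"
    using exists_disjoint_relabelling[OF assms(2) diagramD(2)[OF M(1)]] .
  have hh: "h (h x) = x" for x using h(1) by (simp add: fun_eq_iff)
  show ?thesis
  proof (rule that)
    show "diagram P (relabel_diag h M) (set (map h L))" using diagram_relabel[OF M(1) h(1)] by simp
    show "face (nxt (relabel_diag h M)) (map h L)"
      using face_relabel[OF h(1) M(2)] by (simp add: relabel_diag_def)
    show "map (label (relabel_diag h M)) (map h L) = w"
      using M(3) by (auto simp: relabel_diag_def hh)
    show "X \<inter> darts (relabel_diag h M) = {}" using h(2) by (simp add: relabel_diag_def)
  qed
qed

lemma bounds_append:
  assumes "bounds P u" "bounds P v"
  shows "bounds P (u @ v)"
proof -
  obtain M A where M: "diagram P M (set A)" "face (nxt M) A" "map (label M) A = u"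
    using assms(1) by (auto simp: bounds_def)
  obtain N B where N: "diagram P N (set B)" "face (nxt N) B" "map (label N) B = v" "darts M \<inter> darts N = {}"
    using bounds_disjoint[OF assms(2) diagramD(2)[OF M(1)]] .
  show ?thesis
  proof (cases "u = [] \<or> v = []")
    case False
    then have ne: "A \<noteq> []" "B \<noteq> []" using M(3) N(3) by auto
    obtain \<pi> where U: "diagram P ((union_diag M N)\<lparr>nxt := \<pi>\<rparr>) (set (A @ B))" "face \<pi> (A @ B)"
      using diagram_disjoint_union_join[OF M(1,2) ne(1) N(1,2) ne(2) N(4)] by metis
    have "label (union_diag M N) d = label M d" if "d \<in> set A" for d
      using that diagramD(5)[OF M(1)] union_diag_simps(5) by blast
    moreover have "label (union_diag M N) d = label N d" if "d \<in> set B" for d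
      using that diagramD(5)[OF N(1)] N(4) union_diag_simps(9) by blast
    ultimately have "map (label (union_diag M N)) (A @ B) = u @ v"
      using M(3) N(3) by auto
    with U show ?thesis
      unfolding bounds_def by (intro exI[of _ "(union_diag M N)\<lparr>nxt := \<pi>\<rparr>"] exI[of _ "A @ B"]) simp
  qed (use assms in auto)
qed

text \<open>
  An edge labelled by the new letter is attached at the base point, and the boundary word is read
  from the other end of that edge.
\<close>

lemma bounds_conj: "bounds P w \<Longrightarrow> bounds P (u @ w @ winv u)"
proof (induction u)
  case (Cons a u)
  have "bounds P ((u @ w @ winv u) @ [inv_letter a, inv_letter (inv_letter a)])"
    using bounds_append[OF Cons.IH[OF Cons.prems] bounds_edge] .
  then have "bounds P (((u @ w @ winv u) @ [inv_letter a]) @ [a])" by simp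
  then have "bounds P ([a] @ (u @ w @ winv u) @ [inv_letter a])" by (rule bounds_rotate)
  then show ?case by simp
qed simp

lemma bounds_winv:
  assumes "bounds P w"
  shows "bounds P (winv w)"
proof -
  obtain M L where M: "diagram P M (set L)" "face (nxt M) L" "map (label M) L = w"
    using assms by (auto simp: bounds_def)
  have "face (nxt (mirror_diag M)) (rev L)"
    using face_inv[OF M(2) permutes_inj[OF diagramD(3)[OF M(1)]]] by (simp add: mirror_diag_def)
  moreover have "diagram P (mirror_diag M) (set (rev L))" using diagram_mirror[OF M(1)] by simp
  moreover have "map (label (mirror_diag M)) (rev L) = winv w"
    using M(3) by (auto simp: mirror_diag_def winv_def rev_map)
  ultimately show ?thesis unfolding bounds_def by blast
qed

text \<open>
  The tree with boundary word \<open>r r\<inverse>\<close> has one face, which is cut into two with boundary words \<open>r\<close> and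
  \<open>r\<inverse>\<close>; the first is filled in with a 2-cell, the second is the outer face.
\<close>

lemma bounds_relator:
  assumes "r \<in> set (rels P)"
  shows "bounds P r"
proof (cases "r = []")
  case False
  obtain j where j: "j < length (rels P)" "rels P ! j = r" using assms by (metis in_set_conv_nth)
  have "bounds P (r @ [] @ winv r)" by (rule bounds_conj[OF bounds_Nil])
  then obtain M L where M: "diagram P M (set L)" "face (nxt M) L" "map (label M) L = r @ winv r"
    by (auto simp: bounds_def)
  then obtain A B where L: "L = A @ B" "map (label M) A = r" "map (label M) B = winv r"
    by (auto simp: map_eq_append_conv)
  have ne: "A \<noteq> []" "B \<noteq> []" using L False by (auto simp: winv_def)
  note s = diagram_split_face[OF M(1)[unfolded L] M(2)[unfolded L] ne subset_refl]
  define M' where "M' = M\<lparr>nxt := nxt M \<circ> Transposition.transpose (last A) (last B)\<rparr>"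
  have M': "diagram P M' (set A \<union> set B)" "face (nxt M') A" "face (nxt M') B" "label M' = label M"
    using s by (simp_all add: M'_def)
  have "set A \<inter> set B = {}" using M(2) L by (auto simp: face_def)
  then obtain t where "diagram P (M'\<lparr>side := t\<rparr>) (set B)"
    using diagram_close_face[OF M'(1,2) _ j(1)] L(2) j(2) M'(4) by metis
  then have "bounds P (winv r)"
    unfolding bounds_def using M'(3,4) L(3)
    by (intro exI[of _ "M'\<lparr>side := t\<rparr>"] exI[of _ B]) simp
  then show ?thesis using bounds_winv by fastforce
qed (simp add: bounds_Nil)

text \<open>
  Every cancellation made in computing the reduced product is realised by sewing up two adjacent
  boundary edges.
\<close>

lemma bounds_cons_red:
  assumes "bounds P (x @ u @ v)"
  shows "bounds P (x @ foldr cons_red u v)"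
  using assms
proof (induction u arbitrary: x)
  case (Cons a u)
  have IH: "bounds P (x @ a # foldr cons_red u v)" using Cons.IH[of "x @ [a]"] Cons.prems by simp
  show ?case
  proof (cases "foldr cons_red u v")
    case (Cons b w)
    then show ?thesis using IH bounds_cancel[of P x a w] by auto
  qed (use IH in simp)
qed simp

section \<open>Folding edges of minimal diagrams\<close>

lemma nat_mod_add_cancel:
  fixes p x y l :: nat
  assumes "(p + x) mod l = (p + y) mod l"
  shows "x mod l = y mod l"
proof -
  have "x mod l = y mod l" if "(p + x) mod l = (p + y) mod l" "x \<le> y" for x y :: nat
  proof -
    have "l dvd (p + y) - (p + x)" using that by (intro mod_eq_dvd_iff_nat[THEN iffD1]) simp_all
    then have "l dvd y - x" by simp
    then show ?thesis using mod_eq_dvd_iff_nat[OF that(2), of l] by simp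
  qed
  then show ?thesis using assms by (metis nat_le_linear)
qed

lemma side_next_funpow:
  assumes "p < length (rels P ! j)"
  shows "(side_next P ^^ i) (j, p, True) = (j, (p + i) mod length (rels P ! j), True)"
  by (induction i) (use assms in \<open>simp_all add: Let_def mod_simps\<close>)

lemma side_next_funpow_sides: "s \<in> sides P \<Longrightarrow> (side_next P ^^ i) s \<in> sides P"
  by (induction i) (simp_all add: side_next_in_sides)

lemma side_next_funpow_flip:
  assumes s: "s \<in> sides P" and per: "(side_next P ^^ l) s = s"
  shows "i \<le> l \<Longrightarrow> (side_next P ^^ i) (flip_side s) = flip_side ((side_next P ^^ (l - i)) s)"
proof (induction i)
  case 0
  then show ?case using per by simp
next
  case (Suc i)
  then have l: "l - i = Suc (l - Suc i)" by simp
  have "(side_next P ^^ Suc i) (flip_side s) = side_next P (flip_side ((side_next P ^^ (l - i)) s))"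
    using Suc by simp
  also have "\<dots> = flip_side ((side_next P ^^ (l - Suc i)) s)"
    unfolding l using side_next_flip[OF side_next_funpow_sides[OF s]] by simp
  finally show ?case .
qed

text \<open>
  A closed walk once around a 2-cell of \<open>K(P)\<close> meets each of its sides exactly once, in either direction.
\<close>

lemma side_next_cycle:
  assumes "(j, p, e) \<in> sides P"
  shows "(side_next P ^^ length (rels P ! j)) (j, p, e) = (j, p, e)"
    and "inj_on (\<lambda>i. (side_next P ^^ i) (j, p, e)) {..<length (rels P ! j)}"
proof -
  let ?l = "length (rels P ! j)"
  have p: "p < ?l" and j: "j < length (rels P)" using assms by (auto simp: sides_def)
  note T = side_next_funpow[OF p]
  have per: "(side_next P ^^ ?l) (j, p, True) = (j, p, True)" using p by (simp add: T)
  have inj: "inj_on (\<lambda>i. (side_next P ^^ i) (j, p, True)) {..<?l}"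
  proof (rule inj_onI)
    fix x y assume "x \<in> {..<?l}" "y \<in> {..<?l}" "(side_next P ^^ x) (j, p, True) = (side_next P ^^ y) (j, p, True)"
    then have "(p + x) mod ?l = (p + y) mod ?l" "x < ?l" "y < ?l" by (simp_all add: T)
    then show "x = y" using nat_mod_add_cancel[of p x ?l y] by simp
  qed
  have "(j, p, True) \<in> sides P" using p j by (simp add: sides_def)
  note F = side_next_funpow_flip[OF this per, simplified]
  show "(side_next P ^^ ?l) (j, p, e) = (j, p, e)" using per F[of ?l] by (cases e) simp_all
  show "inj_on (\<lambda>i. (side_next P ^^ i) (j, p, e)) {..<?l}"
  proof (cases e)
    case False
    show ?thesis
    proof (rule inj_onI)
      fix x y assume xy: "x \<in> {..<?l}" "y \<in> {..<?l}" "(side_next P ^^ x) (j, p, e) = (side_next P ^^ y) (j, p, e)"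
      then have "(p + (?l - x)) mod ?l = (p + (?l - y)) mod ?l" using F[of x] F[of y] False
        by (simp add: T)
      then have "(?l - x) mod ?l = (?l - y) mod ?l" by (rule nat_mod_add_cancel)
      then show "x = y" using xy(1,2) by (cases "x = 0"; cases "y = 0") auto
    qed
  qed (use inj in simp)
qed

text \<open>
  As a face embeds into its 2-cell, its length is exactly that of the relator.
\<close>

lemma inner_face:
  assumes M: "diagram P M F" and d: "d \<in> darts M" "d \<notin> F" and s: "side M d = (j, p, e)"
  defines "L \<equiv> map (\<lambda>i. (nxt M ^^ i) d) [0..<length (rels P ! j)]"
  shows "face (nxt M) L" "d \<in> set L" "set L \<subseteq> darts M - F" "L \<noteq> []" "hd L = d"
    and "\<And>i. (nxt M ^^ i) d \<in> darts M - F \<and> side M ((nxt M ^^ i) d) = (side_next P ^^ i) (j, p, e)"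
proof -
  let ?l = "length (rels P ! j)" and ?g = "\<lambda>i. (nxt M ^^ i) d"
  note i = diagram_inner[OF M d]
  have sd: "(j, p, e) \<in> sides P" using i(1) s by simp
  then have l: "0 < ?l" by (auto simp: sides_def)
  show g: "?g i \<in> darts M - F \<and> side M (?g i) = (side_next P ^^ i) (j, p, e)" for i
  proof (induction i)
    case (Suc i)
    then show ?case
      using diagram_inner(2)[OF M, of "?g i"] diagramD(12)[OF M, of "?g i"] diagram_nxt_free_iff[OF M] by simp
  qed (use d s in simp)
  have period: "?g ?l = d"
  proof -
    have "?g ?l \<in> orbit (nxt M) d" unfolding orbit_altdef using l by blast
    moreover have "d \<in> orbit (nxt M) d" using self_in_orbit diagramD(2,3)[OF M] by metis
    moreover have "side M (?g ?l) = side M d" using g[of ?l] side_next_cycle(1)[OF sd] s by simp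
    ultimately show ?thesis using i(4) by (meson inj_onD)
  qed
  have "inj_on (side M \<circ> ?g) {..<?l}"
    using side_next_cycle(2)[OF sd] by (rule inj_on_cong[THEN iffD1, rotated]) (use g in simp)
  then have "inj_on ?g {..<?l}" by (rule inj_on_imageI2)
  then have dist: "distinct L" by (simp add: L_def distinct_map atLeast0LessThan)
  obtain k where k: "?l = Suc k" using l by (metis Suc_pred)
  have "map (nxt M) L = map ?g (map Suc [0..<Suc k])" by (simp add: L_def k)
  also have "\<dots> = map ?g [Suc 0..<Suc k] @ [?g (Suc k)]" by (simp add: map_Suc_upt)
  also have "\<dots> = rotate1 L"
    unfolding L_def k using period k by (subst (2) upt_conv_Cons) simp_all
  finally have "map (nxt M) L = rotate1 L" .
  then show "face (nxt M) L" using dist by (simp add: face_def)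
  show "d \<in> set L" unfolding L_def using l by force
  show "set L \<subseteq> darts M - F" unfolding L_def using g by auto
  show "L \<noteq> []" using l by (simp add: L_def)
  show "hd L = d" using l by (simp add: L_def hd_map)
qed

text \<open>
  A face of the diagram meets all sides of its 2-cell, since it meets as many sides as there are.
\<close>

lemma inner_label_occurs:
  assumes M: "diagram P M F" and d: "d \<in> darts M" "d \<notin> F"
    and all: "\<forall>r \<in> set (rels P). x \<in> fst ` set r"
  obtains y where "y \<in> darts M" "y \<notin> F" "fst (label M y) = x"
proof -
  obtain j p e where s: "side M d = (j, p, e)" by (cases "side M d")
  let ?l = "length (rels P ! j)"
  note f = inner_face[OF M d s]
  have sd: "(j, p, e) \<in> sides P" using diagram_inner(1)[OF M d] s by simp
  have "(side_next P ^^ i) (j, p, e) \<in> {(j, q, e) | q. q < ?l}" for i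
    by (induction i) (use sd in \<open>auto simp: sides_def Let_def intro!: mod_less_divisor\<close>)
  then have "(\<lambda>i. (side_next P ^^ i) (j, p, e)) ` {..<?l} \<subseteq> {(j, q, e) | q. q < ?l}" by blast
  moreover have T: "{(j, q, e) | q. q < ?l} = (\<lambda>q. (j, q, e)) ` {..<?l}" by auto
  have "card {(j, q, e) | q. q < ?l} = ?l" unfolding T by (subst card_image) (auto simp: inj_on_def)
  moreover have "card ((\<lambda>i. (side_next P ^^ i) (j, p, e)) ` {..<?l}) = ?l"
    using side_next_cycle(2)[OF sd] by (simp add: card_image)
  ultimately have eq: "(\<lambda>i. (side_next P ^^ i) (j, p, e)) ` {..<?l} = {(j, q, e) | q. q < ?l}"
    by (intro card_subset_eq) (auto simp: T)
  have "rels P ! j \<in> set (rels P)" using sd by (simp add: sides_def)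
  then obtain a where "a \<in> set (rels P ! j)" "fst a = x" using all by auto
  then obtain q where q: "q < ?l" "fst (rels P ! j ! q) = x" by (metis in_set_conv_nth)
  then have "(j, q, e) \<in> (\<lambda>i. (side_next P ^^ i) (j, p, e)) ` {..<?l}" using eq by blast
  then obtain i where i: "(side_next P ^^ i) (j, p, e) = (j, q, e)" by auto
  let ?y = "(nxt M ^^ i) d"
  have y: "?y \<in> darts M" "?y \<notin> F" "side M ?y = (j, q, e)" using f(6)[of i] i by auto
  have "fst (label M ?y) = x" using diagram_inner(3)[OF M y(1,2)] y(3) q(2) by simp
  with y(1,2) show ?thesis by (rule that)
qed

text \<open>
  The two 2-cells at a folding edge are removed, and the resulting free faces are joined at the
  starting point of that edge. Read from there, the joint face has a boundary word of the form
  \<open>r r\<inverse>\<close>, so it can be sewn up.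
\<close>

lemma fold_reduces:
  assumes M: "diagram P M (set L)" "face (nxt M) L"
    and d: "d \<in> darts M" "d \<notin> set L" "opp M d \<notin> set L"
    and fold: "side M d = (j, p, True)" "side M (opp M d) = (j, p, False)"
  obtains N where "diagram P N (set L)" "face (nxt N) L" "label N = label M" "card (darts N) < card (darts M)"
proof -
  let ?l = "length (rels P ! j)" and ?e = "nxt M (opp M d)"
  note D = diagramD[OF M(1)]
  \<comment> \<open>\<open>A\<close> starts with the folding edge and \<open>B\<close> ends with it, so that the two boundary words are inverse.\<close>
  define A where "A = map (\<lambda>i. (nxt M ^^ i) d) [0..<?l]"
  define B where "B = map (\<lambda>i. (nxt M ^^ i) ?e) [0..<?l]"
  have sd: "(j, p, True) \<in> sides P" using diagram_inner(1)[OF M(1) d(1,2)] fold(1) by simp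
  have od: "opp M d \<in> darts M" using D(11) d(1) .
  have e: "?e \<in> darts M" "?e \<notin> set L"
    using od d(3) D(12) diagram_nxt_free_iff[OF M(1)] by auto
  obtain p' where e_side: "side M ?e = (j, p', False)" 
    using diagram_inner(2)[OF M(1) od d(3)] fold(2) by (simp add: Let_def)
  note fA = inner_face[OF M(1) d(1,2) fold(1), folded A_def]
  note fB = inner_face[OF M(1) e e_side, folded B_def]
  have per: "(side_next P ^^ ?l) (j, p, True) = (j, p, True)" by (rule side_next_cycle(1)[OF sd])
  have sB: "side M (B ! i) = flip_side (side M (A ! (?l - Suc i)))" if "i < ?l" for i
  proof -
    have "side M (B ! i) = (side_next P ^^ i) (side M ?e)" using fB(6)[of i] e_side that by (simp add: B_def)
    also have "\<dots> = (side_next P ^^ Suc i) (flip_side (j, p, True))"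
      using diagram_inner(2)[OF M(1) od d(3)] fold(2) by (simp add: funpow_swap1)
    also have "\<dots> = flip_side ((side_next P ^^ (?l - Suc i)) (j, p, True))"
      by (rule side_next_funpow_flip[OF sd per]) (use that in simp)
    also have "\<dots> = flip_side (side M (A ! (?l - Suc i)))"
    proof -
      have "A ! k = (nxt M ^^ k) d" if "k < ?l" for k using that by (simp add: A_def)
      then show ?thesis using fA(6)[of "?l - Suc i"] that by simp
    qed
    finally show ?thesis .
  qed
  have len: "length A = ?l" "length B = ?l" by (simp_all add: A_def B_def)
  have labB: "map (label M) B = winv (map (label M) A)"
  proof (rule nth_equalityI)
    fix i assume "i < length (map (label M) B)"
    then have i: "i < ?l" by (simp add: len)
    have "B ! i \<in> darts M - set L" "A ! (?l - Suc i) \<in> darts M - set L"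
      using fA(3) fB(3) i len by (metis nth_mem subsetD, metis nth_mem subsetD diff_less zero_less_Suc less_zeroE not_gr_zero)
    then have "label M (B ! i) = inv_letter (label M (A ! (?l - Suc i)))"
      using diagram_inner(3)[OF M(1)] sB[OF i] by simp
    then show "map (label M) B ! i = winv (map (label M) A) ! i"
      using i by (simp add: winv_def rev_nth len)
  qed (simp add: winv_def len)
  have AB: "set A \<inter> set B = {}"
  proof -
    have "snd (snd (side_next P s)) = snd (snd s)" for s by (cases s) (simp add: Let_def)
    then have se: "snd (snd ((side_next P ^^ i) s)) = snd (snd s)" for i s by (induction i) simp_all
    have "snd (snd (side M x))" if "x \<in> set A" for x using that fA(6) se by (auto simp: A_def)
    moreover have "\<not> snd (snd (side M x))" if "x \<in> set B" for x using that fB(6) se by (auto simp: B_def)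
    ultimately show ?thesis by blast
  qed
  have nl: "nxt M (last K) = hd K" if "face (nxt M) K" "K \<noteq> []" for K
    using that face_snoc[of "nxt M" "butlast K" "last K"] by simp
  have inj: "nxt M x = nxt M y \<longleftrightarrow> x = y" for x y using permutes_inj[OF D(3)] by (auto dest: injD)
  have lA: "nxt M (last A) = d" using nl[OF fA(1,4)] fA(5) by simp
  have lB: "last B = opp M d" using nl[OF fB(1,4)] fB(5) inj by simp
  have lastA: "last A \<in> darts M" using fA(3,4) last_in_set by blast
  have eq: "(last A, last B) \<in> eqv (perm_graph (darts M) (opp M \<circ> nxt M))"
    using eqv_perm_graph_step[OF lastA, of "opp M \<circ> nxt M"] lA lB by simp
  have F: "diagram P M (set L \<union> set A \<union> set B)"
    by (intro diagram_free_more M(1)) (use fA fB face_image[OF fA(1)] face_image[OF fB(1)] in auto)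
  let ?M = "M\<lparr>nxt := nxt M \<circ> Transposition.transpose (last A) (last B)\<rparr>"
  note j = diagram_join_faces[OF F fA(1) fB(1) fA(4) fB(4) _ _ AB disjI1[OF eq]]
  have jd: "diagram P ?M (set (A @ B) \<union> set L)" "face (nxt ?M) (A @ B)"
    using j by (auto simp: Un_ac)
  have "set (A @ B) \<inter> set L = {}" using fA(3) fB(3) by auto
  note cf = cancel_face[OF jd this]
  have "map (label ?M) (A @ B) = map (label M) A @ winv (map (label M) A)" using labB by simp
  then obtain N where N: "diagram P N (set L)" "darts N = darts ?M - set (A @ B)" "label N = label ?M"
    "\<And>x. x \<in> darts N \<Longrightarrow> nxt N x = nxt ?M x"
    using cf by metis
  show ?thesis
  proof (rule that[OF N(1)])
    have "nxt N x = nxt M x" if "x \<in> set L" for x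
    proof -
      have "x \<noteq> last A" "x \<noteq> last B" using that fA(3,4) fB(3,4) last_in_set by blast+
      then show ?thesis using N(4)[of x] diagramD(5)[OF N(1)] that by (auto simp: transpose_def)
    qed
    then show "face (nxt N) L" using M(2) face_cong by metis
    show "label N = label M" using N(3) by simp
    have "darts N \<subset> darts M" using N(2) fA(2) d(1) by auto
    then show "card (darts N) < card (darts M)" using D(2) psubset_card_mono by blast
  qed
qed

text \<open>
  Minimality in the number of darts is convenient because gluing preserves this number and only
  discarding edges lowers it.
\<close>

definition minimal_diagram :: "'a presentation \<Rightarrow> 'a word \<Rightarrow> 'a diag \<Rightarrow> nat list \<Rightarrow> bool" where
  "minimal_diagram P w M L \<longleftrightarrow>
     (diagram P M (set L) \<and> face (nxt M) L \<and> map (label M) L = w) \<and>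
     (\<forall>N K. diagram P N (set K) \<and> face (nxt N) K \<and> map (label N) K = w \<longrightarrow>
        card (darts M) \<le> card (darts N))"

lemma minimal_diagram_exists:
  assumes "bounds P w"
  obtains M L where "minimal_diagram P w M L"
proof -
  let ?Q = "\<lambda>(M, L). diagram P M (set L) \<and> face (nxt M) L \<and> map (label M) L = w"
  obtain M0 L0 where "?Q (M0, L0)" using assms by (auto simp: bounds_def)
  from ex_has_least_nat[of ?Q, OF this, of "\<lambda>(M, L). card (darts M)"]
  obtain X where X: "?Q X" "\<forall>Y. ?Q Y \<longrightarrow> (case X of (M, L) \<Rightarrow> card (darts M)) \<le> (case Y of (M, L) \<Rightarrow> card (darts M))"
    by blast
  obtain M L where "X = (M, L)" by (cases X)
  with X have "minimal_diagram P w M L" unfolding minimal_diagram_def by auto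
  then show ?thesis by (rule that)
qed

lemma minimal_diagram_no_fold:
  assumes min: "minimal_diagram P w M L"
    and d: "d \<in> darts M" "d \<notin> set L" "opp M d \<notin> set L"
    and fold: "side M d = (j, p, e)" "side M (opp M d) = (j, p, \<not> e)"
  shows False
proof -
  have M: "diagram P M (set L)" "face (nxt M) L" "map (label M) L = w"
    using min by (auto simp: minimal_diagram_def)
  note D = diagramD[OF M(1)]
  obtain N where "diagram P N (set L)" "face (nxt N) L" "label N = label M" "card (darts N) < card (darts M)"
  proof (cases e)
    case True
    then show ?thesis using fold_reduces[OF M(1,2) d, of j p] fold that by auto
  next
    case False
    then show ?thesis
      using fold_reduces[OF M(1,2) D(11)[OF d(1)] d(3), of j p] D(9)[OF d(1)] d(2) fold that by auto
  qed
  then show False using min M(3) unfolding minimal_diagram_def by (metis not_less)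
qed

section \<open>Doubling a minimal diagram\<close>

lemma card_fixed_point_free_involution:
  assumes "finite K" "\<And>d. d \<in> K \<Longrightarrow> \<rho> d \<in> K \<and> \<rho> d \<noteq> d \<and> \<rho> (\<rho> d) = d"
  shows "card K = 2 * card ((\<lambda>d. {d, \<rho> d}) ` K)"
proof -
  have "2 * card ((\<lambda>d. {d, \<rho> d}) ` K) = card (\<Union>((\<lambda>d. {d, \<rho> d}) ` K))"
  proof (rule card_partition)
    show "finite (\<Union>((\<lambda>d. {d, \<rho> d}) ` K))" using assms by auto
    show "card c = 2" if c: "c \<in> (\<lambda>d. {d, \<rho> d}) ` K" for c
    proof -
      obtain d where "d \<in> K" "c = {d, \<rho> d}" using c by blast
      then show ?thesis using assms(2)[of d] by (metis card_2_iff)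
    qed
    show "c \<inter> c' = {}" if c: "c \<in> (\<lambda>d. {d, \<rho> d}) ` K" "c' \<in> (\<lambda>d. {d, \<rho> d}) ` K" "c \<noteq> c'" for c c'
    proof -
      obtain x y where xy: "x \<in> K" "y \<in> K" "c = {x, \<rho> x}" "c' = {y, \<rho> y}" using c by auto
      show ?thesis
      proof (rule ccontr)
        assume "c \<inter> c' \<noteq> {}"
        then have "x = y \<or> x = \<rho> y \<or> \<rho> x = y \<or> \<rho> x = \<rho> y" using xy by auto
        then have "x = y \<or> x = \<rho> y" using assms(2)[OF xy(1)] assms(2)[OF xy(2)] by metis
        then have "c = c'" using xy assms(2)[OF xy(2)] by auto
        then show False using c(3) by simp
      qed
    qed
  qed (use assms(1) in simp)
  moreover have "\<Union>((\<lambda>d. {d, \<rho> d}) ` K) = K" using assms(2) by auto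
  ultimately show ?thesis by simp
qed

lemma orbit_involution:
  assumes "\<rho> (\<rho> d) = d"
  shows "orbit \<rho> d = {d, \<rho> d}"
proof
  have "y \<in> {d, \<rho> d}" if "y \<in> orbit \<rho> d" for y
    using that by induction (use assms in auto)
  then show "orbit \<rho> d \<subseteq> {d, \<rho> d}" by blast
  have "\<rho> d \<in> orbit \<rho> d" by (rule orbit.base)
  then have "\<rho> (\<rho> d) \<in> orbit \<rho> d" by (rule orbit.step)
  then show "{d, \<rho> d} \<subseteq> orbit \<rho> d" using assms \<open>\<rho> d \<in> orbit \<rho> d\<close> by simp
qed

text \<open>
  In a finite permutation every step can be undone by going around its cycle, so following the
  permutations forwards reaches the whole class.
\<close>

lemma eqv_perm_graph_imp_rtrancl:
  assumes "finite K" "\<pi> permutes K" "\<rho> permutes K" "x \<in> K"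
    and "(x, y) \<in> eqv (perm_graph K \<pi> \<union> perm_graph K \<rho>)"
  shows "(x, y) \<in> {(a, b). a \<in> K \<and> (b = \<rho> a \<or> b = \<pi> a)}\<^sup>*"
proof -
  let ?E = "{(a, b). a \<in> K \<and> (b = \<rho> a \<or> b = \<pi> a)}"
  have bwd: "(f u, u) \<in> ?E\<^sup>*" if f: "f permutes K" "f = \<pi> \<or> f = \<rho>" and u: "u \<in> K" for f u
  proof -
    have "v \<in> K \<and> (f u, v) \<in> ?E\<^sup>*" if "v \<in> orbit f u" for v
      using that
    proof induction
      case base
      then show ?case using u permutes_in_image[OF f(1)] by simp
    next
      case (step v)
      then have "(v, f v) \<in> ?E" using f(2) by auto
      then show ?case using step permutes_in_image[OF f(1)] rtrancl_into_rtrancl[of "f u" v ?E] by simp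
    qed
    then show ?thesis using self_in_orbit[OF assms(1) f(1)] by blast
  qed
  have step: "(u, v) \<in> ?E\<^sup>* \<and> (v, u) \<in> ?E\<^sup>*" if "(u, v) \<in> perm_graph K \<pi> \<union> perm_graph K \<rho>" for u v
  proof -
    from that have u: "u \<in> K" "v = \<pi> u \<or> v = \<rho> u" by (auto simp: perm_graph_def)
    then have "(u, v) \<in> ?E" by auto
    moreover have "(v, u) \<in> ?E\<^sup>*" using u bwd[OF assms(2)] bwd[OF assms(3)] by auto
    ultimately show ?thesis by blast
  qed
  have "(perm_graph K \<pi> \<union> perm_graph K \<rho>) \<union> (perm_graph K \<pi> \<union> perm_graph K \<rho>)\<inverse> \<subseteq> ?E\<^sup>*" using step by auto
  then have "eqv (perm_graph K \<pi> \<union> perm_graph K \<rho>) \<subseteq> ?E\<^sup>*" unfolding eqv_def by (rule rtrancl_subset_rtrancl)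
  then show ?thesis using assms(5) by blast
qed

text \<open>
  A component of a planar surface is planar, and for a connected surface defect zero means Euler
  characteristic 2.
\<close>

lemma component_sphere:
  assumes N: "diagram P N {}" and d0: "d0 \<in> darts N"
  obtains C where "spherical_diagram P C (side N)" "darts C \<subseteq> darts N" "d0 \<in> darts C"
    "\<And>d. d \<in> darts C \<Longrightarrow> opp C d = opp N d"
proof -
  note D = diagramD[OF N]
  let ?D = "darts N"
  let ?R = "perm_graph ?D (nxt N) \<union> perm_graph ?D (opp N)"
  define K where "K = eqv ?R `` {d0}"
  have "y \<in> ?D" if "y \<in> K" for y
  proof (rule eqv_in_closed[of d0 y ?R])
    show "(d0, y) \<in> eqv ?R" using that by (simp add: K_def)
    show "u \<in> ?D \<longleftrightarrow> v \<in> ?D" if "(u, v) \<in> ?R" for u v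
      using that D(11,12) by (auto simp: perm_graph_def)
  qed (rule d0)
  then have sub: "K \<subseteq> ?D" by blast
  have d0K: "d0 \<in> K" by (simp add: K_def)
  have st: "nxt N d \<in> K" "opp N d \<in> K" if "d \<in> K" for d
  proof -
    have "(d, nxt N d) \<in> eqv ?R" "(d, opp N d) \<in> eqv ?R"
      using that sub by (auto simp: perm_graph_def intro: eqv_base)
    then show "nxt N d \<in> K" "opp N d \<in> K" using that eqv_trans[of d0 d ?R] by (auto simp: K_def)
  qed
  define \<pi> where "\<pi> = perm_restrict (nxt N) K"
  define \<rho> where "\<rho> = perm_restrict (opp N) K"
  have \<pi>: "\<pi> d = nxt N d" and \<rho>: "\<rho> d = opp N d" if "d \<in> K" for d
    using that by (simp_all add: \<pi>_def \<rho>_def perm_restrict_simps)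
  have pl: "planar K \<pi> \<rho>"
    unfolding \<pi>_def \<rho>_def by (rule planar_restrict[OF D(1) sub]) (use st in auto)
  note p = planarD[OF pl]
  have conn: "(x, y) \<in> eqv (perm_graph K \<pi> \<union> perm_graph K \<rho>)" if "x \<in> K" "y \<in> K" for x y
  proof -
    have "eqv ?R \<subseteq> {(u, v). (u \<in> K \<longleftrightarrow> v \<in> K) \<and> (u \<in> K \<longrightarrow> (u, v) \<in> eqv (perm_graph K \<pi> \<union> perm_graph K \<rho>))}" (is "_ \<subseteq> ?E")
    proof (rule eqv_least)
      show "?R \<subseteq> ?E"
      proof
        fix q assume "q \<in> ?R"
        then obtain u v where q: "q = (u, v)" "u \<in> ?D" "v = nxt N u \<or> v = opp N u" by (auto simp: perm_graph_def)
        have uv: "(u, v) \<in> eqv ?R" using q by (auto simp: perm_graph_def intro: eqv_base)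
        have "u \<in> K \<longleftrightarrow> v \<in> K"
          unfolding K_def using eqv_trans[OF _ uv, of d0] eqv_trans[OF _ eqv_sym[OF uv], of d0] by auto
        moreover have "(u, v) \<in> eqv (perm_graph K \<pi> \<union> perm_graph K \<rho>)" if "u \<in> K"
          using q(3) \<pi>[OF that] \<rho>[OF that] that by (intro eqv_base) (auto simp: perm_graph_def)
        ultimately show "q \<in> ?E" using q(1) by simp
      qed
      show "(u, u) \<in> ?E" for u by simp
      show "(v, u) \<in> ?E" if "(u, v) \<in> ?E" for u v
        using that eqv_sym[of u v] by simp
      show "(u, w) \<in> ?E" if "(u, v) \<in> ?E" "(v, w) \<in> ?E" for u v w
        using that eqv_trans[of u v _ w] by simp
    qed
    moreover have "(x, y) \<in> eqv ?R"
      using that eqv_trans[OF eqv_sym, of d0 x ?R y] by (simp add: K_def)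
    ultimately show ?thesis using that(1) by blast
  qed
  have inv: "\<rho> d \<in> K \<and> \<rho> d \<noteq> d \<and> \<rho> (\<rho> d) = d" if "d \<in> K" for d
    using that st[OF that] \<rho>[OF that] \<rho>[of "opp N d"] D(8,9)[of d] sub by auto
  define C where "C = \<lparr>darts = K, opp = \<rho>, nxt = \<pi>\<rparr>"
  have "closed_surface C" unfolding closed_surface_def C_def using p inv by simp
  moreover have "connected_surface C"
    unfolding connected_surface_def C_def using eqv_perm_graph_imp_rtrancl[OF p(1-3) _ conn] by simp
  moreover have "euler_char C = 2"
  proof -
    have "eqv (perm_graph K \<pi> \<union> perm_graph K \<rho>) `` {x} = eqv (perm_graph K \<pi> \<union> perm_graph K \<rho>) `` {d0}" if "x \<in> K" for x
      using conn[OF that d0K] by (simp only: eqv_class_eq)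
    then have "(\<lambda>x. eqv (perm_graph K \<pi> \<union> perm_graph K \<rho>) `` {x}) ` K = (\<lambda>x. eqv (perm_graph K \<pi> \<union> perm_graph K \<rho>) `` {d0}) ` K"
      by (rule image_cong[OF refl])
    also have "\<dots> = {eqv (perm_graph K \<pi> \<union> perm_graph K \<rho>) `` {d0}}" by (rule image_constant[OF d0K])
    finally have "(\<lambda>x. eqv (perm_graph K \<pi> \<union> perm_graph K \<rho>) `` {x}) ` K = {eqv (perm_graph K \<pi> \<union> perm_graph K \<rho>) `` {d0}}" .
    then have 1: "nclasses K (perm_graph K \<pi> \<union> perm_graph K \<rho>) = 1" by (simp add: nclasses_def)
    have 2: "nclasses K (perm_graph K \<pi>) = card (cells2 C)"
      using nclasses_perm_graph[OF p(1,2)] by (simp add: cells2_def C_def)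
    have "orbit \<rho> ` K = cells1 C"
      unfolding cells1_def C_def using orbit_involution[of \<rho>] inv by (auto intro!: image_cong)
    then have 3: "nclasses K (perm_graph K \<rho>) = card (cells1 C)" using nclasses_perm_graph[OF p(1,3)] by simp
    have 4: "nclasses K (perm_graph K (\<pi> \<circ> \<rho>)) = card (cells0 C)"
      using nclasses_perm_graph[OF p(1) permutes_compose[OF p(3,2)]] by (simp add: cells0_def C_def)
    have "card K = 2 * card (cells1 C)"
      using card_fixed_point_free_involution[OF p(1) inv] by (simp add: cells1_def C_def)
    then show ?thesis using p(4) 1 2 3 4 unfolding defect_def euler_char_def by simp
  qed
  moreover have "combinatorial_map P C (side N)"
    unfolding combinatorial_map_def
  proof (intro conjI ballI)
    fix d assume "d \<in> darts C"
    then have d: "d \<in> K" "d \<in> ?D" using sub by (auto simp: C_def)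
    note i = diagram_inner[OF N d(2) empty_iff[THEN iffD1, THEN notI]]
    note i' = diagram_inner[OF N D(11)[OF d(2)] empty_iff[THEN iffD1, THEN notI]]
    show "side N d \<in> sides P" by (rule i(1))
    show "side N (nxt C d) = side_next P (side N d)" using i(2) \<pi>[OF d(1)] by (simp add: C_def)
    show "side_letter P (side N (opp C d)) = inv_letter (side_letter P (side N d))"
      using i(3) i'(3) D(10)[OF d(2)] \<rho>[OF d(1)] by (simp add: C_def)
  next
    fix c assume "c \<in> cells2 C"
    then obtain d where d: "d \<in> K" "c = orbit \<pi> d" by (auto simp: cells2_def C_def)
    have "orbit \<pi> d = orbit (nxt N) d"
      by (rule orbit_cong0[OF d(1)]) (use \<pi> st in auto)
    moreover have "d \<in> ?D" using d(1) sub by blast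
    ultimately show "inj_on (side N) c" using diagram_inner(4)[OF N] d(2) by simp
  qed
  ultimately have "spherical_diagram P C (side N)"
    by (simp add: spherical_diagram_def sphere_structure_def)
  then show ?thesis
    by (rule that) (use sub d0K \<rho> in \<open>simp_all add: C_def\<close>)
qed

text \<open>
  A minimal diagram is glued to its mirror image along the outer face. The result has no free face,
  so each of its components is a spherical diagram. If there were a 2-cell, one of these would contain
  an edge labelled \<open>x\<close>, and hence a folding edge labelled \<open>x\<close>. The letter \<open>x\<close> does not occur on the seam,
  so this edge and its two 2-cells lie in one of the two copies, against minimality.
\<close>

lemma minimal_diagram_no_inner:
  assumes min: "minimal_diagram P w M L" and ne: "w \<noteq> []"
    and DR: "DR_in_all_directions P" and x: "x \<in> gens P" "x \<notin> fst ` set w"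
    and all: "\<forall>r \<in> set (rels P). x \<in> fst ` set r"
  shows "darts M = set L"
proof (rule ccontr)
  assume contr: "darts M \<noteq> set L"
  have M: "diagram P M (set L)" "face (nxt M) L" "map (label M) L = w"
    using min by (auto simp: minimal_diagram_def)
  note D = diagramD[OF M(1)]
  obtain d0 where "d0 \<in> darts M" "d0 \<notin> set L" using contr D(5) by blast
  then obtain y where y: "y \<in> darts M" "y \<notin> set L" "fst (label M y) = x"
    using inner_label_occurs[OF M(1) _ _ all] by metis
  obtain h where h: "h \<circ> h = id" "darts M \<inter> h ` darts M = {}"
    using exists_disjoint_relabelling[OF D(2) D(2)] .
  have hh: "h (h z) = z" for z using h(1) by (simp add: fun_eq_iff)
  \<comment> \<open>The mirror image, on a disjoint set of darts, and its outer face \<open>L'\<close>.\<close>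
  define N0 where "N0 = relabel_diag h (mirror_diag M)"
  define L' where "L' = map h (rev L)"
  have N0_simps: "darts N0 = h ` darts M" "opp N0 (h z) = h (opp M z)"
    "side N0 (h z) = flip_side (side M z)" "label N0 (h z) = inv_letter (label M z)" for z
    by (simp_all add: N0_def relabel_diag_def mirror_diag_def hh)
  have N0: "diagram P N0 (set L')"
    unfolding N0_def L'_def using diagram_relabel[OF diagram_mirror[OF M(1)] h(1)] by simp
  have fN0: "face (nxt N0) L'"
    using face_relabel[OF h(1) face_inv[OF M(2) permutes_inj[OF D(3)]]]
    by (simp add: N0_def L'_def relabel_diag_def mirror_diag_def)
  have L: "L \<noteq> []" "L' \<noteq> []" using ne M(3) by (auto simp: L'_def)
  have dis: "darts M \<inter> darts N0 = {}" using h(2) N0_simps(1) by simp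
  note U = union_diag_simps[where M = M and N = N0]
  obtain \<pi> where "diagram P ((union_diag M N0)\<lparr>nxt := \<pi>\<rparr>) (set (L @ L'))" "face \<pi> (L @ L')"
    using diagram_disjoint_union_join[OF M(1,2) L(1) N0 fN0 L(2) dis] by metis
  moreover define W where "W = (union_diag M N0)\<lparr>nxt := \<pi>\<rparr>"
  ultimately have W: "diagram P W (set (L @ L') \<union> {})" "face (nxt W) (L @ L')"
    by simp_all
  have W_simps: "darts W = darts M \<union> darts N0" "opp W = opp (union_diag M N0)"
    "side W = side (union_diag M N0)" "label W = label (union_diag M N0)"
    by (simp_all add: W_def U(1))
  have L'_out: "h z \<notin> darts M" if "z \<in> darts M" for z using that h(2) by blast
  have lab: "map (label W) (L @ L') = w @ winv w"
  proof -
    have "map (label W) L = w" using M(3) D(5) U(5) by (auto simp: W_simps subset_iff intro!: map_cong)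
    moreover have "map (label W) L' = map (\<lambda>z. inv_letter (label M z)) (rev L)"
      unfolding L'_def map_map using D(5) L'_out U(9) N0_simps(4)
      by (intro map_cong) (auto simp: W_simps subset_iff)
    ultimately show ?thesis using M(3) by (auto simp: winv_def rev_map)
  qed
  obtain N where N: "diagram P N {}" "darts N = darts W - set (L @ L')" "side N = side W"
    "label N = label W" "\<And>d. d \<in> darts N \<Longrightarrow> opp N d = opp W d \<or> fst (label W d) \<in> fst ` set w"
    using cancel_face[OF W _ lab] by (metis inf_bot_right)
  have "y \<notin> set L'"
    using y(1) D(5) L'_out by (auto simp: L'_def)
  then have yN: "y \<in> darts N" using N(2) y W_simps by simp
  obtain C where C: "spherical_diagram P C (side N)" "darts C \<subseteq> darts N" "y \<in> darts C"
    "\<And>d. d \<in> darts C \<Longrightarrow> opp C d = opp N d"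
    using component_sphere[OF N(1) yN] by metis
  have el: "edge_label P (side N) d = fst (label W d)" if "d \<in> darts N" for d
    using diagram_inner(3)[OF N(1) that] N(4) by (simp add: edge_label_def)
  have "edge_label P (side N) y = x" using el[OF yN] y U(5)[OF y(1)] by (simp add: W_simps)
  then obtain d where d: "d \<in> darts C" "edge_label P (side N) d = x" "folding_edge C (side N) d"
    using DR x(1) C(1,3) unfolding DR_in_all_directions_def by blast
  have dN: "d \<in> darts N" using d(1) C(2) by blast
  \<comment> \<open>The edge at \<open>d\<close> was not touched when the seam was closed.\<close>
  have "fst (label W d) = x" using el[OF dN] d(2) by simp
  then have od: "opp N d = opp W d" using N(5)[OF dN] x(2) by auto
  obtain j p e where fold: "side W d = (j, p, e)" "side W (opp W d) = (j, p, \<not> e)"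
    using d(3) C(4)[OF d(1)] od N(3) unfolding folding_edge_def by auto
  have odN: "opp W d \<in> darts N" using diagramD(11)[OF N(1) dN] od by simp
  show False
  proof (cases "d \<in> darts M")
    case True
    then have o: "opp W d = opp M d" using U(2) W_simps by simp
    have "opp M d \<in> darts M" using D(11) True .
    then show False
      using minimal_diagram_no_fold[OF min True, of j p e] dN odN N(2) o fold U(4) True
      by (simp add: W_simps)
  next
    case False
    then obtain z where z: "z \<in> darts M" "d = h z" using dN N(2) W_simps N0_simps(1) by auto
    have o: "opp W d = h (opp M z)" using U(6)[OF False] z N0_simps by (simp add: W_simps)
    have oz: "opp M z \<in> darts M" using D(11) z(1) .
    have "side M z = flip_side (j, p, e)"
      using fold(1) U(8)[OF False] z N0_simps(3)[of z] flip_side_simps(1) by (metis W_simps(3))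
    moreover have "side M (opp M z) = flip_side (j, p, \<not> e)"
      using fold(2) U(8)[OF L'_out[OF oz]] o N0_simps(3)[of "opp M z"] flip_side_simps(1)
      by (metis W_simps(3))
    moreover have "z \<notin> set L" "opp M z \<notin> set L"
      using dN odN N(2) z(2) o by (auto simp: L'_def)
    ultimately show False using minimal_diagram_no_fold[OF min z(1), of j p "\<not> e"] by simp
  qed
qed

lemma reduced_nth:
  "reduced w \<Longrightarrow> Suc i < length w \<Longrightarrow> w ! Suc i \<noteq> inv_letter (w ! i)"
proof (induction w arbitrary: i rule: reduced.induct)
  case (1 a b w)
  then show ?case by (cases i) auto
qed auto

text \<open>
  Otherwise all classes but one have at least two elements, and their sizes add up to more than
  \<open>card D\<close>.
\<close>

lemma two_singleton_classes:
  assumes "finite D" "R \<subseteq> D \<times> D" "card D + 2 \<le> 2 * nclasses D R"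
  obtains x y where "x \<in> D" "y \<in> D" "x \<noteq> y" "eqv R `` {x} = {x}" "eqv R `` {y} = {y}"
proof -
  let ?C = "(\<lambda>x. eqv R `` {x}) ` D"
  define S where "S = {c \<in> ?C. card c = 1}"
  have sub: "eqv R `` {x} \<subseteq> D" if "x \<in> D" for x
    using eqv_in_closed[of x _ R D] that assms(2) by blast
  then have U: "\<Union>?C = D" by (auto simp: subset_iff)
  have fin: "finite c" if "c \<in> ?C" for c using that sub assms(1) finite_subset by blast
  have "card (\<Union>?C) = sum card ?C"
  proof (rule card_Union_disjoint)
    show "pairwise disjnt ?C"
    proof (rule pairwiseI)
      fix c c' assume "c \<in> ?C" "c' \<in> ?C" "c \<noteq> c'"
      then obtain x y where xy: "c = eqv R `` {x}" "c' = eqv R `` {y}" by blast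
      with \<open>c \<noteq> c'\<close> have ne: "(x, y) \<notin> eqv R" by (simp add: eqv_class_eq)
      show "disjnt c c'"
        unfolding disjnt_def
      proof (rule ccontr)
        assume "c \<inter> c' \<noteq> {}"
        then obtain z where "(x, z) \<in> eqv R" "(y, z) \<in> eqv R" using xy by auto
        then show False using ne eqv_trans[OF _ eqv_sym] by metis
      qed
    qed
  qed (rule fin)
  moreover have "2 * card ?C \<le> sum card ?C + card S"
  proof -
    have "2 * card ?C = (\<Sum>c\<in>?C. 2)" by simp
    also have "\<dots> \<le> (\<Sum>c\<in>?C. card c + (if card c = 1 then 1 else 0))"
    proof (rule sum_mono)
      fix c assume c: "c \<in> ?C"
      then obtain x where "c = eqv R `` {x}" by blast
      then have "x \<in> c" by simp
      then have "card c \<noteq> 0" using fin[OF c] by auto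
      then show "2 \<le> card c + (if card c = 1 then 1 else 0)" by auto
    qed
    also have "\<dots> = sum card ?C + (\<Sum>c\<in>?C. if card c = 1 then 1 else 0)" by (rule sum.distrib)
    also have "(\<Sum>c\<in>?C. if card c = 1 then 1 else 0) = (\<Sum>c\<in>S. 1)"
      unfolding S_def by (rule sum.inter_filter[symmetric]) (use assms(1) in simp)
    finally show ?thesis by simp
  qed
  ultimately have "2 \<le> card S" using assms(3) U unfolding nclasses_def by simp
  then obtain c c' where cc: "c \<in> S" "c' \<in> S" "c \<noteq> c'"
    by (metis card_2_iff' card_le_Suc0_iff_eq card_ge_0_finite not_less_eq_eq numeral_2_eq_2 zero_less_numeral order_less_le_trans)
  have single: "\<exists>x \<in> D. c = eqv R `` {x} \<and> c = {x}" if cS: "c \<in> S" for c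
  proof -
    obtain x where x: "x \<in> D" "c = eqv R `` {x}" "card c = 1" using cS by (auto simp: S_def)
    have "x \<in> c" using x by simp
    then have "c = {x}" using x(3) by (metis card_1_singletonE singletonD)
    then show ?thesis using x by blast
  qed
  obtain x y where "x \<in> D" "c = eqv R `` {x}" "c = {x}" "y \<in> D" "c' = eqv R `` {y}" "c' = {y}"
    using single[OF cc(1)] single[OF cc(2)] by blast
  then show ?thesis using that[of x y] cc(3) by simp
qed

text \<open>
  A planar surface with one face and \<open>e\<close> edges has \<open>e + 1\<close> vertices, hence at least two vertices of
  degree one: it is a tree with two leaves. At a leaf the boundary word backtracks. One of the
  two leaves is not the base point, so the two inverse letters there are consecutive in the word,
  and not just cyclically consecutive.
\<close>

lemma one_face_diagram_not_reduced:
  assumes M: "diagram P M (set L)" "face (nxt M) L" "darts M = set L" "L \<noteq> []"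
  shows "\<not> reduced (map (label M) L)"
proof
  assume red: "reduced (map (label M) L)"
  note D = diagramD[OF M(1)]
  let ?D = "darts M"
  have conn: "(x, y) \<in> eqv (perm_graph ?D (nxt M))" if "x \<in> ?D" "y \<in> ?D" for x y
    by (rule face_eqv[OF M(2)]) (use that M(3) in auto)
  have one: "nclasses ?D R = 1" if "perm_graph ?D (nxt M) \<subseteq> R" for R
  proof -
    have "eqv R `` {x} = eqv R `` {hd L}" if "x \<in> ?D" for x
      unfolding eqv_class_eq using eqv_mono[OF \<open>perm_graph ?D (nxt M) \<subseteq> R\<close>] conn[OF that, of "hd L"] M(3,4) by auto
    then have "(\<lambda>x. eqv R `` {x}) ` ?D = (\<lambda>x. eqv R `` {hd L}) ` ?D"
      by (rule image_cong[OF refl])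
    also have "\<dots> = {eqv R `` {hd L}}" by (rule image_constant[of "hd L"]) (use M(3,4) in simp)
    finally show ?thesis by (simp add: nclasses_def)
  qed
  have "card ?D = 2 * card ((\<lambda>d. {d, opp M d}) ` ?D)"
    by (rule card_fixed_point_free_involution) (use D in auto)
  moreover have "orbit (opp M) ` ?D = (\<lambda>d. {d, opp M d}) ` ?D"
    using orbit_involution[of "opp M"] D(9) by (intro image_cong) auto
  ultimately have "card ?D = 2 * nclasses ?D (perm_graph ?D (opp M))" using nclasses_perm_graph[OF D(2,4)] by simp
  moreover have "defect ?D (nxt M) (opp M) = 0" using planarD(4)[OF D(1)] .
  ultimately have "card ?D + 2 = 2 * nclasses ?D (perm_graph ?D (nxt M \<circ> opp M))"
    using one[OF subset_refl] one[OF Un_upper1, of "perm_graph ?D (opp M)"] unfolding defect_def by simp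
  moreover have "perm_graph ?D (nxt M \<circ> opp M) \<subseteq> ?D \<times> ?D" by (rule perm_graph_subset) (use D(11,12) in auto)
  ultimately obtain x y where xy: "x \<in> ?D" "y \<in> ?D" "x \<noteq> y"
    "eqv (perm_graph ?D (nxt M \<circ> opp M)) `` {x} = {x}" "eqv (perm_graph ?D (nxt M \<circ> opp M)) `` {y} = {y}"
    using two_singleton_classes[OF D(2)] by (metis order_refl)
  have fixed: "nxt M (opp M z) = z" if "z \<in> ?D" "eqv (perm_graph ?D (nxt M \<circ> opp M)) `` {z} = {z}" for z
    using eqv_perm_graph_step[OF that(1), of "nxt M \<circ> opp M"] that(2) by auto
  obtain z where z: "z \<in> ?D" "nxt M (opp M z) = z" "z \<noteq> L ! 0"
    using xy fixed by metis
  then obtain k where k: "k < length L" "z = L ! k" using M(3) by (metis in_set_conv_nth)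
  then obtain i where i: "k = Suc i" using z(3) by (cases k) auto
  have "map (nxt M) L ! i = rotate1 L ! i" using M(2) by (simp add: face_def)
  then have "nxt M (L ! i) = z" using k i by (simp add: nth_rotate1)
  then have "opp M z = L ! i" using z(2) permutes_inj[OF D(3)] by (metis injD)
  then have "label M (L ! i) = inv_letter (label M (L ! Suc i))" using D(10)[OF z(1)] k i by simp
  then show False using reduced_nth[OF red, of i] k i by simp
qed

theorem bounds_reduced_imp_Nil:
  assumes "bounds P w" "reduced w" "DR_in_all_directions P" "x \<in> gens P" "x \<notin> fst ` set w"
    and "\<forall>r \<in> set (rels P). x \<in> fst ` set r"
  shows "w = []"
proof (rule ccontr)
  assume ne: "w \<noteq> []"
  obtain M L where min: "minimal_diagram P w M L" using minimal_diagram_exists[OF assms(1)] .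
  then have M: "diagram P M (set L)" "face (nxt M) L" "map (label M) L = w"
    by (auto simp: minimal_diagram_def)
  have "darts M = set L" by (rule minimal_diagram_no_inner[OF min ne assms(3-6)])
  then show False using one_face_diagram_not_reduced[OF M(1,2)] M(3) ne assms(2) by auto
qed

section \<open>From the presented group to diagrams\<close>

lemma reduced_Cons: "reduced (a # w) \<longleftrightarrow> reduced w \<and> (\<forall>b v. w = b # v \<longrightarrow> b \<noteq> inv_letter a)"
  by (cases w) auto

lemma reduced_cons_red: "reduced w \<Longrightarrow> reduced (cons_red a w)"
  by (cases w) (auto simp: reduced_Cons)

lemma reduced_foldr: "reduced v \<Longrightarrow> reduced (foldr cons_red u v)"
  by (induction u) (simp_all add: reduced_cons_red)

lemma set_foldr_cons_red: "set (foldr cons_red u v) \<subseteq> set u \<union> set v"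
proof (induction u)
  case (Cons a u)
  have "set (cons_red a w) \<subseteq> insert a (set w)" for w :: "'a word" by (cases w) auto
  from this[of "foldr cons_red u v"] Cons show ?case by auto
qed simp

lemma cons_red_inv: "reduced w \<Longrightarrow> cons_red a (cons_red (inv_letter a) w) = w"
proof (cases w)
  case (Cons b v)
  assume "reduced w"
  then show ?thesis by (cases v) (auto simp: Cons reduced_Cons)
qed simp

lemma cons_red_reduced: "reduced (a # w) \<Longrightarrow> cons_red a w = a # w"
  by (cases w) auto

lemma foldr_cons_red_cons:
  assumes "reduced z"
  shows "foldr cons_red (cons_red a v) z = cons_red a (foldr cons_red v z)"
proof (cases v)
  case (Cons b u)
  then show ?thesis using cons_red_inv[OF reduced_foldr[OF assms], of a u] by auto
qed simp

text \<open>
  Associativity of the reduced product: left multiplication by a letter and by its inverse are inverse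
  permutations of the reduced words, so a cancellation in \<open>u v\<close> does not affect the action on \<open>z\<close>.
\<close>

lemma foldr_cons_red_assoc:
  "reduced z \<Longrightarrow> foldr cons_red (foldr cons_red u v) z = foldr cons_red u (foldr cons_red v z)"
  by (induction u) (simp_all add: foldr_cons_red_cons)

lemma reduce_reduced: "reduced w \<Longrightarrow> foldr cons_red w [] = w"
  by (induction w) (auto simp: reduced_Cons intro!: cons_red_reduced)

lemma foldr_winv: "reduced z \<Longrightarrow> foldr cons_red (winv w) (foldr cons_red w z) = z"
proof (induction w)
  case (Cons a w)
  then show ?case
    using cons_red_inv[OF reduced_foldr[OF Cons.prems], of "inv_letter a" w] by simp
qed simp

lemma set_winv: "set (winv w) \<subseteq> X \<times> UNIV \<longleftrightarrow> set w \<subseteq> X \<times> UNIV"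
  by (auto simp: winv_def inv_letter_def)

lemma in_free_group: "w \<in> carrier (free_group X) \<longleftrightarrow> set w \<subseteq> X \<times> UNIV \<and> reduced w"
  by (simp add: free_group_def)

lemma free_group_simps [simp]:
  "u \<otimes>\<^bsub>free_group X\<^esub> v = foldr cons_red u v" "\<one>\<^bsub>free_group X\<^esub> = []"
  by (simp_all add: free_group_def)

lemma foldr_in_free_group:
  "set u \<subseteq> X \<times> UNIV \<Longrightarrow> v \<in> carrier (free_group X) \<Longrightarrow> foldr cons_red u v \<in> carrier (free_group X)"
  using set_foldr_cons_red[of u v] by (auto simp: in_free_group reduced_foldr)

lemma group_free_group: "group (free_group X)"
proof (rule groupI)
  fix w assume w: "w \<in> carrier (free_group X)"
  let ?v = "foldr cons_red (winv w) []"
  have "?v \<in> carrier (free_group X)"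
    by (rule foldr_in_free_group) (use w set_winv in \<open>auto simp: in_free_group\<close>)
  moreover have "foldr cons_red ?v w = []"
    using w foldr_cons_red_assoc[of w "winv w" "[]"] foldr_winv[of "[]" w] reduce_reduced[of w]
    by (simp add: in_free_group)
  ultimately show "\<exists>y\<in>carrier (free_group X). y \<otimes>\<^bsub>free_group X\<^esub> w = \<one>\<^bsub>free_group X\<^esub>" by auto
next
  fix u v assume "u \<in> carrier (free_group X)" "v \<in> carrier (free_group X)"
  then show "u \<otimes>\<^bsub>free_group X\<^esub> v \<in> carrier (free_group X)"
    using foldr_in_free_group[of u X v] by (simp add: in_free_group)
qed (simp_all add: foldr_cons_red_assoc in_free_group)

lemma inv_free_group:
  assumes "w \<in> carrier (free_group X)"
  shows "inv\<^bsub>free_group X\<^esub> w = foldr cons_red (winv w) []"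
proof (rule group.inv_equality[OF group_free_group _ assms])
  show "foldr cons_red (winv w) [] \<in> carrier (free_group X)"
    by (rule foldr_in_free_group) (use assms set_winv in \<open>auto simp: in_free_group\<close>)
  show "foldr cons_red (winv w) [] \<otimes>\<^bsub>free_group X\<^esub> w = \<one>\<^bsub>free_group X\<^esub>"
    using assms foldr_cons_red_assoc[of w "winv w" "[]"] foldr_winv[of "[]" w] reduce_reduced[of w]
    by (simp add: in_free_group)
qed

lemma (in group) normal_closure_normal:
  assumes "A \<subseteq> carrier G"
  shows "normal_closure G A \<lhd> G"
  unfolding normal_closure_def
proof (rule normal_generateI)
  show "{g \<otimes> a \<otimes> inv g | g a. g \<in> carrier G \<and> a \<in> A} \<subseteq> carrier G" using assms by auto
  fix h k assume "h \<in> {g \<otimes> a \<otimes> inv g | g a. g \<in> carrier G \<and> a \<in> A}" and k: "k \<in> carrier G"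
  then obtain g a where g: "g \<in> carrier G" "a \<in> A" "h = g \<otimes> a \<otimes> inv g" by blast
  then have "k \<otimes> h \<otimes> inv k = (k \<otimes> g) \<otimes> a \<otimes> inv (k \<otimes> g)"
    using k assms by (auto simp: m_assoc inv_mult_group subset_iff)
  then show "k \<otimes> h \<otimes> inv k \<in> {g \<otimes> a \<otimes> inv g | g a. g \<in> carrier G \<and> a \<in> A}"
    using g k by blast
qed

lemma relators_in_free_group:
  "finite_presentation P \<Longrightarrow> reduce ` set (rels P) \<subseteq> carrier (free_group (gens P))"
  unfolding finite_presentation_def reduce_def
  by (auto intro!: foldr_in_free_group simp: in_free_group)

lemma bounds_reduce: "bounds P w \<Longrightarrow> bounds P (foldr cons_red w [])"
  using bounds_cons_red[of P "[]" w "[]"] by simp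

text \<open>
  The words that bound diagrams contain the relators and are closed under conjugation, formal inversion,
  concatenation and free reduction.
\<close>

lemma bounds_normal_closure:
  assumes fp: "finite_presentation P"
    and w: "w \<in> normal_closure (free_group (gens P)) (reduce ` set (rels P))"
  shows "bounds P w"
proof -
  let ?F = "free_group (gens P)"
  interpret F: group ?F by (rule group_free_group)
  have H: "h \<in> carrier ?F \<and> bounds P h"
    if "h \<in> {g \<otimes>\<^bsub>?F\<^esub> a \<otimes>\<^bsub>?F\<^esub> inv\<^bsub>?F\<^esub> g | g a. g \<in> carrier ?F \<and> a \<in> reduce ` set (rels P)}" for h
  proof -
    from that obtain g r where g: "g \<in> carrier ?F" "r \<in> set (rels P)"
      "h = g \<otimes>\<^bsub>?F\<^esub> reduce r \<otimes>\<^bsub>?F\<^esub> inv\<^bsub>?F\<^esub> g" by blast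
    have a: "reduce r \<in> carrier ?F" using relators_in_free_group[OF fp] g(2) by blast
    have ig: "inv\<^bsub>?F\<^esub> g = foldr cons_red (winv g) []" by (rule inv_free_group[OF g(1)])
    have "bounds P (reduce r)" unfolding reduce_def by (rule bounds_reduce[OF bounds_relator[OF g(2)]])
    then have "bounds P (g @ reduce r @ winv g)" by (rule bounds_conj)
    then have "bounds P ((g @ reduce r) @ inv\<^bsub>?F\<^esub> g)"
      unfolding ig using bounds_cons_red[of P "g @ reduce r" "winv g" "[]"] by simp
    then have "bounds P (g @ foldr cons_red (reduce r) (inv\<^bsub>?F\<^esub> g))"
      using bounds_cons_red[of P g "reduce r"] by simp
    then have "bounds P (foldr cons_red g (foldr cons_red (reduce r) (inv\<^bsub>?F\<^esub> g)))"
      using bounds_cons_red[of P "[]" g] by simp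
    moreover have "h = g \<otimes>\<^bsub>?F\<^esub> (reduce r \<otimes>\<^bsub>?F\<^esub> inv\<^bsub>?F\<^esub> g)"
      unfolding g(3) by (rule F.m_assoc) (use g a in auto)
    ultimately show ?thesis using g(1) a F.m_closed[OF g(1) F.m_closed[OF a F.inv_closed[OF g(1)]]] by simp
  qed
  from w have "w \<in> generate ?F {g \<otimes>\<^bsub>?F\<^esub> a \<otimes>\<^bsub>?F\<^esub> inv\<^bsub>?F\<^esub> g | g a. g \<in> carrier ?F \<and> a \<in> reduce ` set (rels P)}"
    by (simp only: normal_closure_def)
  then show ?thesis
  proof (induction rule: generate.induct)
    case one
    show ?case using bounds_Nil by simp
  next
    case (incl h)
    then show ?case using H by blast
  next
    case (inv h)
    note h = H[OF inv.hyps]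
    show ?case using inv_free_group h bounds_reduce[OF bounds_winv] by metis
  next
    case (eng h1 h2)
    then show ?case using bounds_cons_red[of P "[]" h1 h2] bounds_append[of P h1 h2] by simp
  qed
qed

theorem corollary2p5:
  fixes P :: "'a presentation" and S :: "'a set"
  assumes "finite_presentation P"
    and "\<forall>r \<in> set (rels P). \<forall>x \<in> gens P. x \<in> fst ` set r"
    and "DR_in_all_directions P"
    and "S \<subset> gens P"
  shows "freely_generates (presented_group P) (gen_class P) S"
proof -
  let ?F = "free_group (gens P)" and ?E = "free_group S"
  define N where "N = normal_closure ?F (reduce ` set (rels P))"
  define G where "G = presented_group P"
  define \<phi> where "\<phi> = gen_class P"
  interpret F: group ?F by (rule group_free_group)
  interpret E: group ?E by (rule group_free_group)
  interpret N: normal N ?F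
    unfolding N_def by (rule F.normal_closure_normal[OF relators_in_free_group[OF assms(1)]])
  have G: "G = ?F Mod N" by (simp add: G_def presented_group_def N_def)
  interpret G: group G unfolding G by (rule N.factorgroup_is_group)
  interpret q: group_hom ?F G "\<lambda>w. N #>\<^bsub>?F\<^esub> w"
    by (rule group_hom.intro[OF F.group_axioms G.group_axioms], rule group_hom_axioms.intro)
      (unfold G, rule N.r_coset_hom_Mod)
  have \<phi>: "\<phi> x = N #>\<^bsub>?F\<^esub> [(x, True)]" for x by (simp add: \<phi>_def gen_class_def N_def)
  have sub: "w \<in> carrier ?F" if "w \<in> carrier ?E" for w
    using that assms(4) by (auto simp: in_free_group)
  have letter: "[a] \<in> carrier ?F" if "fst a \<in> gens P" for a
    using that by (auto simp: in_free_group mem_Times_iff)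
  have letter_eval: "(if snd a then \<phi> (fst a) else inv\<^bsub>G\<^esub> \<phi> (fst a)) = N #>\<^bsub>?F\<^esub> [a]" if "fst a \<in> gens P" for a
  proof (cases a)
    case (Pair x b)
    have x: "[(x, True)] \<in> carrier ?F" using letter[of "(x, True)"] that Pair by simp
    have "inv\<^bsub>?F\<^esub> [(x, True)] = [(x, False)]"
      using inv_free_group[OF x] by (simp add: winv_def inv_letter_def)
    then have "inv\<^bsub>G\<^esub> \<phi> x = N #>\<^bsub>?F\<^esub> [(x, False)]" using q.hom_inv[OF x] \<phi> by simp
    then show ?thesis using Pair \<phi> by simp
  qed
  \<comment> \<open>Evaluating a reduced word over the generators in \<open>G(P)\<close> yields its coset.\<close>
  have eval: "word_eval G \<phi> w = N #>\<^bsub>?F\<^esub> w" if "w \<in> carrier ?F" for w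
    using that
  proof (induction w)
    case Nil
    show ?case using q.hom_one by (simp add: word_eval_def)
  next
    case (Cons a w)
    then have a: "fst a \<in> gens P" and w: "w \<in> carrier ?F"
      by (auto simp: in_free_group reduced_Cons mem_Times_iff)
    have "word_eval G \<phi> (a # w) = (N #>\<^bsub>?F\<^esub> [a]) \<otimes>\<^bsub>G\<^esub> word_eval G \<phi> w"
      using letter_eval[OF a] by (simp add: word_eval_def)
    also have "\<dots> = (N #>\<^bsub>?F\<^esub> [a]) \<otimes>\<^bsub>G\<^esub> (N #>\<^bsub>?F\<^esub> w)" using Cons.IH[OF w] by simp
    also have "\<dots> = N #>\<^bsub>?F\<^esub> ([a] \<otimes>\<^bsub>?F\<^esub> w)" using q.hom_mult[OF letter[OF a] w] by simp
    also have "[a] \<otimes>\<^bsub>?F\<^esub> w = a # w"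
      using Cons.prems cons_red_reduced[of a w] by (simp add: in_free_group)
    finally show ?case .
  qed
  have \<phi>_carrier: "\<phi> x \<in> carrier G" if "x \<in> S" for x
    unfolding \<phi> by (rule q.hom_closed, rule letter) (use that assms(4) in auto)
  have hom: "word_eval G \<phi> \<in> hom ?E G"
  proof (rule homI)
    fix u v assume uv: "u \<in> carrier ?E" "v \<in> carrier ?E"
    show "word_eval G \<phi> u \<in> carrier G" using eval sub[OF uv(1)] q.hom_closed by simp
    have "u \<otimes>\<^bsub>?E\<^esub> v = u \<otimes>\<^bsub>?F\<^esub> v" by simp
    then show "word_eval G \<phi> (u \<otimes>\<^bsub>?E\<^esub> v) = word_eval G \<phi> u \<otimes>\<^bsub>G\<^esub> word_eval G \<phi> v"
      using eval sub uv q.hom_mult[of u v] F.m_closed[of u v] by metis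
  qed
  interpret e: group_hom ?E G "word_eval G \<phi>" by unfold_locales (rule hom)
  have "w = []" if w: "w \<in> carrier ?E" "word_eval G \<phi> w = \<one>\<^bsub>G\<^esub>" for w
  proof -
    have "N #>\<^bsub>?F\<^esub> w = N" using w eval[OF sub[OF w(1)]] by (simp add: G FactGroup_def)
    then have "w \<in> N" using F.rcos_self[OF sub[OF w(1)] N.subgroup_axioms] by simp
    then have "bounds P w" unfolding N_def by (rule bounds_normal_closure[OF assms(1)])
    obtain x where x: "x \<in> gens P" "x \<notin> S" using assms(4) by blast
    show ?thesis
      by (rule bounds_reduced_imp_Nil[OF \<open>bounds P w\<close> _ assms(3) x(1)])
        (use w(1) x assms(2) in \<open>auto simp: in_free_group\<close>)
  qed
  then have inj: "inj_on (word_eval G \<phi>) (carrier ?E)"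
    unfolding e.inj_on_one_iff by simp
  have "word_eval G \<phi> ` carrier ?E = generate G (\<phi> ` S)"
  proof
    have sg: "subgroup (generate G (\<phi> ` S)) G"
      by (rule G.generate_is_subgroup) (use \<phi>_carrier in auto)
    have "word_eval G \<phi> w \<in> generate G (\<phi> ` S)" if "set w \<subseteq> S \<times> UNIV" for w
      using that
    proof (induction w)
      case (Cons a w)
      then have "\<phi> (fst a) \<in> \<phi> ` S" by auto
      then have "(if snd a then \<phi> (fst a) else inv\<^bsub>G\<^esub> \<phi> (fst a)) \<in> generate G (\<phi> ` S)"
        by (simp add: generate.incl generate.inv)
      moreover have "word_eval G \<phi> w \<in> generate G (\<phi> ` S)" using Cons by simp
      ultimately show ?case using generate.eng by (fastforce simp: word_eval_def)
    qed (simp add: word_eval_def generate.one)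
    then show "word_eval G \<phi> ` carrier ?E \<subseteq> generate G (\<phi> ` S)" by (auto simp: in_free_group)
    show "generate G (\<phi> ` S) \<subseteq> word_eval G \<phi> ` carrier ?E"
    proof (rule G.generate_subgroup_incl[OF _ e.img_is_subgroup])
      show "\<phi> ` S \<subseteq> word_eval G \<phi> ` carrier ?E"
      proof
        fix y assume "y \<in> \<phi> ` S"
        then obtain x where x: "x \<in> S" "y = \<phi> x" by blast
        then have "[(x, True)] \<in> carrier ?E" by (simp add: in_free_group)
        moreover have "word_eval G \<phi> [(x, True)] = y"
          using eval[OF sub[OF \<open>[(x, True)] \<in> carrier ?E\<close>]] x(2) \<phi> by simp
        ultimately show "y \<in> word_eval G \<phi> ` carrier ?E" by blast
      qed
    qed
  qed
  then have "bij_betw (word_eval G \<phi>) (carrier ?E) (generate G (\<phi> ` S))"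
    using inj by (simp add: bij_betw_def)
  moreover from this have "word_eval G \<phi> \<in> hom ?E (G\<lparr>carrier := generate G (\<phi> ` S)\<rparr>)"
    using e.hom_mult by (intro homI) (auto dest: bij_betwE simp del: free_group_simps)
  ultimately have "word_eval G \<phi> \<in> iso ?E (G\<lparr>carrier := generate G (\<phi> ` S)\<rparr>)"
    by (simp add: iso_def)
  then show ?thesis by (simp add: freely_generates_def G_def \<phi>_def)
qed

end
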